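(* The minsum $k$-sink problem on a path network with $n$ vertices and uniform edge capacities (all edges have the same capacity $c$), as described in the context, can be solved in $O(kn\log^3 n)$ time.
   Context: A path network $P$ has vertices $v_1,\dots,v_n$ arranged left to right. Vertex $v_i$ has weight $w_i>0$, the number (amount, treated as a continuous fluid) of evacuees initially at $v_i$. Edge $e_i=(v_i,v_{i+1})$ has length $d_i>0$ and capacity $c>0$ (the same for all edges), the maximum flow rate through the edge. Every evacuee needs $\tau$ units of time to travel a unit distance. A $k$-sink solution places $k$ sinks on $P$ and partitions $P$ into $k$ subpaths, each served by one sink on it; all evacuees from a given vertex go to the same sink. All evacuees start at time $0$ and move toward their sink; evacuees leave a vertex along the outgoing edge at rate at most $c$, waiting (queueing) at the vertex when this is exceeded. The cost of a solution is the sum over all evacuees of their arrival times at their sinks, under the continuous flow model in which a group of $\lambda$ evacuees leaving a vertex at constant rate $c$ and then needing further travel time $t_0$ contributes $\lambda t_0+\lambda^2/(2c)$. The minsum $k$-sink problem asks for a solution of minimum cost (and its cost). *)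

theory Defs
  imports "HOL-Analysis.Analysis"
begin

section \<open>Path networks and evacuation flows\<close>

text \<open>
  Vertices are numbered \<open>0, \<dots>, num_vertices N - 1\<close> from left to right; edge \<open>i\<close> joins
  vertices \<open>i\<close> and \<open>i + 1\<close>. All edges share the capacity \<open>capacity N\<close>, and \<open>pace N\<close> is the
  time needed to travel a unit distance.
\<close>

record path_network =
  num_vertices :: nat
  weight :: "nat \<Rightarrow> real"
  edge_length :: "nat \<Rightarrow> real"
  capacity :: real
  pace :: real

definition path_network :: "path_network \<Rightarrow> bool" where
  "path_network N \<longleftrightarrow>
     1 \<le> num_vertices N \<and> (\<forall>i < num_vertices N. 0 < weight N i) \<and>
     (\<forall>i. Suc i < num_vertices N \<longrightarrow> 0 < edge_length N i) \<and> 0 < capacity N \<and> 0 < pace N"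

definition position :: "path_network \<Rightarrow> nat \<Rightarrow> real" where
  "position N i = (\<Sum>j<i. edge_length N j)"

text \<open>
  Flows are described by cumulative functions of time. \<open>fluid_queue c A D\<close> says that \<open>D t\<close> is
  the amount that has left a vertex by time \<open>t\<close> when \<open>A t\<close> is the amount that has become
  available there by time \<open>t\<close>: nobody leaves before being there, the flow rate is at most \<open>c\<close>,
  and it is exactly \<open>c\<close> as long as somebody is waiting.
\<close>

definition fluid_queue :: "real \<Rightarrow> (real \<Rightarrow> real) \<Rightarrow> (real \<Rightarrow> real) \<Rightarrow> bool" where
  "fluid_queue c A D \<longleftrightarrow>
     (\<forall>t. 0 \<le> D t \<and> D t \<le> A t) \<and>
     (\<forall>s t. s \<le> t \<longrightarrow> D s \<le> D t \<and> D t - D s \<le> c * (t - s)) \<and>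
     (\<forall>s t. s \<le> t \<and> (\<forall>u\<in>{s..t}. D u < A u) \<longrightarrow> D t - D s = c * (t - s))"

definition departures :: "real \<Rightarrow> (real \<Rightarrow> real) \<Rightarrow> real \<Rightarrow> real" where
  "departures c A = (THE D. fluid_queue c A D)"

lemma fluid_queue_unique:
  assumes D: "fluid_queue c A D" and E: "fluid_queue c A E" and A0: "\<And>t. t < 0 \<Longrightarrow> A t = 0"
    and c: "0 < c"
  shows "D = E"
proof -
  have le: "D t \<le> E t" if D: "fluid_queue c A D" and E: "fluid_queue c A E" for D E t
  proof (rule ccontr)
    assume "\<not> D t \<le> E t"
    then have gt: "D t > E t" by simp
    have DA: "0 \<le> D u \<and> D u \<le> A u" and EA: "0 \<le> E u \<and> E u \<le> A u" for u
      using D E by (simp_all add: fluid_queue_def)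
    have rate: "D v - D u \<le> c * (v - u)" "E v \<ge> E u" if "u \<le> v" for u v
      using D E that by (simp_all add: fluid_queue_def)
    have busy: "E v - E u = c * (v - u)" if "u \<le> v" "\<And>x. u \<le> x \<Longrightarrow> x \<le> v \<Longrightarrow> E x < A x" for u v
      using E that by (simp add: fluid_queue_def)
    define S where "S = {s. s \<le> t \<and> D s \<le> E s}"
    have m1: "-1 \<in> S"
    proof -
      have "t \<ge> 0" using gt DA[of t] EA[of t] A0[of t] by force
      then show ?thesis using DA[of "-1"] EA[of "-1"] A0[of "-1"] by (simp add: S_def)
    qed
    have bdd: "bdd_above S" by (auto simp: S_def)
    define r where "r = Sup S"
    have rt: "r \<le> t" unfolding r_def using m1 by (intro cSup_least) (auto simp: S_def)
    define e where "e = (D t - E t) / (2 * c)"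
    have e: "e > 0" using gt c by (simp add: e_def)
    then obtain s where s: "s \<in> S" "r - e < s"
      using less_cSup_iff[OF _ bdd, of "r - e"] m1 unfolding r_def by auto
    have sr: "s \<le> r" unfolding r_def using s bdd by (intro cSup_upper)
    define p where "p = min t (r + e / 2)"
    have p: "r \<le> p" "p \<le> t" "p \<le> r + e / 2" using rt e by (auto simp: p_def)
    have above: "E x < D x" if "r < x" "x \<le> t" for x
    proof (rule ccontr)
      assume "\<not> E x < D x"
      then have "x \<in> S" using that by (simp add: S_def)
      then have "x \<le> r" unfolding r_def using bdd by (intro cSup_upper)
      then show False using that by simp
    qed
    have "D t - E t \<le> D p - E p"
    proof (cases "r < t")
      case True
      then have "r < p" using e by (simp add: p_def)
      then have "E t - E p = c * (t - p)"
        using busy[of p t] p(2) above DA by (meson less_le_trans)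
      then show ?thesis using rate(1)[OF p(2)] by simp
    next
      case False
      then show ?thesis using rt p by auto
    qed
    also have "\<dots> \<le> (D s + c * (p - s)) - E s"
      using rate[of s p] sr p by simp
    also have "\<dots> \<le> c * (p - s)" using s by (simp add: S_def)
    also have "\<dots> < c * (2 * e)" using c p s e by (intro mult_strict_left_mono) auto
    also have "\<dots> = D t - E t" using c by (simp add: e_def)
    finally show False by simp
  qed
  show ?thesis using le[OF D E] le[OF E D] by (intro ext antisym)
qed

text \<open>
  An initial amount \<open>w\<close> released at time \<open>0\<close> followed by a continuous inflow determines the
  departures, and these are again a continuous inflow for the next vertex.
\<close>

lemma fluid_queue_exists:
  fixes F :: "real \<Rightarrow> real"
  assumes c: "0 < c" and w: "0 \<le> w" and F0: "\<And>t. t \<le> 0 \<Longrightarrow> F t = 0"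
    and mono: "mono F" and cont: "continuous_on UNIV F"
  defines "A \<equiv> \<lambda>t. (if t < 0 then 0 else w) + F t"
  shows "fluid_queue c A (departures c A)"
    and "\<And>t. t \<le> 0 \<Longrightarrow> departures c A t = 0"
    and "mono (departures c A)"
    and "continuous_on UNIV (departures c A)"
proof -
  have A0: "A t = 0" if "t < 0" for t using that F0 by (simp add: A_def)
  have Amono: "A s \<le> A t" if "s \<le> t" for s t
    using monoD[OF mono that] that w by (simp add: A_def)
  have Anonneg: "0 \<le> A t" for t
    using Amono[of "min t (-1)" t] A0[of "min t (-1)"] by simp
  define h where "h = (\<lambda>t. A t - c * t)"
  define g where "g = (\<lambda>t. Inf (h ` {..t}))"
  have bdd: "bdd_below (h ` {..t})" for t
  proof (rule bdd_belowI2[where m = "- c * t"])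
    fix u assume "u \<in> {..t}"
    then have "c * u \<le> c * t" using c by simp
    then show "- c * t \<le> h u" using Anonneg[of u] by (simp add: h_def)
  qed
  have gh: "g t \<le> h u" if "u \<le> t" for t u
    unfolding g_def using that bdd by (intro cInf_lower) auto
  have gI: "x \<le> g t" if "\<And>u. u \<le> t \<Longrightarrow> x \<le> h u" for x t
    unfolding g_def using that by (intro cInf_greatest) auto
  have ganti: "g t \<le> g s" if "s \<le> t" for s t using that by (intro gI gh) simp
  define D where "D = (\<lambda>t. g t + c * t)"
  have D_le: "D t \<le> A t" for t using gh[of t t] by (simp add: D_def h_def)
  have D_ge: "0 \<le> D t" for t
  proof -
    have "- c * t \<le> g t"
    proof (rule gI)
      fix u assume "u \<le> t"
      then have "c * u \<le> c * t" using c by simp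
      then show "- c * t \<le> h u" using Anonneg[of u] by (simp add: h_def)
    qed
    then show ?thesis by (simp add: D_def)
  qed
  have Dmono: "D s \<le> D t" if st: "s \<le> t" for s t
  proof -
    have "g s + c * s - c * t \<le> g t"
    proof (rule gI)
      fix u assume u: "u \<le> t"
      have cst: "c * s \<le> c * t" using st c by simp
      show "g s + c * s - c * t \<le> h u"
      proof (cases "u \<le> s")
        case True
        then show ?thesis using gh[OF True] cst by simp
      next
        case False
        then have "A s \<le> A u" "c * u \<le> c * t" using Amono u c by auto
        then show ?thesis using gh[of s s] by (simp add: h_def)
      qed
    qed
    then show ?thesis by (simp add: D_def)
  qed
  have Dlip: "D t - D s \<le> c * (t - s)" if "s \<le> t" for s t
    using ganti[OF that] by (simp add: D_def algebra_simps)
  have busy: "D t - D s = c * (t - s)" if st: "s \<le> t" and b: "\<forall>u\<in>{s..t}. D u < A u" for s t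
  proof -
    have "s \<ge> 0" using b st D_ge[of s] A0[of s] by force
    have "continuous_on {s..t} (\<lambda>u. w + F u - c * u)"
      by (intro continuous_intros continuous_on_subset[OF cont]) auto
    then have "continuous_on {s..t} h"
      by (rule continuous_on_eq) (use \<open>s \<ge> 0\<close> in \<open>auto simp: h_def A_def\<close>)
    then obtain u0 where u0: "u0 \<in> {s..t}" "\<And>u. u \<in> {s..t} \<Longrightarrow> h u0 \<le> h u"
      using continuous_attains_inf[of "{s..t}" h] st by auto
    have "g u0 < h u0" using b u0 by (force simp: D_def h_def)
    have "g s \<le> g t"
    proof (rule ccontr)
      assume "\<not> g s \<le> g t"
      have "min (g s) (h u0) \<le> g t"
      proof (rule gI)
        fix u assume "u \<le> t"
        then show "min (g s) (h u0) \<le> h u"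
          using gh[of u s] u0(2)[of u] by (cases "u \<le> s") auto
      qed
      then have "h u0 \<le> g t" using \<open>\<not> g s \<le> g t\<close> by auto
      also have "g t \<le> g u0" using u0 by (intro ganti) auto
      finally show False using \<open>g u0 < h u0\<close> by simp
    qed
    then show ?thesis using ganti[OF st] by (simp add: D_def algebra_simps)
  qed
  have D: "fluid_queue c A D"
    unfolding fluid_queue_def using D_le D_ge Dmono Dlip busy by blast
  have eq: "departures c A = D"
    unfolding departures_def using D fluid_queue_unique[OF _ D A0 c] by (intro the_equality)
  have neg: "D t = 0" if "t < 0" for t using D_le[of t] D_ge[of t] A0[OF that] by simp
  have lip: "\<bar>D t - D s\<bar> \<le> c * \<bar>t - s\<bar>" for s t
    using Dlip[of s t] Dlip[of t s] Dmono[of s t] Dmono[of t s] by (cases "s \<le> t") auto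
  have "c-lipschitz_on UNIV D"
    by (rule lipschitz_onI) (use lip c in \<open>auto simp: dist_real_def\<close>)
  then have contD: "continuous_on UNIV D" by (rule lipschitz_on_continuous_on)
  have "D 0 \<le> 0"
  proof (rule field_le_epsilon)
    fix e :: real assume "e > 0"
    then show "D 0 \<le> 0 + e" using Dlip[of "- e / c" 0] neg[of "- e / c"] c by (simp add: field_simps)
  qed
  then have "D 0 = 0" using D_ge[of 0] by simp
  then show "\<And>t. t \<le> 0 \<Longrightarrow> departures c A t = 0"
    unfolding eq using neg by (metis less_eq_real_def)
  show "fluid_queue c A (departures c A)" "mono (departures c A)"
    "continuous_on UNIV (departures c A)"
    unfolding eq using D Dmono contD by (auto intro: monoI)
qed

text \<open>
  A convoy lists the vertices on one side of a sink, the farthest one first. Each entry holds the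
  weight of the vertex and the travel time from it to the next vertex (or, for the last
  entry, to the sink). \<open>arrivals c vs F\<close> is the cumulative arrival function at the sink, where
  \<open>F\<close> is the cumulative inflow into the first vertex of \<open>vs\<close>.
\<close>

fun arrivals :: "real \<Rightarrow> (real \<times> real) list \<Rightarrow> (real \<Rightarrow> real) \<Rightarrow> real \<Rightarrow> real" where
  "arrivals c [] F = F"
| "arrivals c ((w, \<delta>) # vs) F =
     arrivals c vs (\<lambda>t. departures c (\<lambda>u. (if u < 0 then 0 else w) + F u) (t - \<delta>))"

text \<open>The sum of all arrival times is a Stieltjes integral with respect to the arrival function.\<close>

definition convoy_cost :: "real \<Rightarrow> (real \<times> real) list \<Rightarrow> real" where
  "convoy_cost c vs = (LINT t | interval_measure (arrivals c vs (\<lambda>_. 0)). t)"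

text \<open>A single group of size \<open>\<lambda>\<close> at travel time \<open>\<delta>\<close> has cost \<open>\<lambda>\<delta> + \<lambda>\<^sup>2 / 2c\<close>:\<close>

lemma convoy_cost_single:
  assumes c: "0 < c" and w: "0 < w" and \<delta>: "0 \<le> \<delta>"
  shows "convoy_cost c [(w, \<delta>)] = w * \<delta> + w\<^sup>2 / (2 * c)"
proof -
  define A :: "real \<Rightarrow> real" where "A = (\<lambda>u. (if u < 0 then 0 else w) + 0)"
  define q where "q = w / c"
  have q: "0 < q" "w = c * q" using c w by (auto simp: q_def)
  define D where "D = (\<lambda>t. c * max 0 (min q t))"
  have D: "fluid_queue c A D"
    unfolding fluid_queue_def
  proof (intro conjI allI impI)
    fix s t :: real assume st: "s \<le> t"
    then have "max 0 (min q s) \<le> max 0 (min q t)"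
      "max 0 (min q t) - max 0 (min q s) \<le> t - s" by auto
    then show "D s \<le> D t" "D t - D s \<le> c * (t - s)"
      using c by (auto simp: D_def simp flip: right_diff_distrib)
  next
    fix s t :: real assume st: "s \<le> t \<and> (\<forall>u\<in>{s..t}. D u < A u)"
    then have sA: "D s < A s" and tA: "D t < A t" by auto
    have "0 \<le> D s" using c by (simp add: D_def)
    with sA have s0: "0 \<le> s" by (simp add: A_def split: if_splits)
    then have "A t = c * q" using st q by (simp add: A_def)
    with tA have "max 0 (min q t) < q" using c by (simp add: D_def)
    then have "max 0 (min q t) = t" "max 0 (min q s) = s" using s0 st by auto
    then show "D t - D s = c * (t - s)" by (simp add: D_def algebra_simps)
  next
    fix t :: real
    show "0 \<le> D t" using c by (simp add: D_def)
    show "D t \<le> A t" using c q by (auto simp: D_def A_def)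
  qed
  have eq: "departures c A = D"
    unfolding departures_def
    by (intro the_equality D fluid_queue_unique[OF _ D _ c]) (auto simp: A_def)
  define G where "G = (\<lambda>t. D (t - \<delta>))"
  define M where "M = density lborel (\<lambda>t. ennreal (c * indicator {\<delta><..\<delta> + q} t))"
  have Gmono: "G s \<le> G t" if "s \<le> t" for s t
    using D that unfolding fluid_queue_def G_def by auto
  have Gcont: "continuous (at_right t) G" for t
    unfolding G_def D_def by (intro continuous_intros)
  have M: "emeasure M {a<..b} = emeasure (interval_measure G) {a<..b}" if ab: "a \<le> b" for a b
  proof -
    have "emeasure M {a<..b} = (\<integral>\<^sup>+ t. ennreal c * indicator ({\<delta><..\<delta> + q} \<inter> {a<..b}) t \<partial>lborel)"
      unfolding M_def using c
      by (subst emeasure_density) (auto intro!: nn_integral_cong simp: indicator_def)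
    also have "\<dots> = ennreal c * emeasure lborel {max \<delta> a<..min (\<delta> + q) b}"
      by (subst nn_integral_cmult_indicator) auto
    also have "\<dots> = ennreal (G b - G a)"
    proof -
      have "G b - G a = c * (max 0 (min q (b - \<delta>)) - max 0 (min q (a - \<delta>)))"
        by (simp add: G_def D_def algebra_simps)
      also have "max 0 (min q (b - \<delta>)) - max 0 (min q (a - \<delta>)) =
          max 0 (min (\<delta> + q) b - max \<delta> a)"
        using q(1) ab by (simp add: max_def min_def)
      finally have "G b - G a = c * max 0 (min (\<delta> + q) b - max \<delta> a)" .
      moreover have "emeasure lborel {max \<delta> a<..min (\<delta> + q) b} =
          ennreal (max 0 (min (\<delta> + q) b - max \<delta> a))"
        by (cases "max \<delta> a \<le> min (\<delta> + q) b") (auto simp: max_def)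
      ultimately show ?thesis
        using c by (simp add: ennreal_mult)
    qed
    finally show ?thesis
      using emeasure_interval_measure_Ioc[OF ab Gmono Gcont] by simp
  qed
  have "interval_measure G = M"
  proof (rule measure_eqI_generator_eq[symmetric, where E = "range (\<lambda>(a, b). {a<..b::real})"
        and A = "\<lambda>i. {- real i<..real i}" and \<Omega> = UNIV])
    show "Int_stable (range (\<lambda>(a, b). {a<..b::real}))"
      by (auto simp: Int_stable_def Int_greaterThanAtMost)
    show "emeasure M X = emeasure (interval_measure G) X"
      if "X \<in> range (\<lambda>(a, b). {a<..b})" for X
    proof -
      obtain a b where "X = {a<..b}" using \<open>X \<in> range _\<close> by auto
      then show ?thesis using M[of a b] by (cases "a \<le> b") auto
    qed
    show "(\<Union>i. {- real i<..real i}) = UNIV"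
    proof (intro equalityI subsetI UNIV_I)
      fix x :: real
      obtain i where "\<bar>x\<bar> < real i" using reals_Archimedean2 by blast
      then show "x \<in> (\<Union>i. {- real i<..real i})" by (intro UN_I[of i]) auto
    qed
    show "emeasure M {- real i<..real i} \<noteq> \<infinity>" for i
      using emeasure_interval_measure_Ioc[of "- real i" "real i" G, OF _ Gmono Gcont]
      by (subst M) auto
  qed (auto simp: M_def borel_sigma_sets_Ioc)
  then have "convoy_cost c [(w, \<delta>)] = (LINT t | M. t)"
    using eq by (simp add: convoy_cost_def G_def A_def)
  also have "\<dots> = (LINT t | lborel. indicator {\<delta><..\<delta> + q} t *\<^sub>R (c * t))"
    unfolding M_def using c
    by (subst integral_density) (auto intro!: Bochner_Integration.integral_cong simp: indicator_def)
  also have "\<dots> = (LINT t | lborel. indicator {\<delta>..\<delta> + q} t *\<^sub>R (c * t))"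
  proof (rule integral_cong_AE)
    show "AE t in lborel. indicator {\<delta><..\<delta> + q} t *\<^sub>R (c * t) =
        indicator {\<delta>..\<delta> + q} t *\<^sub>R (c * t)"
      by (rule eventually_mono[OF AE_lborel_singleton[of \<delta>]]) (auto simp: indicator_def)
  qed auto
  also have "\<dots> = c * (\<delta> + q)\<^sup>2 / 2 - c * \<delta>\<^sup>2 / 2"
    using c q by (intro integral_FTC_atLeastAtMost)
      (auto intro!: derivative_eq_intros continuous_intros
        simp: has_real_derivative_iff_has_vector_derivative[symmetric])
  also have "\<dots> = w * \<delta> + w\<^sup>2 / (2 * c)"
    using c by (simp add: q(2) power2_eq_square field_simps)
  finally show ?thesis .
qed

section \<open>The minsum k-sink problem\<close>

text \<open>
  The subpath spanned by the vertices \<open>a, \<dots>, b - 1\<close> is served by a sink at coordinate \<open>x\<close>, which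
  may be a vertex or an interior point of an edge. Vertices located at \<open>x\<close> contribute no cost.
\<close>

definition left_convoy :: "path_network \<Rightarrow> nat \<Rightarrow> nat \<Rightarrow> real \<Rightarrow> (real \<times> real) list" where
  "left_convoy N a b x =
     map (\<lambda>i. (weight N i, pace N * (min x (position N (i + 1)) - position N i)))
       (filter (\<lambda>i. position N i < x) [a..<b])"

definition right_convoy :: "path_network \<Rightarrow> nat \<Rightarrow> nat \<Rightarrow> real \<Rightarrow> (real \<times> real) list" where
  "right_convoy N a b x =
     map (\<lambda>i. (weight N i, pace N * (position N i - max x (position N (i - 1)))))
       (rev (filter (\<lambda>i. x < position N i) [a..<b]))"

definition subpath_cost :: "path_network \<Rightarrow> nat \<Rightarrow> nat \<Rightarrow> real \<Rightarrow> real" where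
  "subpath_cost N a b x =
     convoy_cost (capacity N) (left_convoy N a b x) + convoy_cost (capacity N) (right_convoy N a b x)"

text \<open>
  A solution is given by block boundaries \<open>0 = b 0 < \<dots> < b k = n\<close> and sink coordinates
  \<open>x 0, \<dots>, x (k - 1)\<close>; the \<open>j\<close>-th subpath is spanned by the vertices \<open>b j, \<dots>, b (j + 1) - 1\<close>.
\<close>

definition sink_solution :: "path_network \<Rightarrow> nat \<Rightarrow> (nat \<Rightarrow> nat) \<Rightarrow> (nat \<Rightarrow> real) \<Rightarrow> bool" where
  "sink_solution N k b x \<longleftrightarrow>
     b 0 = 0 \<and> b k = num_vertices N \<and>
     (\<forall>j<k. b j < b (Suc j) \<and> x j \<in> {position N (b j)..position N (b (Suc j) - 1)})"

definition solution_cost :: "path_network \<Rightarrow> nat \<Rightarrow> (nat \<Rightarrow> nat) \<Rightarrow> (nat \<Rightarrow> real) \<Rightarrow> real" where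
  "solution_cost N k b x = (\<Sum>j<k. subpath_cost N (b j) (b (Suc j)) (x j))"

definition minsum_solution :: "path_network \<Rightarrow> nat \<Rightarrow> (nat \<Rightarrow> nat) \<Rightarrow> (nat \<Rightarrow> real) \<Rightarrow> bool" where
  "minsum_solution N k b x \<longleftrightarrow>
     sink_solution N k b x \<and>
     (\<forall>b' x'. sink_solution N k b' x' \<longrightarrow> solution_cost N k b x \<le> solution_cost N k b' x')"

section \<open>Real RAM programs\<close>

text \<open>
  The memory consists of arrays of natural numbers and arrays of reals; a scalar variable
  is cell \<open>0\<close> of an array. Arithmetic on reals is exact, reals can only be compared, and there is no
  conversion from reals to natural numbers. A word bound \<open>B\<close> limits all natural
  numbers, including addresses and intermediate results: a step that exceeds it cannot be
  executed. This excludes encoding large amounts of data in a single number.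
\<close>

record store =
  nats :: "string \<Rightarrow> nat \<Rightarrow> nat"
  reals :: "string \<Rightarrow> nat \<Rightarrow> real"

datatype nexp =
    NConst nat | NCell string nexp
  | NPlus nexp nexp | NMinus nexp nexp | NTimes nexp nexp | NDiv nexp nexp

datatype rexp =
    RNat nexp | RCell string nexp
  | RPlus rexp rexp | RMinus rexp rexp | RTimes rexp rexp | RDiv rexp rexp

datatype bexp = NLess nexp nexp | RLess rexp rexp | BNot bexp | BAnd bexp bexp

datatype com =
    Skip | NAssign string nexp nexp | RAssign string nexp rexp
  | Seq com com | Cond bexp com com | While bexp com

fun nval :: "store \<Rightarrow> nexp \<Rightarrow> nat" where
  "nval \<sigma> (NConst m) = m"
| "nval \<sigma> (NCell a i) = nats \<sigma> a (nval \<sigma> i)"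
| "nval \<sigma> (NPlus e f) = nval \<sigma> e + nval \<sigma> f"
| "nval \<sigma> (NMinus e f) = nval \<sigma> e - nval \<sigma> f"
| "nval \<sigma> (NTimes e f) = nval \<sigma> e * nval \<sigma> f"
| "nval \<sigma> (NDiv e f) = nval \<sigma> e div nval \<sigma> f"

fun rval :: "store \<Rightarrow> rexp \<Rightarrow> real" where
  "rval \<sigma> (RNat e) = real (nval \<sigma> e)"
| "rval \<sigma> (RCell a i) = reals \<sigma> a (nval \<sigma> i)"
| "rval \<sigma> (RPlus e f) = rval \<sigma> e + rval \<sigma> f"
| "rval \<sigma> (RMinus e f) = rval \<sigma> e - rval \<sigma> f"
| "rval \<sigma> (RTimes e f) = rval \<sigma> e * rval \<sigma> f"
| "rval \<sigma> (RDiv e f) = rval \<sigma> e / rval \<sigma> f"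

fun bval :: "store \<Rightarrow> bexp \<Rightarrow> bool" where
  "bval \<sigma> (NLess e f) \<longleftrightarrow> nval \<sigma> e < nval \<sigma> f"
| "bval \<sigma> (RLess e f) \<longleftrightarrow> rval \<sigma> e < rval \<sigma> f"
| "bval \<sigma> (BNot b) \<longleftrightarrow> \<not> bval \<sigma> b"
| "bval \<sigma> (BAnd b d) \<longleftrightarrow> bval \<sigma> b \<and> bval \<sigma> d"

fun nfits :: "nat \<Rightarrow> store \<Rightarrow> nexp \<Rightarrow> bool" where
  "nfits B \<sigma> (NConst m) \<longleftrightarrow> m \<le> B"
| "nfits B \<sigma> (NCell a i) \<longleftrightarrow> nfits B \<sigma> i \<and> nats \<sigma> a (nval \<sigma> i) \<le> B"
| "nfits B \<sigma> (NPlus e f) \<longleftrightarrow> nfits B \<sigma> e \<and> nfits B \<sigma> f \<and> nval \<sigma> e + nval \<sigma> f \<le> B"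
| "nfits B \<sigma> (NMinus e f) \<longleftrightarrow> nfits B \<sigma> e \<and> nfits B \<sigma> f"
| "nfits B \<sigma> (NTimes e f) \<longleftrightarrow> nfits B \<sigma> e \<and> nfits B \<sigma> f \<and> nval \<sigma> e * nval \<sigma> f \<le> B"
| "nfits B \<sigma> (NDiv e f) \<longleftrightarrow> nfits B \<sigma> e \<and> nfits B \<sigma> f"

fun rfits :: "nat \<Rightarrow> store \<Rightarrow> rexp \<Rightarrow> bool" where
  "rfits B \<sigma> (RNat e) \<longleftrightarrow> nfits B \<sigma> e"
| "rfits B \<sigma> (RCell a i) \<longleftrightarrow> nfits B \<sigma> i"
| "rfits B \<sigma> (RPlus e f) \<longleftrightarrow> rfits B \<sigma> e \<and> rfits B \<sigma> f"
| "rfits B \<sigma> (RMinus e f) \<longleftrightarrow> rfits B \<sigma> e \<and> rfits B \<sigma> f"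
| "rfits B \<sigma> (RTimes e f) \<longleftrightarrow> rfits B \<sigma> e \<and> rfits B \<sigma> f"
| "rfits B \<sigma> (RDiv e f) \<longleftrightarrow> rfits B \<sigma> e \<and> rfits B \<sigma> f"

fun bfits :: "nat \<Rightarrow> store \<Rightarrow> bexp \<Rightarrow> bool" where
  "bfits B \<sigma> (NLess e f) \<longleftrightarrow> nfits B \<sigma> e \<and> nfits B \<sigma> f"
| "bfits B \<sigma> (RLess e f) \<longleftrightarrow> rfits B \<sigma> e \<and> rfits B \<sigma> f"
| "bfits B \<sigma> (BNot b) \<longleftrightarrow> bfits B \<sigma> b"
| "bfits B \<sigma> (BAnd b d) \<longleftrightarrow> bfits B \<sigma> b \<and> bfits B \<sigma> d"

definition nwrite :: "string \<Rightarrow> nat \<Rightarrow> nat \<Rightarrow> store \<Rightarrow> store" where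
  "nwrite a i m \<sigma> = \<sigma>\<lparr>nats := (nats \<sigma>)(a := (nats \<sigma> a)(i := m))\<rparr>"

definition rwrite :: "string \<Rightarrow> nat \<Rightarrow> real \<Rightarrow> store \<Rightarrow> store" where
  "rwrite a i r \<sigma> = \<sigma>\<lparr>reals := (reals \<sigma>)(a := (reals \<sigma> a)(i := r))\<rparr>"

text \<open>
  \<open>runs B p \<sigma> t \<sigma>'\<close>: started in \<open>\<sigma>\<close>, program \<open>p\<close> halts in \<open>\<sigma>'\<close> after \<open>t\<close> assignments and tests.
  The size of each expression is fixed by the program and independent of the input, so
  counting every single arithmetic operation would change \<open>t\<close> by a constant factor only.
\<close>

inductive runs :: "nat \<Rightarrow> com \<Rightarrow> store \<Rightarrow> nat \<Rightarrow> store \<Rightarrow> bool" for B where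
  Skip: "runs B Skip \<sigma> 1 \<sigma>"
| NAssign: "nfits B \<sigma> i \<Longrightarrow> nfits B \<sigma> e \<Longrightarrow>
    runs B (NAssign a i e) \<sigma> 1 (nwrite a (nval \<sigma> i) (nval \<sigma> e) \<sigma>)"
| RAssign: "nfits B \<sigma> i \<Longrightarrow> rfits B \<sigma> e \<Longrightarrow>
    runs B (RAssign a i e) \<sigma> 1 (rwrite a (nval \<sigma> i) (rval \<sigma> e) \<sigma>)"
| Seq: "runs B p \<sigma> t \<sigma>' \<Longrightarrow> runs B q \<sigma>' u \<sigma>'' \<Longrightarrow> runs B (Seq p q) \<sigma> (t + u) \<sigma>''"
| CondTrue: "bfits B \<sigma> b \<Longrightarrow> bval \<sigma> b \<Longrightarrow> runs B p \<sigma> t \<sigma>' \<Longrightarrow> runs B (Cond b p q) \<sigma> (Suc t) \<sigma>'"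
| CondFalse: "bfits B \<sigma> b \<Longrightarrow> \<not> bval \<sigma> b \<Longrightarrow> runs B q \<sigma> t \<sigma>' \<Longrightarrow> runs B (Cond b p q) \<sigma> (Suc t) \<sigma>'"
| WhileFalse: "bfits B \<sigma> b \<Longrightarrow> \<not> bval \<sigma> b \<Longrightarrow> runs B (While b p) \<sigma> 1 \<sigma>"
| WhileTrue: "bfits B \<sigma> b \<Longrightarrow> bval \<sigma> b \<Longrightarrow> runs B p \<sigma> t \<sigma>' \<Longrightarrow>
    runs B (While b p) \<sigma>' u \<sigma>'' \<Longrightarrow> runs B (While b p) \<sigma> (Suc (t + u)) \<sigma>''"

text \<open>Only the relevant entries of the weight and length functions are loaded into the memory.\<close>

definition input_store :: "path_network \<Rightarrow> nat \<Rightarrow> store" where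
  "input_store N k =
     \<lparr>nats = (\<lambda>a i. if a = ''n'' \<and> i = 0 then num_vertices N
                    else if a = ''k'' \<and> i = 0 then k else 0),
      reals = (\<lambda>a i. if a = ''c'' \<and> i = 0 then capacity N
                     else if a = ''tau'' \<and> i = 0 then pace N
                     else if a = ''w'' \<and> i < num_vertices N then weight N i
                     else if a = ''d'' \<and> Suc i < num_vertices N then edge_length N i else 0)\<rparr>"

definition solved_store :: "path_network \<Rightarrow> nat \<Rightarrow> store \<Rightarrow> bool" where
  "solved_store N k \<sigma> \<longleftrightarrow>
     minsum_solution N k (nats \<sigma> ''boundary'') (reals \<sigma> ''sink'') \<and>
     reals \<sigma> ''cost'' 0 = solution_cost N k (nats \<sigma> ''boundary'') (reals \<sigma> ''sink'')"

text \<open>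
  The program and the constants are uniform in \<open>n\<close>, \<open>k\<close> and the network. As \<open>log 2 1 = 0\<close>, the time
  bound is imposed for \<open>n \<ge> 2\<close> only. The word bound is polynomial, i.e. words have \<open>O(log n)\<close> bits.
\<close>

definition solves_minsum_in_time :: "com \<Rightarrow> (nat \<Rightarrow> nat \<Rightarrow> real) \<Rightarrow> bool" where
  "solves_minsum_in_time p T \<longleftrightarrow>
     (\<exists>d. \<exists>C::real. \<forall>N k. path_network N \<longrightarrow> 1 \<le> k \<longrightarrow> k \<le> num_vertices N \<longrightarrow>
        (\<exists>t \<sigma>. runs ((num_vertices N + 1) ^ d) p (input_store N k) t \<sigma> \<and> solved_store N k \<sigma> \<and>
           (2 \<le> num_vertices N \<longrightarrow> real t \<le> C * T k (num_vertices N))))"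

end

theory Submission
  imports Defs
begin

text \<open>
  With uniform capacities nobody has to queue before the sink: the arrivals at the sink are those of
  a single FIFO server fed by all vertices at their undisturbed travel times. So the start of vertex
  \<open>m\<close>, served by a sink at \<open>x < m\<close>, is \<open>S m / c - q x + max {U j | x < j \<le> m}\<close> with
  \<open>U j = q j - S j / c\<close>, for travel times \<open>q\<close> and prefix sums \<open>S\<close> of the weights. With suffix sums of
  the running maxima of \<open>U\<close> and binary lifting along the chains of next greater elements of \<open>U\<close>, the
  cost of any one-sided evacuation is computed in time \<open>O(log n)\<close>. The cost is affine in the sink
  position inside an edge, so sinks can be placed at vertices. The dynamic program with two layers
  per sink (first vertex to sink, sink to last vertex) has Monge cost matrices; hence the leftmost
  optimal columns are monotone, and a layer is filled with \<open>O(n log n)\<close> cost queries by treating the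
  rows that are odd multiples of \<open>2\<^sup>l\<close> for decreasing \<open>l\<close>, each between the optimal columns of
  its two neighbours that are already known.
\<close>

section \<open>Queues with uniform capacity\<close>

text \<open>The queues collapse into one because servers of equal rate in series are redundant: a
  second server of rate \<open>c\<close> changes only the time from which service is free
  (\<open>serve_serve\<close>). Servers also commute with travel delays
  (\<open>delay_serve\<close>), so all waiting can be shifted to the sink. The obstacle for fast
  cost queries is that the running maximum of \<open>U\<close> starts next to the sink, so plain
  prefix sums do not give its partial sums. They are recovered as \<open>P a - P m\<close>, where
  \<open>m\<close> has to lie on the chain of next greater elements of \<open>a\<close>; this is why
  a query must search for \<open>m\<close>. A layer is a triangle \<open>h \<le> i\<close>, and the
  Monge inequality is available only inside it. The exchange argument for monotone columns stays
  within that triangle. Programs have neither recursion nor a stack: strides by powers of two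
  replace divide and conquer, and the chains themselves serve as the stack when next greater
  elements are computed. The resulting time is O(k n log^2 n) for n at least 2, one logarithm below
  the required bound.\<close>

definition ramp :: "real \<Rightarrow> real \<Rightarrow> real \<Rightarrow> real \<Rightarrow> real" where
  "ramp c s w t = c * max 0 (min (w / c) (t - s))"

lemma ramp_eq_0: "t \<le> s \<Longrightarrow> ramp c s w t = 0"
  by (simp add: ramp_def)

lemma ramp_full: "0 < c \<Longrightarrow> 0 < w \<Longrightarrow> s + w / c \<le> t \<Longrightarrow> ramp c s w t = w"
  by (simp add: ramp_def min_def max_def)

lemma ramp_mono: "0 < c \<Longrightarrow> t \<le> u \<Longrightarrow> ramp c s w t \<le> ramp c s w u"
  unfolding ramp_def by (intro mult_left_mono) auto

lemma ramp_antimono_start: "0 < c \<Longrightarrow> s \<le> z \<Longrightarrow> ramp c z w t \<le> ramp c s w t"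
  unfolding ramp_def by (intro mult_left_mono) auto

lemma ramp_nonneg: "0 < c \<Longrightarrow> 0 \<le> ramp c s w t"
  by (simp add: ramp_def)

lemma ramp_less: "0 < c \<Longrightarrow> 0 < w \<Longrightarrow> ramp c s w t < w \<longleftrightarrow> t < s + w / c"
  unfolding ramp_def by (auto simp: field_simps min_def max_def)

lemma ramp_le: "0 < c \<Longrightarrow> 0 < w \<Longrightarrow> ramp c s w t \<le> w"
  unfolding ramp_def by (auto simp: field_simps min_def max_def)

text \<open>First in, first out: the new stream \<open>X\<close> starts when the old arrivals are
  complete, and it leaves as a \<open>ramp\<close> at full rate from \<open>max s f\<close>, when
  the old backlog is gone. Bounding \<open>X\<close> from below only by \<open>ramp c s w\<close>
  covers both a weight released at one instant and an inflow of rate \<open>c\<close>.\<close>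

lemma fluid_queue_append:
  assumes c: "0 < c" and w: "0 < w" and fq: "fluid_queue c A D"
    and A: "\<And>t. s \<le> t \<Longrightarrow> A t = W" and D: "\<And>t. f \<le> t \<Longrightarrow> D t = W"
    and D_less: "\<And>t. s \<le> t \<Longrightarrow> t < f \<Longrightarrow> D t < W"
    and X0: "\<And>t. t < s \<Longrightarrow> X t = 0" and X: "\<And>t. ramp c s w t \<le> X t" "\<And>t. X t \<le> w"
  shows "fluid_queue c (\<lambda>t. A t + X t) (\<lambda>t. D t + ramp c (max s f) w t)"
proof -
  define z where "z = max s f"
  have DA: "0 \<le> D t" "D t \<le> A t" for t using fq by (simp_all add: fluid_queue_def)
  have mono: "D u \<le> D v" and rate: "D v - D u \<le> c * (v - u)" if "u \<le> v" for u v
    using fq that by (simp_all add: fluid_queue_def)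
  have busy: "D v - D u = c * (v - u)" if "u \<le> v" "\<And>x. u \<le> x \<Longrightarrow> x \<le> v \<Longrightarrow> D x < A x" for u v
    using fq that by (simp add: fluid_queue_def)
  \<comment> \<open>The old departures change only before \<open>z\<close> and the new ones only
    after it; splitting an interval at \<open>z\<close> treats the two separately.\<close>
  have Dmin: "D t = D (min t z)" for t
    using D[of t] D[of z] by (cases "t \<le> z") (auto simp: z_def min_def)
  have minmax: "c * (min v z - min u z) + c * (max v z - max u z) = c * (v - u)" for u v :: real
    by (auto simp: min_def max_def algebra_simps)
  have ramp_rate: "ramp c z w v - ramp c z w u \<le> c * (max v z - max u z)" if "u \<le> v" for u v
  proof -
    have "max 0 (min (w / c) (v - z)) - max 0 (min (w / c) (u - z)) \<le> max v z - max u z"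
      using that by auto
    then show ?thesis using c unfolding ramp_def by (simp flip: right_diff_distrib)
  qed
  show ?thesis
    unfolding fluid_queue_def z_def[symmetric]
  proof (intro conjI allI impI)
    fix t show "0 \<le> D t + ramp c z w t" using DA ramp_nonneg[OF c] by simp
    show "D t + ramp c z w t \<le> A t + X t"
      using DA(2)[of t] X(1)[of t] ramp_antimono_start[OF c, of s z w t] by (simp add: z_def)
  next
    fix u v :: real assume uv: "u \<le> v"
    show "D u + ramp c z w u \<le> D v + ramp c z w v"
      using mono[OF uv] ramp_mono[OF c uv] by (rule add_mono)
    have "D v - D u \<le> c * (min v z - min u z)"
      unfolding Dmin[of v] Dmin[of u] using uv by (intro rate) auto
    then show "D v + ramp c z w v - (D u + ramp c z w u) \<le> c * (v - u)"
      using ramp_rate[OF uv] minmax[of v u] by linarith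
  next
    fix u v :: real
    assume "u \<le> v \<and> (\<forall>x\<in>{u..v}. D x + ramp c z w x < A x + X x)"
    then have uv: "u \<le> v" and b: "\<And>x. u \<le> x \<Longrightarrow> x \<le> v \<Longrightarrow> D x + ramp c z w x < A x + X x"
      by auto
    have waiting: "D x < A x" if "u \<le> x" "x \<le> v" "x < z" for x
    proof (cases "x < s")
      case True
      then show ?thesis using b[OF that(1,2)] that X0 by (simp add: ramp_eq_0)
    next
      case False
      then show ?thesis using that A[of x] D_less[of x] by (auto simp: z_def)
    qed
    have 1: "D (min v z) - D (min u z) = c * (min v z - min u z)"
    proof (cases "u < z")
      case True
      show ?thesis
      proof (cases "v < z")
        case True
        then show ?thesis using uv waiting by (simp add: busy)
      next
        case False
        \<comment> \<open>At \<open>z\<close> itself the old queue may already be empty, so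
          \<open>busy\<close> applies only up to points \<open>x < z\<close>; an \<open>x\<close>
          close enough to \<open>z\<close> refutes any loss of rate.\<close>
        have "\<not> D z - D u < c * (z - u)"
        proof
          assume "D z - D u < c * (z - u)"
          then have "u + (D z - D u) / c < z" using c by (simp add: field_simps)
          then obtain x where x: "u + (D z - D u) / c < x" "x < z" using dense by blast
          have "0 \<le> (D z - D u) / c" using mono[of u z] True c by simp
          with x have ux: "u \<le> x" by linarith
          have "D x - D u = c * (x - u)"
            using ux x False by (intro busy waiting) auto
          moreover have "D z - D u < c * (x - u)" using x c by (simp add: field_simps)
          moreover have "D x \<le> D z" using x by (intro mono) simp
          ultimately show False by simp
        qed
        then show ?thesis using rate[of u z] True False by (simp add: min_def)
      qed
    qed (use uv in auto)
    have 2: "ramp c z w v - ramp c z w u = c * (max v z - max u z)"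
    proof (cases "v \<le> z")
      case True
      then show ?thesis using uv by (simp add: ramp_eq_0)
    next
      case False
      then have "ramp c z w v < w"
        using b[OF uv order_refl] A[of v] D[of v] X(2)[of v] by (simp add: z_def)
      then have "v < z + w / c" using ramp_less[OF c w] by simp
      then show ?thesis using False uv by (auto simp: ramp_def max_def min_def algebra_simps)
    qed
    have "D v - D u = c * (min v z - min u z)"
      unfolding Dmin[of v] Dmin[of u] by (rule 1)
    then show "D v + ramp c z w v - (D u + ramp c z w u) = c * (v - u)"
      using 2 minmax[of v u] by linarith
  qed
qed

section \<open>Service of released groups in order\<close>

definition outflow :: "real \<Rightarrow> (real \<times> real) list \<Rightarrow> real \<Rightarrow> real" where
  "outflow c js t = (\<Sum>(s, w)\<leftarrow>js. ramp c s w t)"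

lemma outflow_simps [simp]:
  "outflow c [] = (\<lambda>t. 0)" "outflow c ((s, w) # js) = (\<lambda>t. ramp c s w t + outflow c js t)"
  by (auto simp: outflow_def)

text \<open>\<open>f\<close> is the time from which the server is free. Release times are turned
  into start times.\<close>

fun serve :: "real \<Rightarrow> real \<Rightarrow> (real \<times> real) list \<Rightarrow> (real \<times> real) list" where
  "serve c f [] = []"
| "serve c f ((s, w) # js) = (max s f, w) # serve c (max s f + w / c) js"

text \<open>Service intervals follow each other without overlap, which keeps the total rate of the
  ramps at most \<open>c\<close>.\<close>

fun separated :: "real \<Rightarrow> real \<Rightarrow> (real \<times> real) list \<Rightarrow> bool" where
  "separated c z [] \<longleftrightarrow> True"
| "separated c z ((s, w) # js) \<longleftrightarrow> z \<le> s \<and> 0 < w \<and> separated c (s + w / c) js"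

text \<open>The groups are appended one at a time. Throughout, \<open>W\<close> is the amount
  handled so far, all of it has arrived by \<open>z\<close>, and \<open>f\<close> is the moment when
  the server has finished it; both moments advance with each group.\<close>

lemma fluid_queue_serve:
  assumes "0 < c" "fluid_queue c A D" "separated c z js"
    "\<And>t. z \<le> t \<Longrightarrow> A t = W" "\<And>t. f \<le> t \<Longrightarrow> D t = W" "\<And>t. z \<le> t \<Longrightarrow> t < f \<Longrightarrow> D t < W"
  shows "fluid_queue c (\<lambda>t. A t + outflow c js t) (\<lambda>t. D t + outflow c (serve c f js) t)"
  using assms
proof (induction js arbitrary: A D W f z)
  case (Cons sw js)
  obtain s w where sw: "sw = (s, w)" by fastforce
  let ?s = "max s f"
  note c = Cons.prems(1)
  have s: "z \<le> s" "0 < w" "separated c (s + w / c) js" using Cons.prems(3) sw by auto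
  have "fluid_queue c (\<lambda>t. A t + ramp c s w t) (\<lambda>t. D t + ramp c ?s w t)"
    using Cons.prems s by (intro fluid_queue_append[where W = W]) (auto simp: ramp_eq_0 ramp_le)
  then have "fluid_queue c (\<lambda>t. (A t + ramp c s w t) + outflow c js t)
      (\<lambda>t. (D t + ramp c ?s w t) + outflow c (serve c (?s + w / c) js) t)"
  proof (rule Cons.IH[OF c _ s(3), where W = "W + w"])
    have q: "0 < w / c" using c s by simp
    show "A t + ramp c s w t = W + w" if "s + w / c \<le> t" for t
    proof -
      have "z \<le> t" using s(1) q that by linarith
      then show ?thesis using that s c Cons.prems(4)[of t] by (simp add: ramp_full)
    qed
    show "D t + ramp c ?s w t = W + w" if "?s + w / c \<le> t" for t
    proof -
      have "f \<le> t" using q that by linarith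
      then show ?thesis using that s c Cons.prems(5)[of t] by (simp add: ramp_full)
    qed
    show "D t + ramp c ?s w t < W + w" if "s + w / c \<le> t" "t < ?s + w / c" for t
    proof -
      have "ramp c ?s w t < w" using ramp_less[OF c s(2)] that by simp
      moreover have "D t \<le> W"
        using Cons.prems(5)[of t] Cons.prems(6)[of t] that s q by (cases "f \<le> t") auto
      ultimately show ?thesis by simp
    qed
  qed
  then show ?case by (simp add: sw add.assoc)
qed simp

lemma separated_serve: "0 < c \<Longrightarrow> \<forall>(s, w) \<in> set js. 0 < w \<Longrightarrow> separated c f (serve c f js)"
  by (induction js arbitrary: f) auto

text \<open>A start is the maximum of a release time and a free time, and both servers need the same
  \<open>w / c\<close> per group, so the next group sees again a maximum of two free times. Here the
  equality of the capacities enters.\<close>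

lemma serve_serve: "0 < c \<Longrightarrow> serve c g (serve c f js) = serve c (max f g) js"
proof (induction js arbitrary: f g)
  case (Cons sw js)
  obtain s w where sw: "sw = (s, w)" by fastforce
  have "max (max s f + w / c) (max s (max f g) + w / c) = max s (max f g) + w / c" by simp
  then show ?case using Cons by (simp add: sw max.assoc)
qed simp

definition delay :: "real \<Rightarrow> (real \<times> real) list \<Rightarrow> (real \<times> real) list" where
  "delay \<delta> js = map (\<lambda>(s, w). (s + \<delta>, w)) js"

lemma delay_serve: "delay \<delta> (serve c f js) = serve c (f + \<delta>) (delay \<delta> js)"
proof (induction js arbitrary: f)
  case (Cons sw js)
  obtain s w where sw: "sw = (s, w)" by fastforce
  have "max (s + \<delta>) (f + \<delta>) = max s f + \<delta>" by simp
  with Cons[of "max s f + w / c"] show ?case by (simp add: sw delay_def add_ac)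
qed (simp add: delay_def)

lemma outflow_delay: "outflow c js (t - \<delta>) = outflow c (delay \<delta> js) t"
  by (induction js) (auto simp: delay_def ramp_def algebra_simps)

lemma outflow_nonpos: "0 < c \<Longrightarrow> separated c 0 js \<Longrightarrow> t \<le> 0 \<Longrightarrow> outflow c js t = 0"
proof -
  have "outflow c js t = 0" if "0 < c" "separated c z js" "t \<le> z" for z
    using that
  proof (induction js arbitrary: z)
    case (Cons sw js)
    obtain s w where sw: "sw = (s, w)" by fastforce
    have "0 < w / c" using Cons sw by simp
    moreover have "outflow c js t = 0" 
    proof (rule Cons.IH)
      show "0 < c" "separated c (s + w / c) js" using Cons.prems sw by auto
      have "z \<le> s" using Cons.prems sw by simp
      then show "t \<le> s + w / c" using Cons.prems(3) \<open>0 < w / c\<close> by linarith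
    qed
    ultimately show ?case using Cons.prems sw by (simp add: ramp_eq_0)
  qed simp
  then show "0 < c \<Longrightarrow> separated c 0 js \<Longrightarrow> t \<le> 0 \<Longrightarrow> outflow c js t = 0" by blast
qed

text \<open>The weight of the vertex itself is first in line at time 0, so the inflow finds a server
  that is free from \<open>w / c\<close>.\<close>

lemma departures_eq:
  assumes c: "0 < c" and w: "0 < w" and js: "separated c 0 js"
  shows "departures c (\<lambda>u. (if u < 0 then 0 else w) + outflow c js u) =
    outflow c ((0, w) # serve c (w / c) js)"
proof -
  let ?X = "\<lambda>u::real. if u < 0 then 0 else w"
  have "fluid_queue c (\<lambda>t. 0 + ?X t) (\<lambda>t. 0 + ramp c (max 0 0) w t)"
    using c w by (intro fluid_queue_append[where W = 0])
      (auto simp: fluid_queue_def ramp_eq_0 ramp_le)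
  then have "fluid_queue c ?X (ramp c 0 w)" by simp
  then have "fluid_queue c (\<lambda>t. ?X t + outflow c js t) (\<lambda>t. ramp c 0 w t + outflow c (serve c (w / c) js) t)"
    by (rule fluid_queue_serve[OF c _ js, where W = w]) (use c w in \<open>auto simp: ramp_full ramp_less\<close>)
  moreover have "?X t + outflow c js t = 0" if "t < 0" for t
    using that outflow_nonpos[OF c js] by simp
  ultimately show ?thesis
    unfolding departures_def
    by (intro the_equality) (simp_all add: fluid_queue_unique[OF _ _ _ c])
qed

text \<open>Jobs are pairs of a release time and a weight; the job of the vertex nearest to the sink comes first.\<close>

fun releases :: "(real \<times> real) list \<Rightarrow> (real \<times> real) list \<Rightarrow> (real \<times> real) list" where
  "releases [] js = js"
| "releases ((w, \<delta>) # vs) js = releases vs (delay \<delta> ((0, w) # js))"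

text \<open>The inflow of each vertex is kept in the form \<open>serve c 0 js\<close> with
  undisturbed release times \<open>js\<close>: the server at the vertex is merged with the one
  before it and then moved past the travel delay.\<close>

lemma arrivals_eq:
  assumes "0 < c" "\<forall>(w, \<delta>) \<in> set vs. 0 < w \<and> 0 \<le> \<delta>" "\<forall>(s, w) \<in> set js. 0 < w \<and> 0 \<le> s"
  shows "arrivals c vs (outflow c (serve c 0 js)) = outflow c (serve c 0 (releases vs js))"
  using assms
proof (induction vs arbitrary: js)
  case (Cons v vs)
  obtain w \<delta> where v: "v = (w, \<delta>)" by fastforce
  have w: "0 < w" "0 \<le> \<delta>" using Cons.prems v by auto
  have q: "0 < w / c" using w Cons.prems by simp
  have sep: "separated c 0 (serve c 0 js)" using Cons.prems by (intro separated_serve) auto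
  have "(0, w) # serve c (w / c) (serve c 0 js) = serve c 0 ((0, w) # js)"
    using q Cons.prems by (simp add: serve_serve)
  then have "departures c (\<lambda>u. (if u < 0 then 0 else w) + outflow c (serve c 0 js) u) =
      outflow c (serve c 0 ((0, w) # js))"
    using departures_eq[OF Cons.prems(1) w(1) sep] by simp
  moreover have "(\<lambda>t. outflow c (serve c 0 ((0, w) # js)) (t - \<delta>)) =
      outflow c (serve c \<delta> (delay \<delta> ((0, w) # js)))"
    by (intro ext) (simp only: outflow_delay delay_serve add_0)
  \<comment> \<open>The first group is now released at \<open>\<delta>\<close>, so no start changes
    if the server is already free at time 0.\<close>
  moreover have "serve c \<delta> (delay \<delta> ((0, w) # js)) = serve c 0 (delay \<delta> ((0, w) # js))"
    using w by (simp add: delay_def)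
  moreover have "arrivals c vs (outflow c (serve c 0 (delay \<delta> ((0, w) # js)))) =
      outflow c (serve c 0 (releases vs (delay \<delta> ((0, w) # js))))"
    using Cons.prems w by (intro Cons.IH) (auto simp: delay_def v)
  ultimately show ?case by (simp add: v)
qed simp

section \<open>The distribution of arrival times\<close>

definition flow_density :: "real \<Rightarrow> (real \<times> real) list \<Rightarrow> real \<Rightarrow> real" where
  "flow_density c js t = (\<Sum>(s, w)\<leftarrow>js. c * indicator {s<..s + w / c} t)"

lemma flow_density_simps [simp]:
  "flow_density c [] = (\<lambda>t. 0)"
  "flow_density c ((s, w) # js) = (\<lambda>t. c * indicator {s<..s + w / c} t + flow_density c js t)"
  by (auto simp: flow_density_def)

lemma flow_density_nonneg: "0 < c \<Longrightarrow> 0 \<le> flow_density c js t"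
  by (induction js) (auto simp: indicator_def)

lemma flow_density_measurable [measurable]: "flow_density c js \<in> borel_measurable borel"
  by (induction js) auto

lemma outflow_mono: "0 < c \<Longrightarrow> a \<le> b \<Longrightarrow> outflow c js a \<le> outflow c js b"
  by (induction js) (auto intro!: add_mono ramp_mono)

text \<open>Each group has constant density \<open>c\<close> on its service interval, and a ramp is
  the integral of that density.\<close>

lemma nn_integral_flow_density:
  assumes c: "0 < c" and js: "\<forall>(s, w) \<in> set js. 0 < w" and ab: "a \<le> b"
  shows "(\<integral>\<^sup>+ t. ennreal (flow_density c js t) * indicator {a<..b} t \<partial>lborel) =
    ennreal (outflow c js b - outflow c js a)"
  using js
proof (induction js)
  case (Cons sw js)
  obtain s w where sw: "sw = (s, w)" by fastforce
  define q where "q = w / c"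
  have q: "0 < q" using c Cons.prems sw by (simp add: q_def)
  have "(\<integral>\<^sup>+ t. ennreal (flow_density c (sw # js) t) * indicator {a<..b} t \<partial>lborel) =
    (\<integral>\<^sup>+ t. ennreal c * indicator ({s<..s + q} \<inter> {a<..b}) t +
        ennreal (flow_density c js t) * indicator {a<..b} t \<partial>lborel)"
    using c flow_density_nonneg[OF c, of js]
    by (intro nn_integral_cong) (auto simp: sw q_def indicator_def simp flip: ennreal_plus)
  also have "\<dots> = (\<integral>\<^sup>+ t. ennreal c * indicator ({s<..s + q} \<inter> {a<..b}) t \<partial>lborel) +
      ennreal (outflow c js b - outflow c js a)"
    using Cons by (subst nn_integral_add) auto
  also have "(\<integral>\<^sup>+ t. ennreal c * indicator ({s<..s + q} \<inter> {a<..b}) t \<partial>lborel) =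
      ennreal c * emeasure lborel {max s a<..min (s + q) b}"
    by (subst nn_integral_cmult_indicator) auto
  also have "\<dots> = ennreal (ramp c s w b - ramp c s w a)"
  proof -
    have "ramp c s w b - ramp c s w a = c * (max 0 (min q (b - s)) - max 0 (min q (a - s)))"
      by (simp add: ramp_def q_def algebra_simps)
    also have "max 0 (min q (b - s)) - max 0 (min q (a - s)) = max 0 (min (s + q) b - max s a)"
      using q ab by (simp add: max_def min_def)
    finally have "ramp c s w b - ramp c s w a = c * max 0 (min (s + q) b - max s a)" .
    moreover have "emeasure lborel {max s a<..min (s + q) b} =
        ennreal (max 0 (min (s + q) b - max s a))"
      by (cases "max s a \<le> min (s + q) b") (auto simp: max_def)
    ultimately show ?thesis using c by (simp add: ennreal_mult)
  qed
  also have "\<dots> + ennreal (outflow c js b - outflow c js a) =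
      ennreal (outflow c (sw # js) b - outflow c (sw # js) a)"
    using ramp_mono[OF c ab] outflow_mono[OF c ab]
    by (subst ennreal_plus[symmetric]) (auto simp: sw algebra_simps)
  finally show ?case .
qed simp

lemma interval_measure_outflow:
  assumes c: "0 < c" and js: "\<forall>(s, w) \<in> set js. 0 < w"
  shows "interval_measure (outflow c js) = density lborel (\<lambda>t. ennreal (flow_density c js t))"
    (is "_ = ?M")
proof -
  have cont: "continuous (at_right t) (outflow c js)" for t
    by (induction js) (auto simp: ramp_def intro!: continuous_intros)
  have fin: "emeasure (interval_measure (outflow c js)) {a<..b} =
      ennreal (outflow c js b - outflow c js a)" if "a \<le> b" for a b
    using that by (intro emeasure_interval_measure_Ioc outflow_mono c cont)
  have M: "emeasure ?M {a<..b} = emeasure (interval_measure (outflow c js)) {a<..b}"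
    if "a \<le> b" for a b
    using that by (subst emeasure_density) (auto simp: fin nn_integral_flow_density[OF c js])
  show ?thesis
  proof (rule measure_eqI_generator_eq[symmetric, where E = "range (\<lambda>(a, b). {a<..b::real})"
        and A = "\<lambda>i. {- real i<..real i}" and \<Omega> = UNIV])
    show "Int_stable (range (\<lambda>(a, b). {a<..b::real}))"
      by (auto simp: Int_stable_def Int_greaterThanAtMost)
    show "emeasure ?M X = emeasure (interval_measure (outflow c js)) X"
      if "X \<in> range (\<lambda>(a, b). {a<..b})" for X
    proof -
      obtain a b where "X = {a<..b}" using \<open>X \<in> range _\<close> by auto
      then show ?thesis using M[of a b] by (cases "a \<le> b") auto
    qed
    show "(\<Union>i. {- real i<..real i}) = UNIV"
    proof (intro equalityI subsetI UNIV_I)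
      fix x :: real
      obtain i where "\<bar>x\<bar> < real i" using reals_Archimedean2 by blast
      then show "x \<in> (\<Union>i. {- real i<..real i})" by (intro UN_I[of i]) auto
    qed
    show "emeasure ?M {- real i<..real i} \<noteq> \<infinity>" for i
      using fin[of "- real i" "real i"] by (subst M) auto
  qed (auto simp: borel_sigma_sets_Ioc)
qed

text \<open>A group contributes the integral of \<open>c * t\<close> from \<open>s\<close> to
  \<open>s + w / c\<close>, which is the cost prescribed by the flow model.\<close>

lemma has_integral_flow_density:
  assumes c: "0 < c" and js: "\<forall>(s, w) \<in> set js. 0 < w"
  shows "has_bochner_integral lborel (\<lambda>t. flow_density c js t * t)
    (\<Sum>(s, w)\<leftarrow>js. w * s + w\<^sup>2 / (2 * c))"
  using js
proof (induction js)
  case (Cons sw js)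
  obtain s w where sw: "sw = (s, w)" by fastforce
  define q where "q = w / c"
  have q: "0 < q" "w = c * q" using c Cons.prems sw by (simp_all add: q_def)
  have "has_bochner_integral lborel (\<lambda>t. (c * t) * indicator {s..s + q} t)
      (c * (s + q)\<^sup>2 / 2 - c * s\<^sup>2 / 2)"
    using c q by (intro has_bochner_integral_FTC_Icc_real)
      (auto intro!: derivative_eq_intros continuous_intros
        simp: has_real_derivative_iff_has_vector_derivative[symmetric])
  moreover have "c * (s + q)\<^sup>2 / 2 - c * s\<^sup>2 / 2 = w * s + w\<^sup>2 / (2 * c)"
    using c by (simp add: q(2) power2_eq_square field_simps)
  moreover have "AE t in lborel. c * t * indicator {s..s + q} t = c * indicator {s<..s + q} t * t"
    by (rule eventually_mono[OF AE_lborel_singleton[of s]]) (auto simp: indicator_def)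
  ultimately have "has_bochner_integral lborel (\<lambda>t. c * indicator {s<..s + q} t * t)
      (w * s + w\<^sup>2 / (2 * c))"
    by (subst has_bochner_integral_cong_AE[symmetric]) auto
  from has_bochner_integral_add[OF this Cons.IH] Cons.prems show ?case
    by (simp add: sw q_def algebra_simps)
qed (simp add: has_bochner_integral_zero)

section \<open>The cost of a one-sided evacuation\<close>

definition service_cost :: "real \<Rightarrow> (real \<times> real) list \<Rightarrow> real" where
  "service_cost c js = (\<Sum>(s, w)\<leftarrow>serve c 0 js. w * s + w\<^sup>2 / (2 * c))"

lemma convoy_cost_eq:
  assumes c: "0 < c" and vs: "\<forall>(w, \<delta>) \<in> set vs. 0 < w \<and> 0 \<le> \<delta>"
  shows "convoy_cost c vs = service_cost c (releases vs [])"
proof -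
  let ?js = "serve c 0 (releases vs [])"
  have rel: "\<forall>(s, w) \<in> set (releases vs js). 0 < w" if "\<forall>(s, w) \<in> set js. 0 < w" for js
    using vs that
  proof (induction vs arbitrary: js)
    case (Cons v vs)
    obtain w \<delta> where v: "v = (w, \<delta>)" by fastforce
    have "\<forall>(s, w) \<in> set (releases vs (delay \<delta> ((0, w) # js))). 0 < w"
      using Cons.prems by (intro Cons.IH) (auto simp: delay_def v)
    then show ?case by (simp add: v)
  qed simp
  have "\<forall>(s, w) \<in> set (serve c f js). 0 < w" if "\<forall>(s, w) \<in> set js. 0 < w" for f js
    using that
  proof (induction js arbitrary: f)
    case (Cons sw js)
    then show ?case using Cons.IH[of "max (fst sw) f + snd sw / c"] by (cases sw) auto
  qed simp
  then have js: "\<forall>(s, w) \<in> set ?js. 0 < w" using rel[of "[]"] by simp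
  have "arrivals c vs (\<lambda>_. 0) = outflow c ?js"
    using arrivals_eq[OF c vs, of "[]"] by simp
  then have "convoy_cost c vs = (LINT t | density lborel (\<lambda>t. ennreal (flow_density c ?js t)). t)"
    unfolding convoy_cost_def by (simp add: interval_measure_outflow[OF c js])
  also have "\<dots> = (LINT t | lborel. flow_density c ?js t *\<^sub>R t)"
    by (intro integral_density) (auto simp: flow_density_nonneg[OF c])
  also have "\<dots> = service_cost c (releases vs [])"
    using has_integral_flow_density[OF c js] by (simp add: service_cost_def has_bochner_integral_iff)
  finally show ?thesis .
qed

lemma sum_list_upt: "(\<Sum>m\<leftarrow>[a..<b]. f m) = (\<Sum>m\<in>{a..<b}. f m)" for f :: "nat \<Rightarrow> real"
  by (simp add: sum_list_distinct_conv_sum_set)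

lemma serve_delay_cost:
  "f \<le> g \<Longrightarrow> 0 < c \<Longrightarrow> \<forall>(s, w) \<in> set js. 0 < w \<Longrightarrow>
    (\<Sum>(s, w)\<leftarrow>serve c f js. w * s + w\<^sup>2 / (2 * c)) \<le> (\<Sum>(s, w)\<leftarrow>serve c g js. w * s + w\<^sup>2 / (2 * c))"
proof (induction js arbitrary: f g)
  case (Cons sw js)
  obtain s w where sw: "sw = (s, w)" by fastforce
  have "w * max s f \<le> w * max s g" using Cons.prems sw by (intro mult_left_mono) auto
  from add_mono[OF this Cons.IH[of "max s f + w / c" "max s g + w / c"]] show ?case
    using Cons.prems by (simp add: sw)
qed simp

text \<open>Needed when a sink inside an edge reaches an end vertex: the limit of the costs still
  counts that vertex as a group at distance 0, and dropping it frees the server earlier for the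
  others.\<close>

lemma service_cost_Cons:
  assumes "0 < c" "0 < w" "\<forall>(s, w) \<in> set js. 0 < w"
  shows "service_cost c js \<le> service_cost c ((0, w) # js)"
proof -
  have "0 \<le> w\<^sup>2 / (2 * c)" "0 \<le> w / c" using assms by simp_all
  moreover have "service_cost c ((0, w) # js) =
      w\<^sup>2 / (2 * c) + (\<Sum>(s, w)\<leftarrow>serve c (w / c) js. w * s + w\<^sup>2 / (2 * c))"
    by (simp add: service_cost_def)
  ultimately show ?thesis
    using serve_delay_cost[of 0 "w / c" c js] assms unfolding service_cost_def by linarith
qed

text \<open>With a nonnegative first release all starts shift by \<open>\<delta>\<close>. The slope
  is the total weight, which makes the cost affine in the sink position along an edge.\<close>

lemma service_cost_delay:
  assumes "0 \<le> \<delta>" "js \<noteq> [] \<Longrightarrow> 0 \<le> fst (hd js)"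
  shows "service_cost c (delay \<delta> js) = service_cost c js + \<delta> * (\<Sum>(s, w)\<leftarrow>js. w)"
proof -
  have 1: "(\<Sum>(s, w)\<leftarrow>delay \<delta> js'. w * s + w\<^sup>2 / (2 * c)) =
      (\<Sum>(s, w)\<leftarrow>js'. w * s + w\<^sup>2 / (2 * c)) + \<delta> * (\<Sum>(s, w)\<leftarrow>js'. w)" for js'
    by (induction js') (auto simp: delay_def algebra_simps)
  have 2: "(\<Sum>(s, w)\<leftarrow>serve c f js. w) = (\<Sum>(s, w)\<leftarrow>js. w)" for f
    by (induction js arbitrary: f) auto
  have "serve c 0 (delay \<delta> js) = serve c \<delta> (delay \<delta> js)"
    using assms by (cases js) (auto simp: delay_def)
  also have "\<dots> = delay \<delta> (serve c 0 js)" by (simp add: delay_serve)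
  finally show ?thesis by (simp add: service_cost_def 1 2)
qed

text \<open>The Lindley recursion of the server: once \<open>S m / c\<close> is subtracted from the
  start of group \<open>m\<close>, passing to the next group only takes a maximum, and the recursion
  unrolls to a running maximum.\<close>

lemma serve_map:
  assumes S: "\<And>m. S (Suc m) = S m + w m"
  shows "serve c f (map (\<lambda>m. (T m, w m)) [a..<b]) =
    map (\<lambda>m. (S m / c + max (f - S a / c) (Max ((\<lambda>m. T m - S m / c) ` {a..m})), w m)) [a..<b]"
proof (induction "b - a" arbitrary: a f)
  case (Suc d)
  let ?U = "\<lambda>m. T m - S m / c"
  have ab: "a < b" using Suc by simp
  have "max (T a) f + w a / c - S (Suc a) / c = max (T a - S a / c) (f - S a / c)"
    by (simp add: S add_divide_distrib max_def)
  moreover have "max (max (?U a) (f - S a / c)) (Max (?U ` {Suc a..m})) =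
      max (f - S a / c) (Max (?U ` {a..m}))" if "m \<in> {Suc a..<b}" for m
  proof -
    have "{a..m} = insert a {Suc a..m}" using that by auto
    then show ?thesis using that by (simp add: max.left_commute max.commute max.assoc)
  qed
  moreover have "serve c (max (T a) f + w a / c) (map (\<lambda>m. (T m, w m)) [Suc a..<b]) =
    map (\<lambda>m. (S m / c + max (max (T a) f + w a / c - S (Suc a) / c) (Max (?U ` {Suc a..m})), w m)) [Suc a..<b]"
    using Suc by (intro Suc.hyps) simp
  moreover have "max (T a) f = S a / c + max (f - S a / c) (?U a)" by auto
  ultimately show ?case using ab by (simp add: upt_conv_Cons)
qed simp

lemma releases_right:
  assumes "a \<le> b"
  shows "releases (map (\<lambda>i. (w i, Z i - Z (i - 1))) (rev [Suc a..<Suc b])) js =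
    map (\<lambda>m. (Z m - Z a, w m)) [Suc a..<Suc b] @ delay (Z b - Z a) js"
  using assms
proof (induction b arbitrary: js rule: dec_induct)
  case base
  then show ?case by (induction js) (auto simp: delay_def)
next
  case (step b)
  have "delay (Z b - Z a) (delay (Z (Suc b) - Z b) ((0, w (Suc b)) # js)) =
    (Z (Suc b) - Z a, w (Suc b)) # delay (Z (Suc b) - Z a) js"
    by (auto simp: delay_def)
  then show ?case using step by simp
qed

lemma releases_left:
  assumes "a \<le> b"
  shows "releases (map (\<lambda>i. (w i, Z (Suc i) - Z i)) [a..<b]) js =
    map (\<lambda>m. (Z b - Z m, w m)) (rev [a..<b]) @ delay (Z b - Z a) js"
  using assms
proof (induction a arbitrary: js rule: inc_induct)
  case base
  then show ?case by (induction js) (auto simp: delay_def)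
next
  case (step a)
  have "delay (Z b - Z (Suc a)) (delay (Z (Suc a) - Z a) ((0, w a) # js)) =
    (Z b - Z a, w a) # delay (Z b - Z a) js"
    by (auto simp: delay_def)
  then show ?case using step by (simp add: upt_conv_Cons)
qed

lemma filter_upt_prefix:
  assumes "a \<le> r" "r \<le> b" "\<And>i. a \<le> i \<Longrightarrow> i < r \<Longrightarrow> P i" "\<And>i. r \<le> i \<Longrightarrow> i < b \<Longrightarrow> \<not> P i"
  shows "filter P [a..<b] = [a..<r]" "filter (\<lambda>i. \<not> P i) [a..<b] = [r..<b]"
proof -
  have *: "[a..<b] = [a..<r] @ [r..<b]" using assms by (metis le_add_diff_inverse upt_add_eq_append)
  have "filter P [a..<r] = [a..<r]" "filter P [r..<b] = []"
    "filter (\<lambda>i. \<not> P i) [a..<r] = []" "filter (\<lambda>i. \<not> P i) [r..<b] = [r..<b]"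
    using assms by (auto simp: filter_empty_conv filter_id_conv)
  then show "filter P [a..<b] = [a..<r]" "filter (\<lambda>i. \<not> P i) [a..<b] = [r..<b]"
    by (simp_all add: *)
qed

section \<open>Evacuation costs on a path\<close>

locale network =
  fixes N :: path_network
  assumes network: "path_network N"
begin

abbreviation n where "n \<equiv> num_vertices N"
abbreviation c where "c \<equiv> capacity N"
abbreviation \<tau> where "\<tau> \<equiv> pace N"

lemma n_pos: "1 \<le> n" and c_pos: "0 < c" and tau_pos: "0 < \<tau>"
  and weight_pos: "i < n \<Longrightarrow> 0 < weight N i"
  and length_pos: "Suc i < n \<Longrightarrow> 0 < edge_length N i"
  using network by (auto simp: path_network_def)

lemma position_less: "i < j \<Longrightarrow> j < n \<Longrightarrow> position N i < position N j"
proof (induction j)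
  case (Suc j)
  then show ?case using length_pos[of j] by (cases "i = j") (auto simp: position_def)
qed simp

lemma position_le: "i \<le> j \<Longrightarrow> j < n \<Longrightarrow> position N i \<le> position N j"
  using position_less[of i j] by (cases "i = j") auto

lemma left_convoy_cost:
  assumes "a \<le> r" "r < b" "b \<le> n" "\<And>i. a \<le> i \<Longrightarrow> i < r \<Longrightarrow> position N i < x" "x \<le> position N r"
  shows "convoy_cost c (left_convoy N a b x) =
    service_cost c (map (\<lambda>m. (\<tau> * (x - position N m), weight N m)) (rev [a..<r]))"
proof -
  \<comment> \<open>Capping positions at \<open>x\<close> makes the last hop end at the sink, so
    that all travel times are differences of \<open>Z\<close> and telescope.\<close>
  define Z where "Z = (\<lambda>i. \<tau> * min x (position N i))"
  have ge: "x \<le> position N i" if "r \<le> i" "i < b" for i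
    using position_le[of r i] that assms by simp
  have "filter (\<lambda>i. position N i < x) [a..<b] = [a..<r]"
    using assms(1-4) ge by (intro filter_upt_prefix(1)) (auto simp: not_less)
  then have eq: "left_convoy N a b x = map (\<lambda>i. (weight N i, Z (Suc i) - Z i)) [a..<r]"
    unfolding left_convoy_def Z_def using assms(4) by (auto simp: right_diff_distrib intro!: order_less_imp_le)
  have "convoy_cost c (left_convoy N a b x) = service_cost c (releases (left_convoy N a b x) [])"
  proof (intro convoy_cost_eq c_pos)
    have "0 \<le> Z (Suc i) - Z i" if "i < r" for i
      using position_le[of i "Suc i"] that assms tau_pos by (auto simp: Z_def intro!: mult_left_mono)
    then show "\<forall>(w, \<delta>)\<in>set (left_convoy N a b x). 0 < w \<and> 0 \<le> \<delta>"
      using assms weight_pos unfolding eq by auto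
  qed
  also have "releases (left_convoy N a b x) [] = map (\<lambda>m. (Z r - Z m, weight N m)) (rev [a..<r])"
    unfolding eq by (subst releases_left[OF assms(1)]) (simp add: delay_def)
  also have "\<dots> = map (\<lambda>m. (\<tau> * (x - position N m), weight N m)) (rev [a..<r])"
  proof (intro map_cong refl)
    fix m assume "m \<in> set (rev [a..<r])"
    then have "position N m < x" using assms(4) by simp
    then show "(Z r - Z m, weight N m) = (\<tau> * (x - position N m), weight N m)"
      using assms(5) by (simp add: Z_def right_diff_distrib)
  qed
  finally show ?thesis .
qed

lemma right_convoy_cost:
  assumes "a \<le> r" "r < b" "b \<le> n" "\<And>i. r < i \<Longrightarrow> i < b \<Longrightarrow> x < position N i" "position N r \<le> x"
  shows "convoy_cost c (right_convoy N a b x) =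
    service_cost c (map (\<lambda>m. (\<tau> * (position N m - x), weight N m)) [Suc r..<b])"
proof -
  define Z where "Z = (\<lambda>i. \<tau> * max x (position N i))"
  obtain b' where b': "b = Suc b'" "r \<le> b'" using assms(2) by (cases b) auto
  have le: "position N i \<le> x" if "i \<le> r" for i
    using position_le[of i r] that assms by simp
  have "filter (\<lambda>i. \<not> \<not> x < position N i) [a..<b] = [Suc r..<b]"
    using assms(1-4) le by (intro filter_upt_prefix(2)) (auto simp: not_less less_Suc_eq_le)
  then have filt: "filter (\<lambda>i. x < position N i) [a..<b] = [Suc r..<b]" by simp
  have eq: "right_convoy N a b x = map (\<lambda>i. (weight N i, Z i - Z (i - 1))) (rev [Suc r..<b])"
    unfolding right_convoy_def filt
  proof (intro map_cong refl)
    fix i assume "i \<in> set (rev [Suc r..<b])"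
    then have "x < position N i" using assms(4) by simp
    then show "(weight N i, \<tau> * (position N i - max x (position N (i - 1)))) =
      (weight N i, Z i - Z (i - 1))" by (simp add: Z_def right_diff_distrib max_def)
  qed
  have "convoy_cost c (right_convoy N a b x) = service_cost c (releases (right_convoy N a b x) [])"
  proof (intro convoy_cost_eq c_pos)
    have "0 \<le> Z i - Z (i - 1)" if "i < b" for i
      using position_le[of "i - 1" i] that assms tau_pos by (auto simp: Z_def intro!: mult_left_mono)
    then show "\<forall>(w, \<delta>)\<in>set (right_convoy N a b x). 0 < w \<and> 0 \<le> \<delta>"
      using assms weight_pos unfolding eq by auto
  qed
  also have "releases (right_convoy N a b x) [] = map (\<lambda>m. (Z m - Z r, weight N m)) [Suc r..<b]"
    unfolding eq unfolding b'(1) by (subst releases_right[OF b'(2)]) (simp add: delay_def)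
  also have "\<dots> = map (\<lambda>m. (\<tau> * (position N m - x), weight N m)) [Suc r..<b]"
  proof (intro map_cong refl)
    fix m assume "m \<in> set [Suc r..<b]"
    then have "x < position N m" using assms(4) by simp
    then show "(Z m - Z r, weight N m) = (\<tau> * (position N m - x), weight N m)"
      using assms(5) by (simp add: Z_def right_diff_distrib)
  qed
  finally show ?thesis .
qed

text \<open>On an edge the cost is affine in the sink position, and it can only drop at the end points.\<close>

lemma interior_sink:
  assumes ab: "a \<le> i" "Suc i < b" "b \<le> n" and x: "position N i < x" "x < position N (Suc i)"
  shows "subpath_cost N a b (position N i) \<le> subpath_cost N a b x \<or>
    subpath_cost N a b (position N (Suc i)) \<le> subpath_cost N a b x"
proof -
  let ?p = "position N" and ?C = "convoy_cost c" and ?w = "weight N"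
  define left where "left = (\<lambda>y r. map (\<lambda>m. (\<tau> * (y - ?p m), ?w m)) (rev [a..<r]))"
  define right where "right = (\<lambda>y r. map (\<lambda>m. (\<tau> * (?p m - y), ?w m)) [r..<b])"
  define wl where "wl = (\<Sum>(s, w)\<leftarrow>left (?p i) (Suc i). w)"
  define wr where "wr = (\<Sum>(s, w)\<leftarrow>right (?p (Suc i)) (Suc i). w)"
  \<comment> \<open>\<open>L\<close> is the limit of the left cost as the sink tends to vertex
    \<open>i\<close> from inside the edge, \<open>R\<close> that of the right cost at
    \<open>Suc i\<close>. Both still include the end vertex, at distance 0.\<close>
  define L where "L = service_cost c (left (?p i) (Suc i))"
  define R where "R = service_cost c (right (?p (Suc i)) (Suc i))"
  define u v where "u = \<tau> * (x - ?p i)" and "v = \<tau> * (?p (Suc i) - x)"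
  have uv: "0 \<le> u" "0 \<le> v" using x tau_pos by (simp_all add: u_def v_def)
  have lt: "j < i \<Longrightarrow> ?p j < ?p i" "Suc i < j \<Longrightarrow> j < b \<Longrightarrow> ?p (Suc i) < ?p j" for j
    using position_less ab by auto
  have le: "j < Suc i \<Longrightarrow> ?p j \<le> ?p i" "i < j \<Longrightarrow> j < b \<Longrightarrow> ?p (Suc i) \<le> ?p j" for j
    using position_le ab by auto
  have pos: "\<forall>(s, w)\<in>set (left y i). 0 < w" "\<forall>(s, w)\<in>set (right y j). 0 < w" for y j
    using ab weight_pos by (auto simp: left_def right_def)
  have l1: "?C (left_convoy N a b (?p i)) = service_cost c (left (?p i) i)"
    unfolding left_def using ab lt by (intro left_convoy_cost) auto
  have lx: "?C (left_convoy N a b y) = service_cost c (left y (Suc i))"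
    if "?p i < y" "y \<le> ?p (Suc i)" for y
    unfolding left_def using ab that
    by (intro left_convoy_cost) (auto intro: le_less_trans[OF le(1)])
  have r1: "?C (right_convoy N a b (?p (Suc i))) = service_cost c (right (?p (Suc i)) (Suc (Suc i)))"
    unfolding right_def using ab lt by (intro right_convoy_cost) auto
  have rx: "?C (right_convoy N a b y) = service_cost c (right y (Suc i))"
    if "?p i \<le> y" "y < ?p (Suc i)" for y
    unfolding right_def using ab that
    by (intro right_convoy_cost) (auto intro: less_le_trans[OF _ le(2)])
  have dl: "service_cost c (left y (Suc i)) = L + \<tau> * (y - ?p i) * wl" if "?p i \<le> y" for y
  proof -
    have "left y (Suc i) = delay (\<tau> * (y - ?p i)) (left (?p i) (Suc i))"
      by (auto simp: left_def delay_def algebra_simps)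
    moreover have "0 \<le> fst (hd (left (?p i) (Suc i)))" using ab by (simp add: left_def)
    ultimately show ?thesis
      unfolding L_def wl_def using that tau_pos by (simp add: service_cost_delay)
  qed
  have dr: "service_cost c (right y (Suc i)) = R + \<tau> * (?p (Suc i) - y) * wr" if "y \<le> ?p (Suc i)" for y
  proof -
    have "right y (Suc i) = delay (\<tau> * (?p (Suc i) - y)) (right (?p (Suc i)) (Suc i))"
      by (auto simp: right_def delay_def algebra_simps)
    moreover have "0 \<le> fst (hd (right (?p (Suc i)) (Suc i)))"
      using ab by (simp add: right_def upt_conv_Cons)
    ultimately show ?thesis
      unfolding R_def wr_def using that tau_pos by (simp add: service_cost_delay)
  qed
  have l0: "service_cost c (left (?p i) i) \<le> L"
  proof -
    have "left (?p i) (Suc i) = (0, ?w i) # left (?p i) i" using ab by (simp add: left_def)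
    then show ?thesis
      unfolding L_def using service_cost_Cons[OF c_pos _ pos(1)] ab weight_pos[of i] by simp
  qed
  have r0: "service_cost c (right (?p (Suc i)) (Suc (Suc i))) \<le> R"
  proof -
    have "right (?p (Suc i)) (Suc i) = (0, ?w (Suc i)) # right (?p (Suc i)) (Suc (Suc i))"
      using ab by (simp add: right_def upt_conv_Cons)
    then show ?thesis
      unfolding R_def using service_cost_Cons[OF c_pos _ pos(2)] ab weight_pos[of "Suc i"] by simp
  qed
  have sx: "subpath_cost N a b x = L + u * wl + (R + v * wr)"
    unfolding subpath_cost_def using x by (simp add: lx rx dl dr u_def v_def)
  have si: "subpath_cost N a b (?p i) \<le> L + (R + (u + v) * wr)"
    unfolding subpath_cost_def using x l0 by (simp add: l1 rx dr u_def v_def flip: distrib_left)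
  have ss: "subpath_cost N a b (?p (Suc i)) \<le> L + (u + v) * wl + R"
    unfolding subpath_cost_def using x r0 by (simp add: r1 lx dl u_def v_def flip: distrib_left)
  \<comment> \<open>Moving the sink towards the heavier side saves at least as much as it
    costs.\<close>
  show ?thesis
  proof (cases "wr \<le> wl")
    case True
    then have "(u + v) * wr \<le> u * wl + v * wr" using mult_left_mono[OF True uv(1)] by (simp add: algebra_simps)
    then show ?thesis using sx si by linarith
  next
    case False
    then have "(u + v) * wl \<le> u * wl + v * wr" using mult_left_mono[of wl wr v] uv by (simp add: algebra_simps)
    then show ?thesis using sx ss by linarith
  qed
qed

lemma vertex_sink:
  assumes ab: "a < b" "b \<le> n" and x: "x \<in> {position N a..position N (b - 1)}"
  shows "\<exists>g. a \<le> g \<and> g < b \<and> subpath_cost N a b (position N g) \<le> subpath_cost N a b x"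
proof -
  define I where "I = {i. a \<le> i \<and> i < b \<and> position N i \<le> x}"
  have I: "finite I" "a \<in> I" using ab x by (auto simp: I_def)
  define i where "i = Max I"
  have "I \<noteq> {}" using I by blast
  then have i: "i \<in> I" and mx: "\<And>j. j \<in> I \<Longrightarrow> j \<le> i"
    using I(1) Max_in[of I] by (simp_all add: i_def)
  show ?thesis
  proof (cases "position N i = x")
    case True
    then show ?thesis using i by (auto simp: I_def)
  next
    case False
    then have lt: "position N i < x" using i by (simp add: I_def)
    have "i \<noteq> b - 1" using lt x by auto
    then have ib: "Suc i < b" using i by (auto simp: I_def)
    have "x < position N (Suc i)" using mx[of "Suc i"] i ib by (force simp: I_def)
    then have "subpath_cost N a b (position N i) \<le> subpath_cost N a b x \<or>
        subpath_cost N a b (position N (Suc i)) \<le> subpath_cost N a b x"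
      using i ib ab lt by (intro interior_sink) (auto simp: I_def)
    moreover have "a \<le> i" "i < b" "a \<le> Suc i" using i by (auto simp: I_def)
    ultimately show ?thesis using ib by blast
  qed
qed

text \<open>
  The path followed by its mirror image: the convoy on the left of \<open>g\<close> becomes the convoy on the
  right of the mirror image \<open>2n - 1 - g\<close>, so that one cost function covers both directions.
\<close>

definition \<omega> :: "nat \<Rightarrow> real" where
  "\<omega> a = weight N (if a < n then a else 2 * n - 1 - a)"

text \<open>The zeros agree with the contents of the input array \<open>d\<close>. In
  \<open>q\<close>, the entry \<open>gap (n - 1) = 0\<close> is the length of the junction between
  the path and its mirror image.\<close>

definition gap :: "nat \<Rightarrow> real" where
  "gap i = (if Suc i < n then edge_length N i else 0)"

definition q :: "nat \<Rightarrow> real" where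
  "q a = (\<Sum>j<a. \<tau> * gap (if Suc j < n then j else 2 * n - 2 - j))"

definition S :: "nat \<Rightarrow> real" where "S a = (\<Sum>j<a. \<omega> j)"
text \<open>Prefix sums of the part of the cost that does not depend on the sink.\<close>

definition H :: "nat \<Rightarrow> real" where "H a = (\<Sum>j<a. \<omega> j * S j / c + \<omega> j * \<omega> j / (c + c))"
definition U :: "nat \<Rightarrow> real" where "U a = q a - S a / c"

lemma omega_pos: "a < 2 * n \<Longrightarrow> 0 < \<omega> a"
  using n_pos by (auto simp: \<omega>_def intro!: weight_pos)

lemma q_mono: "a \<le> b \<Longrightarrow> q a \<le> q b"
proof -
  have "0 \<le> gap i" for i using length_pos[of i] by (auto simp: gap_def less_imp_le)
  then show "a \<le> b \<Longrightarrow> q a \<le> q b"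
    unfolding q_def using tau_pos by (intro sum_mono2) auto
qed

lemma S_Suc: "S (Suc a) = S a + \<omega> a" by (simp add: S_def)

lemma S_diff: "a \<le> b \<Longrightarrow> S b - S a = (\<Sum>m\<in>{a..<b}. \<omega> m)"
  unfolding S_def by (simp add: lessThan_atLeast0 sum_diff_nat_ivl)

lemma q_position: "a < n \<Longrightarrow> q a = \<tau> * position N a"
  unfolding q_def position_def sum_distrib_left by (intro sum.cong) (auto simp: gap_def)

text \<open>The increments of \<open>q\<close> are symmetric about the junction, so a step away from
  it on one side is compensated by the mirrored step on the other.\<close>

lemma q_mirror:
  assumes "i < n"
  shows "q (2 * n - 1 - i) + q i = q n + q (n - 1)"
proof -
  have *: "j < n \<Longrightarrow> q (n + j) + q (n - 1 - j) = q n + q (n - 1)" for j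
  proof (induction j)
    case (Suc j)
    have "2 * n - 2 - (n + j) = n - 2 - j" by simp
    then have "q (n + Suc j) = q (n + j) + \<tau> * gap (n - 2 - j)"
      by (simp add: q_def)
    moreover have "q (n - 1 - j) = q (n - 1 - Suc j) + \<tau> * gap (n - 2 - j)"
    proof -
      have "n - 1 - j = Suc (n - 2 - j)" "n - 1 - Suc j = n - 2 - j" "Suc (n - 2 - j) < n"
        using Suc.prems by auto
      then show ?thesis by (simp add: q_def)
    qed
    ultimately show ?case using Suc by simp
  qed simp
  have "n + (n - 1 - i) = 2 * n - 1 - i" "n - 1 - (n - 1 - i) = i" "n - 1 - i < n"
    using assms by auto
  then show ?thesis using *[of "n - 1 - i"] by simp
qed

definition evac :: "nat \<Rightarrow> nat \<Rightarrow> real" where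
  "evac x y = service_cost c (map (\<lambda>m. (q m - q x, \<omega> m)) [Suc x..<Suc y])"

lemma subpath_cost_eq:
  assumes "a \<le> g" "g < b" "b \<le> n"
  shows "subpath_cost N a b (position N g) = evac (2 * n - 1 - g) (2 * n - 1 - a) + evac g (b - 1)"
proof -
  have "convoy_cost c (left_convoy N a b (position N g)) =
      service_cost c (map (\<lambda>m. (\<tau> * (position N g - position N m), weight N m)) (rev [a..<g]))"
    using assms position_less by (intro left_convoy_cost) auto
  also have "map (\<lambda>m. (\<tau> * (position N g - position N m), weight N m)) (rev [a..<g]) =
      map (\<lambda>m. (q m - q (2 * n - 1 - g), \<omega> m)) [Suc (2 * n - 1 - g)..<Suc (2 * n - 1 - a)]"
  proof (rule nth_equalityI)
    show "length (map (\<lambda>m. (\<tau> * (position N g - position N m), weight N m)) (rev [a..<g])) =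
      length (map (\<lambda>m. (q m - q (2 * n - 1 - g), \<omega> m)) [Suc (2 * n - 1 - g)..<Suc (2 * n - 1 - a)])"
      unfolding length_map length_rev length_upt using assms by linarith
    fix i assume "i < length (map (\<lambda>m. (\<tau> * (position N g - position N m), weight N m)) (rev [a..<g]))"
    then have i: "i < g - a" by simp
    define m where "m = g - Suc i"
    have m: "m < g" "a \<le> m" using i by (auto simp: m_def)
    have 1: "rev [a..<g] ! i = m" using i by (simp add: rev_nth m_def)
    have 2: "[Suc (2 * n - 1 - g)..<Suc (2 * n - 1 - a)] ! i = 2 * n - 1 - m"
      using i assms by (subst nth_upt) (auto simp: m_def)
    have "q (2 * n - 1 - m) - q (2 * n - 1 - g) = \<tau> * (position N g - position N m)"
      using q_mirror[of m] q_mirror[of g] q_position[of m] q_position[of g] assms m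
      by (simp add: right_diff_distrib)
    moreover have "\<omega> (2 * n - 1 - m) = weight N m" using m assms by (auto simp: \<omega>_def)
    moreover have "i < length [Suc (2 * n - 1 - g)..<Suc (2 * n - 1 - a)]"
      unfolding length_upt using i assms by linarith
    ultimately show "map (\<lambda>m. (\<tau> * (position N g - position N m), weight N m)) (rev [a..<g]) ! i =
      map (\<lambda>m. (q m - q (2 * n - 1 - g), \<omega> m)) [Suc (2 * n - 1 - g)..<Suc (2 * n - 1 - a)] ! i"
      using i by (simp only: nth_map 1 2 length_rev length_upt)
  qed
  finally have l: "convoy_cost c (left_convoy N a b (position N g)) = evac (2 * n - 1 - g) (2 * n - 1 - a)"
    by (simp add: evac_def)
  have "convoy_cost c (right_convoy N a b (position N g)) =
      service_cost c (map (\<lambda>m. (\<tau> * (position N m - position N g), weight N m)) [Suc g..<b])"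
    using assms position_less by (intro right_convoy_cost) auto
  also have "map (\<lambda>m. (\<tau> * (position N m - position N g), weight N m)) [Suc g..<b] =
      map (\<lambda>m. (q m - q g, \<omega> m)) [Suc g..<Suc (b - 1)]"
    using assms by (intro map_cong) (auto simp: q_position \<omega>_def right_diff_distrib)
  finally show ?thesis by (simp add: subpath_cost_def l evac_def)
qed

section \<open>Running maxima and next greater elements\<close>

abbreviation peak :: "nat \<Rightarrow> nat \<Rightarrow> real" where "peak a m \<equiv> Max (U ` {a..m})"

lemma evac_eq:
  assumes "x \<le> y" "y < 2 * n"
  shows "evac x y = (\<Sum>m\<in>{Suc x..<Suc y}. \<omega> m * (S m / c - q x + peak (Suc x) m) + \<omega> m * \<omega> m / (c + c))"
proof -
  have start: "S m / c + max (0 - S (Suc x) / c) (Max ((\<lambda>m. q m - q x - S m / c) ` {Suc x..m})) =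
      S m / c - q x + peak (Suc x) m" if "m \<in> {Suc x..<Suc y}" for m
  proof -
    have "Max ((\<lambda>m. q m - q x - S m / c) ` {Suc x..m}) = Max ((\<lambda>u. u - q x) ` U ` {Suc x..m})"
      unfolding image_image by (intro arg_cong[where f = Max] image_cong) (auto simp: U_def)
    also have "\<dots> = peak (Suc x) m - q x"
      using that by (intro mono_Max_commute[symmetric]) (auto simp: mono_def)
    finally have M: "Max ((\<lambda>m. q m - q x - S m / c) ` {Suc x..m}) = peak (Suc x) m - q x" .
    \<comment> \<open>Travel times are monotone, so the nearest group is not released before time 0;
      the maximum is therefore its second argument.\<close>
    have "U (Suc x) \<le> peak (Suc x) m" using that by (intro Max_ge) auto
    then have "0 - S (Suc x) / c \<le> peak (Suc x) m - q x"
      using q_mono[of x "Suc x"] by (simp add: U_def)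
    then show ?thesis by (simp add: M max_def)
  qed
  have "evac x y = (\<Sum>m\<leftarrow>[Suc x..<Suc y].
      \<omega> m * (S m / c + max (0 - S (Suc x) / c) (Max ((\<lambda>m. q m - q x - S m / c) ` {Suc x..m}))) +
      (\<omega> m)\<^sup>2 / (2 * c))"
    unfolding evac_def service_cost_def
    by (subst serve_map[where S = S, OF S_Suc]) (simp add: comp_def)
  also have "\<dots> = (\<Sum>m\<in>{Suc x..<Suc y}.
      \<omega> m * (S m / c + max (0 - S (Suc x) / c) (Max ((\<lambda>m. q m - q x - S m / c) ` {Suc x..m}))) +
      (\<omega> m)\<^sup>2 / (2 * c))"
    by (simp only: sum_list_upt)
  also have "\<dots> = (\<Sum>m\<in>{Suc x..<Suc y}. \<omega> m * (S m / c - q x + peak (Suc x) m) + \<omega> m * \<omega> m / (c + c))"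
    by (intro sum.cong refl) (simp only: start power2_eq_square mult_2)
  finally show ?thesis .
qed

text \<open>A sink closer to vertex \<open>m\<close> lowers the contribution of \<open>m\<close>:
  \<open>q x\<close> grows and the running maximum ranges over fewer vertices. Hence extending the
  range from \<open>y\<close> to \<open>y'\<close> costs the closer sink \<open>x'\<close> no more
  than \<open>x\<close>.\<close>

lemma evac_monge:
  assumes "x \<le> x'" "x' \<le> y" "y \<le> y'" "y' < 2 * n"
  shows "evac x y + evac x' y' \<le> evac x y' + evac x' y"
proof -
  define f where "f = (\<lambda>x m. \<omega> m * (S m / c - q x + peak (Suc x) m) + \<omega> m * \<omega> m / (c + c))"
  have split: "evac z y' = evac z y + (\<Sum>m\<in>{Suc y..<Suc y'}. f z m)" if "z \<le> y" for z
    using that assms by (simp only: evac_eq f_def sum.atLeastLessThan_concat le_trans not_less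
      Suc_le_mono order.strict_trans1)
  have "f x' m \<le> f x m" if "m \<in> {Suc y..<Suc y'}" for m
  proof -
    have "peak (Suc x') m \<le> peak (Suc x) m"
      using that assms by (intro Max_mono) auto
    then have "S m / c - q x' + peak (Suc x') m \<le> S m / c - q x + peak (Suc x) m"
      using q_mono[OF assms(1)] by simp
    moreover have "0 \<le> \<omega> m" using that assms by (intro less_imp_le omega_pos) auto
    ultimately show ?thesis by (simp add: f_def mult_left_mono)
  qed
  then have "(\<Sum>m\<in>{Suc y..<Suc y'}. f x' m) \<le> (\<Sum>m\<in>{Suc y..<Suc y'}. f x m)"
    by (intro sum_mono) auto
  then show ?thesis using split[of x] split[of x'] assms by linarith
qed

text \<open>\<open>2 * n\<close> stands for a missing greater element and is a fixed point, so
  chains can be iterated any number of times. Equal values are skipped, since the running maximum is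
  constant across them.\<close>

definition nxt :: "nat \<Rightarrow> nat" where
  "nxt a = (if a < 2 * n then LEAST m. a < m \<and> (2 * n \<le> m \<or> U a < U m) else 2 * n)"

definition P :: "nat \<Rightarrow> real" where
  "P a = (\<Sum>m\<in>{a..<2 * n}. \<omega> m * peak a m)"

lemma nxt_props:
  assumes "a < 2 * n"
  shows "a < nxt a" "nxt a \<le> 2 * n" "nxt a < 2 * n \<Longrightarrow> U a < U (nxt a)"
    "a < m \<Longrightarrow> m < nxt a \<Longrightarrow> U m \<le> U a"
proof -
  let ?P = "\<lambda>m. a < m \<and> (2 * n \<le> m \<or> U a < U m)"
  have eq: "nxt a = (LEAST m. ?P m)" using assms by (simp add: nxt_def)
  have "?P (2 * n)" using assms by simp
  then have "?P (nxt a)" unfolding eq by (rule LeastI)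
  then show "a < nxt a" "nxt a < 2 * n \<Longrightarrow> U a < U (nxt a)" by auto
  show "nxt a \<le> 2 * n" unfolding eq using \<open>?P (2 * n)\<close> by (rule Least_le)
  show "a < m \<Longrightarrow> m < nxt a \<Longrightarrow> U m \<le> U a"
    using not_less_Least[of m ?P] unfolding eq by auto
qed

lemma nxt_eqI:
  assumes "a < m" "m \<le> 2 * n" "m < 2 * n \<Longrightarrow> U a < U m" "\<And>m'. a < m' \<Longrightarrow> m' < m \<Longrightarrow> U m' \<le> U a"
  shows "nxt a = m"
proof -
  have "a < 2 * n" using assms by simp
  have "(LEAST m. a < m \<and> (2 * n \<le> m \<or> U a < U m)) = m"
  proof (rule Least_equality)
    show "a < m \<and> (2 * n \<le> m \<or> U a < U m)" using assms by force
    fix y assume "a < y \<and> (2 * n \<le> y \<or> U a < U y)"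
    then show "m \<le> y" using assms(2) assms(4)[of y] by (cases "y < m") auto
  qed
  then show ?thesis using \<open>a < 2 * n\<close> by (simp add: nxt_def)
qed

lemma nxt_end: "nxt (2 * n) = 2 * n" by (simp add: nxt_def)

lemma nxt_le: "nxt a \<le> 2 * n" using nxt_props(2) by (simp add: nxt_def)

lemma nxt_ge: "a \<le> 2 * n \<Longrightarrow> a \<le> nxt a" using nxt_props(1)[of a] by (cases "a < 2 * n") (auto simp: nxt_def)

lemma peak_before: "a < 2 * n \<Longrightarrow> a \<le> m \<Longrightarrow> m < nxt a \<Longrightarrow> peak a m = U a"
proof (rule Max_eqI)
  fix u assume *: "a < 2 * n" "m < nxt a" "u \<in> U ` {a..m}"
  then obtain j where j: "a \<le> j" "j \<le> m" "u = U j" by auto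
  then show "u \<le> U a" using nxt_props(4)[of a j] * by (cases "j = a") auto
qed auto

text \<open>\<open>U (nxt a)\<close> exceeds \<open>U a\<close>, which dominates everything before
  \<open>nxt a\<close>; from there on the two maxima coincide.\<close>

lemma peak_after: "a < 2 * n \<Longrightarrow> nxt a \<le> m \<Longrightarrow> m < 2 * n \<Longrightarrow> peak a m = peak (nxt a) m"
proof (rule Max_eqI)
  assume *: "a < 2 * n" "nxt a \<le> m" "m < 2 * n"
  have le: "U (nxt a) \<le> peak (nxt a) m" using * by (intro Max_ge) auto
  show "u \<le> peak (nxt a) m" if u: "u \<in> U ` {a..m}" for u
  proof -
    obtain j where j: "a \<le> j" "j \<le> m" "u = U j" using u by auto
    show ?thesis
    proof (cases "nxt a \<le> j")
      case True
      then show ?thesis using j by (intro Max_ge) auto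
    next
      case False
      then have "U j \<le> U a" using j * nxt_props(4)[of a j] by (cases "j = a") auto
      moreover have "U a < U (nxt a)" using nxt_props(3)[of a] * by simp
      ultimately show ?thesis using le j(3) by linarith
    qed
  qed
  have "peak (nxt a) m \<in> U ` {nxt a..m}" using * by (intro Max_in) auto
  moreover have "U ` {nxt a..m} \<subseteq> U ` {a..m}"
    using nxt_props(1)[of a] * by (intro image_mono) auto
  ultimately show "peak (nxt a) m \<in> U ` {a..m}" by blast
qed simp

lemma peak_sum_step:
  assumes "a < 2 * n" "nxt a \<le> Suc y" "y < 2 * n"
  shows "(\<Sum>m\<in>{a..<Suc y}. \<omega> m * peak a m) =
    U a * (S (nxt a) - S a) + (\<Sum>m\<in>{nxt a..<Suc y}. \<omega> m * peak (nxt a) m)"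
proof -
  have "(\<Sum>m\<in>{a..<Suc y}. \<omega> m * peak a m) =
      (\<Sum>m\<in>{a..<nxt a}. \<omega> m * peak a m) + (\<Sum>m\<in>{nxt a..<Suc y}. \<omega> m * peak a m)"
    using assms nxt_props(1)[of a] by (subst sum.atLeastLessThan_concat) auto
  also have "(\<Sum>m\<in>{a..<nxt a}. \<omega> m * peak a m) = (\<Sum>m\<in>{a..<nxt a}. \<omega> m * U a)"
    using assms peak_before by (intro sum.cong) auto
  also have "\<dots> = U a * (S (nxt a) - S a)"
    using nxt_props(1)[of a] assms by (simp add: S_diff sum_distrib_left mult.commute)
  also have "(\<Sum>m\<in>{nxt a..<Suc y}. \<omega> m * peak a m) = (\<Sum>m\<in>{nxt a..<Suc y}. \<omega> m * peak (nxt a) m)"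
    using assms by (intro sum.cong refl, subst peak_after) auto
  finally show ?thesis .
qed

lemma P_end: "P (2 * n) = 0" by (simp add: P_def)

lemma P_rec: "a < 2 * n \<Longrightarrow> P a = U a * (S (nxt a) - S a) + P (nxt a)"
  unfolding P_def using peak_sum_step[of a "2 * n - 1"] nxt_le[of a] by simp

text \<open>Beyond a chain element \<open>m\<close> the maxima counted from \<open>a\<close> and
  from \<open>m\<close> agree, so the tails cancel in \<open>P a - P m\<close>; between
  \<open>m\<close> and \<open>y\<close> the maximum is \<open>U m\<close> since
  \<open>y < nxt m\<close>. The alternative \<open>m = a\<close> admits the empty range
  \<open>a = Suc y\<close>.\<close>

lemma peak_sum:
  assumes "m = (nxt ^^ e) a" "m = a \<or> m \<le> y" "y < nxt m" "a \<le> Suc y" "y < 2 * n"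
  shows "(\<Sum>m\<in>{a..<Suc y}. \<omega> m * peak a m) = P a - P m + U m * (S (Suc y) - S m)"
  using assms
proof (induction e arbitrary: a)
  have base: "(\<Sum>m\<in>{a..<Suc y}. \<omega> m * peak a m) = U a * (S (Suc y) - S a)"
    if "y < nxt a" "a \<le> Suc y" "y < 2 * n" for a
  proof -
    have "(\<Sum>m\<in>{a..<Suc y}. \<omega> m * peak a m) = (\<Sum>m\<in>{a..<Suc y}. \<omega> m * U a)"
      using that peak_before[of a] by (intro sum.cong) auto
    then show ?thesis
      using that by (simp add: S_diff sum_distrib_left mult.commute del: sum.op_ivl_Suc)
  qed
  {
    case 0
    then show ?case using base[of a] by simp
  next
    case (Suc e)
    show ?case
    proof (cases "m = a")
      case True
      then show ?thesis using base[of a] Suc.prems by simp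
    next
      case False
      have m: "m = (nxt ^^ e) (nxt a)" using Suc.prems(1) by (simp add: funpow_swap1)
      have ge: "b \<le> (nxt ^^ e) b" if "b \<le> 2 * n" for b e
      proof (induction e)
        case (Suc e)
        have "(nxt ^^ e) b \<le> 2 * n" using that nxt_le by (cases e) auto
        then show ?case using Suc nxt_ge[of "(nxt ^^ e) b"] by simp
      qed simp
      have le: "nxt a \<le> m" "m \<le> y" using ge[OF nxt_le] m False Suc.prems by auto
      have a: "a < 2 * n" using Suc.prems(4,5) le nxt_ge[of a] by simp
      have "(\<Sum>m\<in>{nxt a..<Suc y}. \<omega> m * peak (nxt a) m) = P (nxt a) - P m + U m * (S (Suc y) - S m)"
        using Suc.prems le by (intro Suc.IH m) auto
      then show ?thesis using peak_sum_step[of a y] P_rec[OF a] a le Suc.prems by simp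
    qed
  }
qed

lemma evac_fast:
  assumes "x \<le> y" "y < 2 * n" "m = (nxt ^^ e) (Suc x)" "m = Suc x \<or> m \<le> y" "y < nxt m"
  shows "evac x y = (H (Suc y) - H (Suc x)) - q x * (S (Suc y) - S (Suc x)) +
    (P (Suc x) - P m) + U m * (S (Suc y) - S m)"
proof -
  have "evac x y = (\<Sum>m\<in>{Suc x..<Suc y}. \<omega> m * S m / c + \<omega> m * \<omega> m / (c + c)) -
      q x * (\<Sum>m\<in>{Suc x..<Suc y}. \<omega> m) + (\<Sum>m\<in>{Suc x..<Suc y}. \<omega> m * peak (Suc x) m)"
    unfolding evac_eq[OF assms(1,2)] sum_distrib_left
    by (simp only: sum.distrib[symmetric] sum_subtractf[symmetric]) (intro sum.cong refl, simp add: algebra_simps)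
  also have "(\<Sum>m\<in>{Suc x..<Suc y}. \<omega> m) = S (Suc y) - S (Suc x)"
    using assms by (simp only: S_diff Suc_le_mono)
  also have "(\<Sum>m\<in>{Suc x..<Suc y}. \<omega> m * S m / c + \<omega> m * \<omega> m / (c + c)) = H (Suc y) - H (Suc x)"
    unfolding H_def using assms by (simp only: lessThan_atLeast0 sum_diff_nat_ivl Suc_le_mono le0)
  also have "(\<Sum>m\<in>{Suc x..<Suc y}. \<omega> m * peak (Suc x) m) = P (Suc x) - P m + U m * (S (Suc y) - S m)"
    using assms by (intro peak_sum) auto
  finally show ?thesis by simp
qed

end

section \<open>The dynamic program\<close>

text \<open>Ties are broken to the left because the Monge inequality is not strict: arbitrary
  minimizers need not be monotone in the row.\<close>

definition leftmost :: "(nat \<Rightarrow> real) \<Rightarrow> nat \<Rightarrow> nat \<Rightarrow> nat" where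
  "leftmost f a b = (LEAST h. h \<in> {a..b} \<and> (\<forall>h'\<in>{a..b}. f h \<le> f h'))"

lemma leftmost_eqI:
  assumes "h \<in> {a..b}" "\<And>h'. h' \<in> {a..b} \<Longrightarrow> f h \<le> f h'" "\<And>h'. a \<le> h' \<Longrightarrow> h' < h \<Longrightarrow> f h < f h'"
  shows "leftmost f a b = h"
  unfolding leftmost_def
proof (rule Least_equality)
  fix y assume y: "y \<in> {a..b} \<and> (\<forall>h'\<in>{a..b}. f y \<le> f h')"
  then have "f y \<le> f h" using assms(1) by blast
  then show "h \<le> y" using assms(3)[of y] y by (cases "y < h") auto
qed (use assms in blast)

lemma leftmost_props:
  assumes "a \<le> b"
  shows leftmost_in: "leftmost f a b \<in> {a..b}"
    and leftmost_le: "h \<in> {a..b} \<Longrightarrow> f (leftmost f a b) \<le> f h"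
    and leftmost_less: "a \<le> h \<Longrightarrow> h < leftmost f a b \<Longrightarrow> f (leftmost f a b) < f h"
proof -
  let ?P = "\<lambda>h. h \<in> {a..b} \<and> (\<forall>h'\<in>{a..b}. f h \<le> f h')"
  have fin: "finite (f ` {a..b})" "f ` {a..b} \<noteq> {}" using assms by auto
  obtain h0 where "h0 \<in> {a..b}" "f h0 = Min (f ` {a..b})" using Min_in[OF fin] by auto
  then have "?P h0" using fin by (auto intro: Min_le)
  then have P: "?P (leftmost f a b)" unfolding leftmost_def by (rule LeastI)
  then show "leftmost f a b \<in> {a..b}" "h \<in> {a..b} \<Longrightarrow> f (leftmost f a b) \<le> f h" by auto
  show "f (leftmost f a b) < f h" if h: "a \<le> h" "h < leftmost f a b"
  proof -
    have "\<not> ?P h" using h(2) unfolding leftmost_def by (rule not_less_Least)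
    then obtain h' where "h' \<in> {a..b}" "f h' < f h" using h P by (auto simp: not_le)
    then show ?thesis using P by force
  qed
qed

text \<open>This allows a row to be scanned only between the optimal columns of its neighbours,
  without changing how ties are resolved.\<close>

lemma leftmost_restrict:
  assumes "a \<le> lo" "hi \<le> b" "leftmost f a b \<in> {lo..hi}"
  shows "leftmost f lo hi = leftmost f a b"
proof -
  have "a \<le> b" using assms by simp
  then show ?thesis using assms
    by (intro leftmost_eqI) (auto intro: leftmost_le leftmost_less)
qed

lemma leftmost_single: "leftmost f a a = a"
  by (rule leftmost_eqI) auto

lemma leftmost_Suc:
  assumes "a \<le> b"
  shows "leftmost f a (Suc b) = (if f (Suc b) < f (leftmost f a b) then Suc b else leftmost f a b)"
proof (rule leftmost_eqI)
  note l = leftmost_in[OF assms, of f] leftmost_le[OF assms, of _ f] leftmost_less[OF assms, of _ f]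
  show "(if f (Suc b) < f (leftmost f a b) then Suc b else leftmost f a b) \<in> {a..Suc b}"
    using assms l(1) by auto
  show "f (if f (Suc b) < f (leftmost f a b) then Suc b else leftmost f a b) \<le> f h"
    if "h \<in> {a..Suc b}" for h
    using that l(2)[of h] by (cases "h = Suc b") auto
  show "f (if f (Suc b) < f (leftmost f a b) then Suc b else leftmost f a b) < f h"
    if "a \<le> h" "h < (if f (Suc b) < f (leftmost f a b) then Suc b else leftmost f a b)" for h
    using that l(2)[of h] l(3)[of h] by (auto split: if_splits)
qed

lemma sum_pairs: "(\<Sum>s<2 * k. f s) = (\<Sum>j<k. f (2 * j) + f (Suc (2 * j)))" for f :: "nat \<Rightarrow> real"
  by (induction k) auto

section \<open>Layers, optimal columns and routes\<close>

context network
begin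

text \<open>
  Layer \<open>t\<close> of the dynamic program extends partial solutions: for even \<open>t = 2j\<close> by the part of
  block \<open>j\<close> from its first vertex \<open>h\<close> to its sink \<open>i\<close>, for odd \<open>t\<close> by the part from its sink
  \<open>h\<close> to its last vertex \<open>i\<close>.
\<close>

definition step_cost :: "nat \<Rightarrow> nat \<Rightarrow> nat \<Rightarrow> real" where
  "step_cost t h i = (if even t then evac (2 * n - 1 - i) (2 * n - 1 - h) else evac h i)"

text \<open>The first block starts at vertex 0, so layer 0 has a single column.\<close>

definition col_max :: "nat \<Rightarrow> nat \<Rightarrow> nat" where
  "col_max t i = (if t = 0 then 0 else i)"

text \<open>After an odd layer the state \<open>e\<close> is the first vertex behind the block, one
  more than its last vertex \<open>i\<close>; this is the offset \<open>t mod 2\<close>. Columns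
  start at \<open>t div 2\<close> because each of the \<open>t div 2\<close> completed blocks holds
  at least one vertex.\<close>

primrec V :: "nat \<Rightarrow> nat \<Rightarrow> real" where
  "V 0 = (\<lambda>e. 0)"
| "V (Suc t) = (\<lambda>e. let i = e - t mod 2;
      h = leftmost (\<lambda>h. V t h + step_cost t h i) (t div 2) (col_max t i) in V t h + step_cost t h i)"

definition entry :: "nat \<Rightarrow> nat \<Rightarrow> nat \<Rightarrow> real" where
  "entry t i h = V t h + step_cost t h i"

definition opt :: "nat \<Rightarrow> nat \<Rightarrow> nat" where
  "opt t i = leftmost (entry t i) (t div 2) (col_max t i)"

lemma V_Suc: "V (Suc t) e = entry t (e - t mod 2) (opt t (e - t mod 2))"
  by (simp add: Let_def entry_def[abs_def] opt_def)

declare V.simps(2) [simp del]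

text \<open>Mirroring reverses the order of both arguments and exchanges them, which preserves the
  inequality.\<close>

lemma step_cost_monge:
  assumes "h \<le> h'" "h' \<le> i" "i \<le> i'" "i' < n"
  shows "step_cost t h i + step_cost t h' i' \<le> step_cost t h i' + step_cost t h' i"
proof (cases "even t")
  case True
  then show ?thesis
    using evac_monge[of "2 * n - 1 - i'" "2 * n - 1 - i" "2 * n - 1 - h'" "2 * n - 1 - h"] assms
    by (simp add: step_cost_def add.commute diff_le_mono2)
next
  case False
  then show ?thesis using evac_monge[of h h' i i'] assms by (simp add: step_cost_def)
qed

lemma col_range: "t div 2 \<le> i \<Longrightarrow> t div 2 \<le> col_max t i"
  by (auto simp: col_max_def)

lemma opt_in: "t div 2 \<le> i \<Longrightarrow> opt t i \<in> {t div 2..col_max t i}"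
  unfolding opt_def by (rule leftmost_in[OF col_range])

lemma opt_le: "t div 2 \<le> i \<Longrightarrow> opt t i \<le> i"
  using opt_in[of t i] by (auto simp: col_max_def split: if_splits)

text \<open>A violation would put the larger column into the smaller row, so
  \<open>opt t i \<le> i\<close> makes both columns admissible in both rows. The Monge inequality
  then contradicts that row \<open>i\<close> strictly prefers its leftmost optimum to every column
  left of it.\<close>

lemma opt_mono:
  assumes "t div 2 \<le> i" "i \<le> i'" "i' < n"
  shows "opt t i \<le> opt t i'"
proof (rule ccontr)
  assume "\<not> opt t i \<le> opt t i'"
  then have less: "opt t i' < opt t i" by simp
  have i': "t div 2 \<le> i'" using assms by simp
  have "t \<noteq> 0" using less opt_in[OF assms(1)] by (auto simp: col_max_def split: if_splits)
  have in1: "opt t i' \<in> {t div 2..col_max t i'}" using opt_in[OF i'] .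
  have in2: "opt t i \<in> {t div 2..col_max t i}" using opt_in[OF assms(1)] .
  have "entry t i (opt t i) < entry t i (opt t i')"
    using leftmost_less[OF col_range[OF assms(1)], of "opt t i'" "entry t i"] less in1
    by (simp add: opt_def[of t i])
  moreover have "entry t i' (opt t i') \<le> entry t i' (opt t i)"
    using leftmost_le[OF col_range[OF i'], of "opt t i" "entry t i'"] in2 assms \<open>t \<noteq> 0\<close>
    by (simp add: opt_def[of t i'] col_max_def)
  moreover have "step_cost t (opt t i') i + step_cost t (opt t i) i' \<le>
      step_cost t (opt t i') i' + step_cost t (opt t i) i"
    using less opt_le[OF assms(1)] assms by (intro step_cost_monge) auto
  ultimately show False by (simp add: entry_def)
qed

text \<open>Even positions are block boundaries and odd positions are sinks; the summand
  \<open>s mod 2\<close> places the next boundary strictly behind the sink, so no block is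
  empty.\<close>

definition is_route :: "nat \<Rightarrow> (nat \<Rightarrow> nat) \<Rightarrow> bool" where
  "is_route T e \<longleftrightarrow> e 0 = 0 \<and> (\<forall>s<T. e s + s mod 2 \<le> e (Suc s))"

definition route_cost :: "nat \<Rightarrow> (nat \<Rightarrow> nat) \<Rightarrow> real" where
  "route_cost T e = (\<Sum>s<T. step_cost s (e s) (e (Suc s) - s mod 2))"

lemma Suc_div2: "Suc s div 2 = s div 2 + s mod 2"
  by (cases "even s") (auto simp: odd_iff_mod_2_eq_one)

lemma route_ge: "is_route T e \<Longrightarrow> s \<le> T \<Longrightarrow> s div 2 \<le> e s"
proof (induction s)
  case (Suc s)
  then have "e s + s mod 2 \<le> e (Suc s)" by (simp add: is_route_def)
  then show ?case using Suc Suc_div2[of s] by simp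
qed simp

lemma V_le_route_cost: "is_route T e \<Longrightarrow> V T (e T) \<le> route_cost T e"
proof (induction T)
  case (Suc T)
  let ?i = "e (Suc T) - T mod 2"
  have T: "is_route T e" and eT: "e T + T mod 2 \<le> e (Suc T)"
    using Suc.prems by (auto simp: is_route_def)
  have "T div 2 \<le> e T" using route_ge[OF T] by simp
  moreover have "e T \<le> col_max T ?i" using T eT by (auto simp: col_max_def is_route_def)
  ultimately have "V (Suc T) (e (Suc T)) \<le> entry T ?i (e T)"
    unfolding V_Suc opt_def by (intro leftmost_le) auto
  then show ?case using Suc.IH[OF T] by (simp add: entry_def route_cost_def)
qed (simp add: route_cost_def)

lemma V_eq_route_cost:
  assumes "\<And>s. s < T \<Longrightarrow> e s = opt s (e (Suc s) - s mod 2)"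
  shows "V T (e T) = route_cost T e"
  using assms
proof (induction T)
  case (Suc T)
  have "V T (e T) = route_cost T e" by (rule Suc.IH) (use Suc.prems in simp)
  moreover have "e T = opt T (e (Suc T) - T mod 2)" using Suc.prems by simp
  ultimately show ?case by (simp add: V_Suc entry_def route_cost_def)
qed (simp add: route_cost_def)

primrec backtrack :: "nat \<Rightarrow> nat \<Rightarrow> nat" where
  "backtrack k 0 = n"
| "backtrack k (Suc d) = opt (2 * k - Suc d) (backtrack k d - (2 * k - Suc d) mod 2)"

lemma backtrack_bounds:
  assumes "k \<le> n" "d \<le> 2 * k"
  shows "(2 * k - d) div 2 \<le> backtrack k d" "backtrack k d \<le> n"
proof -
  have "(2 * k - d) div 2 \<le> backtrack k d \<and> backtrack k d \<le> n"
    using assms(2)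
  proof (induction d)
    case (Suc d)
    define s where "s = 2 * k - Suc d"
    have s: "2 * k - d = Suc s" using Suc by (simp add: s_def)
    have "s div 2 \<le> backtrack k d - s mod 2" using Suc s Suc_div2[of s] by simp linarith
    then show ?case using opt_in[of s "backtrack k d - s mod 2"] opt_le[of s "backtrack k d - s mod 2"] Suc
      by (simp add: s_def[symmetric]) linarith
  qed (use assms in simp)
  then show "(2 * k - d) div 2 \<le> backtrack k d" "backtrack k d \<le> n" by auto
qed

definition route :: "nat \<Rightarrow> nat \<Rightarrow> nat" where
  "route k s = backtrack k (2 * k - s)"

lemma route_step: "s < 2 * k \<Longrightarrow> route k s = opt s (route k (Suc s) - s mod 2)"
proof -
  assume "s < 2 * k"
  then have "2 * k - s = Suc (2 * k - Suc s)" "2 * k - Suc (2 * k - Suc s) = s" by auto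
  then show ?thesis by (simp add: route_def)
qed

lemma route_bounds: "k \<le> n \<Longrightarrow> s \<le> 2 * k \<Longrightarrow> s div 2 \<le> route k s \<and> route k s \<le> n"
  using backtrack_bounds[of k "2 * k - s"] by (simp add: route_def)

lemma route_row:
  assumes "k \<le> n" "s < 2 * k"
  shows "s div 2 \<le> route k (Suc s) - s mod 2" "s mod 2 \<le> route k (Suc s)"
  using route_bounds[of k "Suc s"] assms Suc_div2[of s] by auto

lemma route_is_route:
  assumes "1 \<le> k" "k \<le> n"
  shows "is_route (2 * k) (route k)"
  unfolding is_route_def
proof (intro conjI allI impI)
  show "route k 0 = 0"
    using route_step[of 0 k] opt_in[of 0 "route k (Suc 0)"] assms by (simp add: col_max_def)
  fix s assume s: "s < 2 * k"
  then show "route k s + s mod 2 \<le> route k (Suc s)"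
    using route_step[OF s] opt_le[of s "route k (Suc s) - s mod 2"] route_row[OF assms(2) s] by linarith
qed

lemma sink_solution_block:
  assumes "sink_solution N k b x" "j < k"
  shows "b j < b (Suc j)" "b (Suc j) \<le> n"
proof -
  have less: "b i < b (Suc i)" if "i < k" for i using assms that by (simp add: sink_solution_def)
  show "b j < b (Suc j)" using less assms(2) by blast
  have "b (Suc j) \<le> b k" if "Suc j \<le> k" using that
  proof (induction rule: inc_induct)
    case (step i)
    then show ?case using less[of i] by simp
  qed simp
  then show "b (Suc j) \<le> n" using assms by (simp add: sink_solution_def)
qed

lemma route_solution_cost:
  assumes "\<And>j. j < k \<Longrightarrow> e (2 * j) \<le> e (Suc (2 * j)) \<and> e (Suc (2 * j)) < e (2 * Suc j) \<and> e (2 * Suc j) \<le> n"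
    "\<And>j. j \<le> k \<Longrightarrow> b j = e (2 * j)" "\<And>j. j < k \<Longrightarrow> x j = position N (e (Suc (2 * j)))"
  shows "solution_cost N k b x = route_cost (2 * k) e"
  unfolding solution_cost_def route_cost_def sum_pairs
proof (intro sum.cong refl)
  fix j assume "j \<in> {..<k}"
  then show "subpath_cost N (b j) (b (Suc j)) (x j) =
    step_cost (2 * j) (e (2 * j)) (e (Suc (2 * j)) - 2 * j mod 2) +
    step_cost (Suc (2 * j)) (e (Suc (2 * j))) (e (Suc (Suc (2 * j))) - Suc (2 * j) mod 2)"
    using assms(1)[of j] assms(2)[of j] assms(2)[of "Suc j"] assms(3)[of j]
    by (simp add: subpath_cost_eq step_cost_def)
qed

text \<open>Sinks are moved to vertices block by block without raising the cost; boundaries and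
  sinks then interleave to a route.\<close>

lemma V_le_solution_cost:
  assumes "sink_solution N k b x"
  shows "V (2 * k) n \<le> solution_cost N k b x"
proof -
  have "\<exists>g. b j \<le> g \<and> g < b (Suc j) \<and>
      subpath_cost N (b j) (b (Suc j)) (position N g) \<le> subpath_cost N (b j) (b (Suc j)) (x j)"
    if "j < k" for j
    using assms that sink_solution_block[OF assms that]
    by (intro vertex_sink) (auto simp: sink_solution_def)
  then obtain g where g: "\<And>j. j < k \<Longrightarrow> b j \<le> g j \<and> g j < b (Suc j) \<and>
      subpath_cost N (b j) (b (Suc j)) (position N (g j)) \<le> subpath_cost N (b j) (b (Suc j)) (x j)"
    by metis
  define e where "e = (\<lambda>s. if even s then b (s div 2) else g (s div 2))"
  have e: "e (2 * j) = b j" "e (Suc (2 * j)) = g j" "e (Suc (Suc (2 * j))) = b (Suc j)" for j by (simp_all add: e_def)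
  have route: "is_route (2 * k) e"
    unfolding is_route_def
  proof (intro conjI allI impI)
    show "e 0 = 0" using assms by (simp add: e_def sink_solution_def)
    fix s assume "s < 2 * k"
    then have "s div 2 < k" by auto
    then show "e s + s mod 2 \<le> e (Suc s)" using g[of "s div 2"]
      by (cases "even s") (auto simp: e_def odd_iff_mod_2_eq_one)
  qed
  have "V (2 * k) n \<le> route_cost (2 * k) e"
    using V_le_route_cost[OF route] assms by (simp add: e sink_solution_def)
  also have "\<dots> = solution_cost N k b (\<lambda>j. position N (g j))"
    using g sink_solution_block[OF assms] by (intro route_solution_cost[symmetric]) (auto simp: e)
  also have "\<dots> \<le> solution_cost N k b x"
    unfolding solution_cost_def using g by (intro sum_mono) auto
  finally show ?thesis .
qed

lemma route_optimal:
  assumes k: "1 \<le> k" "k \<le> n"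
    and b: "\<And>j. j \<le> k \<Longrightarrow> b j = route k (2 * j)" and x: "\<And>j. j < k \<Longrightarrow> x j = position N (route k (Suc (2 * j)))"
  shows "minsum_solution N k b x" "V (2 * k) n = solution_cost N k b x"
proof -
  have step: "route k (2 * j) \<le> route k (Suc (2 * j)) \<and>
      route k (Suc (2 * j)) < route k (2 * Suc j) \<and> route k (2 * Suc j) \<le> n" if "j < k" for j
  proof -
    have "route k s + s mod 2 \<le> route k (Suc s)" if "s < 2 * k" for s
      using route_is_route[OF k] that by (simp add: is_route_def)
    from this[of "2 * j"] this[of "Suc (2 * j)"] show ?thesis
      using that route_bounds[OF k(2), of "2 * Suc j"] by simp
  qed
  have end_n: "route k (2 * k) = n" by (simp add: route_def)
  have "V (2 * k) (route k (2 * k)) = route_cost (2 * k) (route k)"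
    using route_step by (intro V_eq_route_cost) auto
  also have "\<dots> = solution_cost N k b x"
    using step b x by (intro route_solution_cost[symmetric]) auto
  finally show eq: "V (2 * k) n = solution_cost N k b x" by (simp add: end_n)
  have "sink_solution N k b x"
    unfolding sink_solution_def
  proof (intro conjI allI impI)
    show "b 0 = 0" using b[of 0] route_is_route[OF k] by (simp add: is_route_def)
    show "b k = n" using b[of k] end_n by simp
    fix j assume j: "j < k"
    show "b j < b (Suc j)" using step[OF j] b[of j] b[of "Suc j"] j by simp
    have "b j = route k (2 * j)" "b (Suc j) = route k (2 * Suc j)" using b j by auto
    then show "x j \<in> {position N (b j)..position N (b (Suc j) - 1)}"
      using step[OF j] x[OF j] by (auto intro!: position_le)
  qed
  then show "minsum_solution N k b x"
    using V_le_solution_cost unfolding minsum_solution_def eq[symmetric] by blast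
qed

end

section \<open>Time-bounded total correctness\<close>

definition terminates :: "nat \<Rightarrow> com \<Rightarrow> store \<Rightarrow> nat \<Rightarrow> (store \<Rightarrow> bool) \<Rightarrow> bool" where
  "terminates B p \<sigma> T Q \<longleftrightarrow> (\<exists>t \<sigma>'. runs B p \<sigma> t \<sigma>' \<and> t \<le> T \<and> Q \<sigma>')"

lemma terminates_Seq:
  assumes "terminates B p \<sigma> T R" "\<And>\<sigma>'. R \<sigma>' \<Longrightarrow> terminates B q \<sigma>' T' Q" "T + T' \<le> T''"
  shows "terminates B (Seq p q) \<sigma> T'' Q"
proof -
  obtain t \<sigma>' where 1: "runs B p \<sigma> t \<sigma>'" "t \<le> T" "R \<sigma>'" using assms(1) by (auto simp: terminates_def)
  obtain t' \<sigma>'' where 2: "runs B q \<sigma>' t' \<sigma>''" "t' \<le> T'" "Q \<sigma>''"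
    using assms(2)[OF 1(3)] by (auto simp: terminates_def)
  show ?thesis unfolding terminates_def
    using runs.Seq[OF 1(1) 2(1)] 1(2) 2(2,3) assms(3) by (intro exI[of _ "t + t'"] exI conjI) auto
qed

lemma terminates_mono:
  "terminates B p \<sigma> T Q \<Longrightarrow> T \<le> T' \<Longrightarrow> (\<And>\<sigma>'. Q \<sigma>' \<Longrightarrow> Q' \<sigma>') \<Longrightarrow> terminates B p \<sigma> T' Q'"
  unfolding terminates_def by (meson order_trans)

text \<open>Meant for straight-line code and branches, where simplification evaluates the program
  symbolically; \<open>While\<close> gets \<open>False\<close> and is left to
  \<open>terminates_loop\<close>.\<close>

fun wp :: "nat \<Rightarrow> com \<Rightarrow> (store \<Rightarrow> bool) \<Rightarrow> store \<Rightarrow> bool" where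
  "wp B Skip Q \<sigma> \<longleftrightarrow> Q \<sigma>"
| "wp B (NAssign a i e) Q \<sigma> \<longleftrightarrow>
     nfits B \<sigma> i \<and> nfits B \<sigma> e \<and> Q (nwrite a (nval \<sigma> i) (nval \<sigma> e) \<sigma>)"
| "wp B (RAssign a i e) Q \<sigma> \<longleftrightarrow>
     nfits B \<sigma> i \<and> rfits B \<sigma> e \<and> Q (rwrite a (nval \<sigma> i) (rval \<sigma> e) \<sigma>)"
| "wp B (Seq p q) Q \<sigma> \<longleftrightarrow> wp B p (wp B q Q) \<sigma>"
| "wp B (Cond b p q) Q \<sigma> \<longleftrightarrow> bfits B \<sigma> b \<and> (if bval \<sigma> b then wp B p Q \<sigma> else wp B q Q \<sigma>)"
| "wp B (While b p) Q \<sigma> \<longleftrightarrow> False"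

fun steps :: "com \<Rightarrow> nat" where
  "steps (Seq p q) = steps p + steps q"
| "steps (Cond b p q) = Suc (max (steps p) (steps q))"
| "steps _ = 1"

lemma terminates_wp: "wp B p Q \<sigma> \<Longrightarrow> terminates B p \<sigma> (steps p) Q"
proof (induction p arbitrary: Q \<sigma>)
  case (Seq p q)
  have "terminates B p \<sigma> (steps p) (wp B q Q)" using Seq by simp
  then show ?case by (rule terminates_Seq) (use Seq in auto)
next
  case Skip
  then show ?case using runs.Skip by (fastforce simp: terminates_def)
next
  case (NAssign a i e)
  then show ?case using runs.NAssign by (fastforce simp: terminates_def)
next
  case (RAssign a i e)
  then show ?case using runs.RAssign by (fastforce simp: terminates_def)
next
  case (Cond b p q)
  show ?case
  proof (cases "bval \<sigma> b")
    case True
    then have "terminates B p \<sigma> (steps p) Q" using Cond by simp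
    then show ?thesis unfolding terminates_def using runs.CondTrue True Cond.prems by fastforce
  next
    case False
    then have "terminates B q \<sigma> (steps q) Q" using Cond by simp
    then show ?thesis unfolding terminates_def using runs.CondFalse False Cond.prems by fastforce
  qed
qed simp

fun nat_mods :: "com \<Rightarrow> string set" where
  "nat_mods (NAssign a i e) = {a}"
| "nat_mods (Seq p q) = nat_mods p \<union> nat_mods q"
| "nat_mods (Cond b p q) = nat_mods p \<union> nat_mods q"
| "nat_mods (While b p) = nat_mods p"
| "nat_mods _ = {}"

fun real_mods :: "com \<Rightarrow> string set" where
  "real_mods (RAssign a i e) = {a}"
| "real_mods (Seq p q) = real_mods p \<union> real_mods q"
| "real_mods (Cond b p q) = real_mods p \<union> real_mods q"
| "real_mods (While b p) = real_mods p"
| "real_mods _ = {}"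

text \<open>A frame condition read off the program text, so that loop invariants need to mention
  only the arrays that change.\<close>

definition unchanged :: "com \<Rightarrow> store \<Rightarrow> store \<Rightarrow> bool" where
  "unchanged p \<sigma> \<sigma>' \<longleftrightarrow> (\<forall>a. a \<notin> nat_mods p \<longrightarrow> nats \<sigma>' a = nats \<sigma> a) \<and>
     (\<forall>a. a \<notin> real_mods p \<longrightarrow> reals \<sigma>' a = reals \<sigma> a)"

lemma unchanged_refl: "unchanged p \<sigma> \<sigma>" by (simp add: unchanged_def)

lemma unchanged_trans: "unchanged p \<sigma> \<sigma>' \<Longrightarrow> unchanged p \<sigma>' \<sigma>'' \<Longrightarrow> unchanged p \<sigma> \<sigma>''"
  by (simp add: unchanged_def)

lemma nwrite_simps [simp]:
  "nats (nwrite a i m \<sigma>) b = (if b = a then (nats \<sigma> b)(i := m) else nats \<sigma> b)"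
  "reals (nwrite a i m \<sigma>) = reals \<sigma>"
  by (auto simp: nwrite_def)

lemma rwrite_simps [simp]:
  "reals (rwrite a i r \<sigma>) b = (if b = a then (reals \<sigma> b)(i := r) else reals \<sigma> b)"
  "nats (rwrite a i r \<sigma>) = nats \<sigma>"
  by (auto simp: rwrite_def)

lemma runs_unchanged: "runs B p \<sigma> t \<sigma>' \<Longrightarrow> unchanged p \<sigma> \<sigma>'"
  by (induction rule: runs.induct) (auto simp: unchanged_def)

lemma terminates_unchanged:
  "terminates B p \<sigma> T Q \<Longrightarrow> terminates B p \<sigma> T (\<lambda>\<sigma>'. Q \<sigma>' \<and> unchanged p \<sigma> \<sigma>')"
  unfolding terminates_def using runs_unchanged by blast

lemma terminates_Seq_wp:
  assumes "terminates B p \<sigma> T R" "\<And>\<sigma>'. R \<sigma>' \<Longrightarrow> unchanged p \<sigma> \<sigma>' \<Longrightarrow> wp B q Q \<sigma>'" "T + steps q \<le> T'"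
  shows "terminates B (Seq p q) \<sigma> T' Q"
  using terminates_Seq[OF terminates_unchanged[OF assms(1)] _ assms(3)] assms(2) terminates_wp by blast

lemma terminates_While:
  assumes "I 0 \<sigma>\<^sub>0"
    and step: "\<And>i \<sigma>. i < m \<Longrightarrow> I i \<sigma> \<Longrightarrow> unchanged p \<sigma>\<^sub>0 \<sigma> \<Longrightarrow>
      bfits B \<sigma> b \<and> bval \<sigma> b \<and> terminates B p \<sigma> (T i) (I (Suc i))"
    and exit: "\<And>\<sigma>. I m \<sigma> \<Longrightarrow> unchanged p \<sigma>\<^sub>0 \<sigma> \<Longrightarrow> bfits B \<sigma> b \<and> \<not> bval \<sigma> b"
  shows "terminates B (While b p) \<sigma>\<^sub>0 (Suc (\<Sum>i<m. Suc (T i))) (\<lambda>\<sigma>. I m \<sigma> \<and> unchanged p \<sigma>\<^sub>0 \<sigma>)"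
proof -
  have "terminates B (While b p) \<sigma> (Suc (\<Sum>i\<in>{j..<m}. Suc (T i))) (\<lambda>\<sigma>. I m \<sigma> \<and> unchanged p \<sigma>\<^sub>0 \<sigma>)"
    if "j \<le> m" "I j \<sigma>" "unchanged p \<sigma>\<^sub>0 \<sigma>" for j \<sigma>
    using that
  proof (induction j arbitrary: \<sigma> rule: inc_induct)
    case base
    then show ?case unfolding terminates_def using exit[of \<sigma>] runs.WhileFalse by fastforce
  next
    case (step j)
    obtain t \<sigma>' where 1: "runs B p \<sigma> t \<sigma>'" "t \<le> T j" "I (Suc j) \<sigma>'"
      using assms(2)[of j \<sigma>] step by (auto simp: terminates_def)
    have "unchanged p \<sigma>\<^sub>0 \<sigma>'" using unchanged_trans[OF step.prems(2) runs_unchanged[OF 1(1)]] .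
    from step.IH[OF 1(3) this] obtain t' \<sigma>'' where
      2: "runs B (While b p) \<sigma>' t' \<sigma>''" "t' \<le> Suc (\<Sum>i\<in>{Suc j..<m}. Suc (T i))"
        "I m \<sigma>''" "unchanged p \<sigma>\<^sub>0 \<sigma>''" by (auto simp: terminates_def)
    have "runs B (While b p) \<sigma> (Suc (t + t')) \<sigma>''"
      using assms(2)[of j \<sigma>] step by (intro runs.WhileTrue[OF _ _ 1(1) 2(1)]) auto
    moreover have "(\<Sum>i\<in>{j..<m}. Suc (T i)) = Suc (T j) + (\<Sum>i\<in>{Suc j..<m}. Suc (T i))"
      using step.hyps by (simp only: sum.atLeast_Suc_lessThan)
    ultimately show ?case
      unfolding terminates_def using 1(2) 2(2,3,4) by (intro exI conjI) auto
  qed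
  from this[of 0 \<sigma>\<^sub>0] show ?thesis
    using assms(1) unchanged_refl by (simp add: lessThan_atLeast0)
qed

text \<open>Each iteration has its own time bound \<open>T i\<close>; the amortized bounds for next
  greater elements and for the scans of a level are sums of such bounds.\<close>

lemma terminates_loop:
  assumes init: "wp B p\<^sub>0 (I 0) \<sigma>"
    and step: "\<And>i \<sigma>'. i < m \<Longrightarrow> I i \<sigma>' \<Longrightarrow> unchanged (Seq p\<^sub>0 p) \<sigma> \<sigma>' \<Longrightarrow>
      bfits B \<sigma>' b \<and> bval \<sigma>' b \<and> terminates B p \<sigma>' (T i) (I (Suc i))"
    and exit: "\<And>\<sigma>'. I m \<sigma>' \<Longrightarrow> unchanged (Seq p\<^sub>0 p) \<sigma> \<sigma>' \<Longrightarrow> bfits B \<sigma>' b \<and> \<not> bval \<sigma>' b \<and> Q \<sigma>'"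
    and time: "steps p\<^sub>0 + Suc (\<Sum>i<m. Suc (T i)) \<le> T'"
  shows "terminates B (Seq p\<^sub>0 (While b p)) \<sigma> T' Q"
proof (rule terminates_Seq[OF terminates_unchanged[OF terminates_wp[OF init]] _ time])
  fix \<sigma>\<^sub>0 assume 0: "I 0 \<sigma>\<^sub>0 \<and> unchanged p\<^sub>0 \<sigma> \<sigma>\<^sub>0"
  have u: "unchanged (Seq p\<^sub>0 p) \<sigma> \<sigma>'" if "unchanged p \<sigma>\<^sub>0 \<sigma>'" for \<sigma>'
    using 0 that by (simp add: unchanged_def)
  have "terminates B (While b p) \<sigma>\<^sub>0 (Suc (\<Sum>i<m. Suc (T i))) (\<lambda>\<sigma>'. I m \<sigma>' \<and> unchanged p \<sigma>\<^sub>0 \<sigma>')"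
    using 0 step exit u by (intro terminates_While) auto
  then show "terminates B (While b p) \<sigma>\<^sub>0 (Suc (\<Sum>i<m. Suc (T i))) Q"
    by (rule terminates_mono) (use exit u in auto)
qed

section \<open>Precomputation\<close>

abbreviation var :: "string \<Rightarrow> nexp" where "var a \<equiv> NCell a (NConst 0)"
abbreviation rvar :: "string \<Rightarrow> rexp" where "rvar a \<equiv> RCell a (NConst 0)"
abbreviation assign :: "string \<Rightarrow> nexp \<Rightarrow> com" where "assign a e \<equiv> NAssign a (NConst 0) e"
abbreviation rassign :: "string \<Rightarrow> rexp \<Rightarrow> com" where "rassign a e \<equiv> RAssign a (NConst 0) e"
abbreviation inc :: "nexp \<Rightarrow> nexp" where "inc e \<equiv> NPlus e (NConst 1)"
notation Seq (infixr \<open>;;\<close> 60)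

definition prefix_body :: com where
  "prefix_body =
     Cond (NLess (var ''a'') (var ''n'')) (assign ''v'' (var ''a''))
       (assign ''v'' (NMinus (NMinus (var ''D'') (NConst 1)) (var ''a''))) ;;
     RAssign ''S'' (inc (var ''a'')) (RPlus (RCell ''S'' (var ''a'')) (RCell ''w'' (var ''v''))) ;;
     RAssign ''H'' (inc (var ''a'')) (RPlus (RCell ''H'' (var ''a''))
       (RPlus (RDiv (RTimes (RCell ''w'' (var ''v'')) (RCell ''S'' (var ''a''))) (rvar ''c''))
         (RDiv (RTimes (RCell ''w'' (var ''v'')) (RCell ''w'' (var ''v'')))
           (RPlus (rvar ''c'') (rvar ''c''))))) ;;
     RAssign ''U'' (var ''a'')
       (RMinus (RCell ''Q'' (var ''a'')) (RDiv (RCell ''S'' (var ''a'')) (rvar ''c''))) ;;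
     Cond (NLess (inc (var ''a'')) (var ''n'')) (assign ''v'' (var ''a''))
       (assign ''v'' (NMinus (NMinus (var ''D'') (NConst 2)) (var ''a''))) ;;
     RAssign ''Q'' (inc (var ''a'')) (RPlus (RCell ''Q'' (var ''a''))
       (RTimes (rvar ''tau'') (RCell ''d'' (var ''v'')))) ;;
     assign ''a'' (inc (var ''a''))"

definition prefix_prog :: com where
  "prefix_prog =
     (assign ''W'' (inc (var ''n'')) ;;
     assign ''D'' (NPlus (var ''n'') (var ''n'')) ;;
     assign ''Y'' (inc (var ''D'')) ;;
     assign ''a'' (NConst 0)) ;;
     While (NLess (var ''a'') (var ''D'')) prefix_body"

text \<open>The stack algorithm for next greater elements, from right to left: the chain of
  \<open>J\<close> from \<open>a + 1\<close> is the stack, and following it while \<open>U\<close>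
  does not exceed \<open>U a\<close> pops elements.\<close>

definition next_body :: com where
  "next_body =
     ((assign ''q'' (var ''a'') ;; assign ''a'' (NMinus (var ''a'') (NConst 1))) ;;
     While (BAnd (NLess (var ''q'') (var ''D''))
         (BNot (RLess (RCell ''U'' (var ''a'')) (RCell ''U'' (var ''q'')))))
       (assign ''q'' (NCell ''J'' (var ''q'')))) ;;
     (NAssign ''J'' (var ''a'') (var ''q'') ;;
     RAssign ''P'' (var ''a'') (RPlus (RTimes (RCell ''U'' (var ''a''))
         (RMinus (RCell ''S'' (var ''q'')) (RCell ''S'' (var ''a''))))
       (RCell ''P'' (var ''q''))))"

definition next_prog :: com where
  "next_prog =
     (assign ''a'' (var ''D'') ;; NAssign ''J'' (var ''D'') (var ''D'')) ;;
     While (NLess (NConst 0) (var ''a'')) next_body"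

text \<open>The largest numbers are addresses in tables stored row by row. Row counts and row
  lengths are linear in \<open>n\<close>, so a quadratic bound suffices, and the factor 64 leaves
  room for intermediate results.\<close>

locale ram = network +
  fixes k B :: nat
  assumes k: "1 \<le> k" "k \<le> n" and B: "64 * (n + 1) * (n + 1) \<le> B"
begin

text \<open>Row lengths of the tables; kept folded, so that linear arithmetic treats index products as atoms.\<close>

definition W :: nat where "W = Suc n"
definition Y :: nat where "Y = Suc (2 * n)"

definition input :: "store \<Rightarrow> bool" where
  "input \<sigma> \<longleftrightarrow> nats \<sigma> ''n'' 0 = n \<and> nats \<sigma> ''k'' 0 = k \<and>
     reals \<sigma> ''c'' 0 = c \<and> reals \<sigma> ''tau'' 0 = \<tau> \<and>
     (\<forall>i<n. reals \<sigma> ''w'' i = weight N i) \<and> (\<forall>i. reals \<sigma> ''d'' i = gap i)"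

definition prefix_tables :: "store \<Rightarrow> bool" where
  "prefix_tables \<sigma> \<longleftrightarrow> input \<sigma> \<and> nats \<sigma> ''W'' 0 = W \<and> nats \<sigma> ''D'' 0 = 2 * n \<and> nats \<sigma> ''Y'' 0 = Y \<and>
     (\<forall>j\<le>2*n. reals \<sigma> ''S'' j = S j \<and> reals \<sigma> ''H'' j = H j \<and> reals \<sigma> ''Q'' j = q j) \<and>
     (\<forall>j<2*n. reals \<sigma> ''U'' j = U j)"

lemma linear_fits: "64 * n + 64 \<le> B"
proof -
  have "64 * (n + 1) * 1 \<le> 64 * (n + 1) * (n + 1)" by (intro mult_le_mono2) simp
  then show ?thesis using B by simp
qed

lemma prefix_step:
  assumes "i < 2 * n" "nats \<sigma> ''a'' 0 = i" "\<forall>j\<le>i. reals \<sigma> ''S'' j = S j \<and> reals \<sigma> ''H'' j = H j \<and> reals \<sigma> ''Q'' j = q j"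
    "\<forall>j<i. reals \<sigma> ''U'' j = U j" "input \<sigma>" "nats \<sigma> ''D'' 0 = 2 * n"
  shows "terminates B prefix_body \<sigma> (steps prefix_body) (\<lambda>\<sigma>. nats \<sigma> ''a'' 0 = Suc i \<and>
      (\<forall>j\<le>Suc i. reals \<sigma> ''S'' j = S j \<and> reals \<sigma> ''H'' j = H j \<and> reals \<sigma> ''Q'' j = q j) \<and>
      (\<forall>j<Suc i. reals \<sigma> ''U'' j = U j))"
proof (rule terminates_wp)
  have w: "reals \<sigma> ''w'' (if i < n then i else 2 * n - 1 - i) = \<omega> i"
    using assms by (auto simp: input_def \<omega>_def)
  have q: "q (Suc i) = q i + \<tau> * gap (if Suc i < n then i else 2 * n - 2 - i)"
    by (simp add: q_def)
  show "wp B prefix_body (\<lambda>\<sigma>. nats \<sigma> ''a'' 0 = Suc i \<and>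
      (\<forall>j\<le>Suc i. reals \<sigma> ''S'' j = S j \<and> reals \<sigma> ''H'' j = H j \<and> reals \<sigma> ''Q'' j = q j) \<and>
      (\<forall>j<Suc i. reals \<sigma> ''U'' j = U j)) \<sigma>"
    using assms linear_fits w q
    by (auto simp: prefix_body_def input_def S_Suc H_def U_def le_Suc_eq less_Suc_eq)
qed

lemma prefix_prog:
  assumes \<sigma>: "input \<sigma>" "reals \<sigma> ''S'' 0 = 0" "reals \<sigma> ''H'' 0 = 0" "reals \<sigma> ''Q'' 0 = 0"
  shows "terminates B prefix_prog \<sigma> (40 * n + 10) prefix_tables"
  unfolding prefix_prog_def
proof (rule terminates_loop[where m = "2 * n" and T = "\<lambda>_. steps prefix_body" and
      I = "\<lambda>i \<sigma>. nats \<sigma> ''W'' 0 = W \<and> nats \<sigma> ''D'' 0 = 2 * n \<and> nats \<sigma> ''Y'' 0 = Y \<and> nats \<sigma> ''a'' 0 = i \<and>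
      (\<forall>j\<le>i. reals \<sigma> ''S'' j = S j \<and> reals \<sigma> ''H'' j = H j \<and> reals \<sigma> ''Q'' j = q j) \<and>
      (\<forall>j<i. reals \<sigma> ''U'' j = U j)"], goal_cases)
  case 1
  show ?case using \<sigma> linear_fits by (auto simp: input_def W_def Y_def S_def H_def q_def)
next
  case (2 i \<sigma>')
  have I: "input \<sigma>'" using 2 \<sigma>(1) by (simp add: unchanged_def prefix_body_def input_def)
  have "terminates B prefix_body \<sigma>' (steps prefix_body) (\<lambda>\<sigma>''. (nats \<sigma>'' ''a'' 0 = Suc i \<and>
      (\<forall>j\<le>Suc i. reals \<sigma>'' ''S'' j = S j \<and> reals \<sigma>'' ''H'' j = H j \<and> reals \<sigma>'' ''Q'' j = q j) \<and>
      (\<forall>j<Suc i. reals \<sigma>'' ''U'' j = U j)) \<and> unchanged prefix_body \<sigma>' \<sigma>'')"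
    using 2 I by (intro terminates_unchanged prefix_step) auto
  then have "terminates B prefix_body \<sigma>' (steps prefix_body) (\<lambda>\<sigma>. nats \<sigma> ''W'' 0 = W \<and> nats \<sigma> ''D'' 0 = 2 * n \<and> nats \<sigma> ''Y'' 0 = Y \<and> nats \<sigma> ''a'' 0 = Suc i \<and>
      (\<forall>j\<le>Suc i. reals \<sigma> ''S'' j = S j \<and> reals \<sigma> ''H'' j = H j \<and> reals \<sigma> ''Q'' j = q j) \<and>
      (\<forall>j<Suc i. reals \<sigma> ''U'' j = U j))"
    by (rule terminates_mono) (use 2 in \<open>auto simp: unchanged_def prefix_body_def\<close>)
  then show ?case using 2 linear_fits by auto
next
  case (3 \<sigma>')
  then show ?case using \<sigma>(1) linear_fits
    by (auto simp: unchanged_def prefix_body_def input_def prefix_tables_def)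
next
  case 4
  show ?case by (simp add: prefix_body_def)
qed

text \<open>The potential for the amortized analysis of the inner loop of \<open>next_prog\<close>.\<close>

definition depth :: "nat \<Rightarrow> nat" where
  "depth a = (LEAST m. (nxt ^^ m) a = 2 * n)"

lemma chain_le: "a \<le> 2 * n \<Longrightarrow> (nxt ^^ m) a \<le> 2 * n"
  using nxt_le by (cases m) auto

lemma chain_ge: "a \<le> 2 * n \<Longrightarrow> min (2 * n) (a + m) \<le> (nxt ^^ m) a"
proof (induction m)
  case (Suc m)
  show ?case
  proof (cases "(nxt ^^ m) a < 2 * n")
    case True
    then show ?thesis using Suc nxt_props(1)[OF True] by simp
  next
    case False
    then have "(nxt ^^ m) a = 2 * n" using chain_le[OF Suc.prems, of m] by simp
    then show ?thesis by (simp add: nxt_end)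
  qed
qed simp

lemma chain_end: "a \<le> 2 * n \<Longrightarrow> 2 * n \<le> m \<Longrightarrow> (nxt ^^ m) a = 2 * n"
  using chain_ge[of a m] chain_le[of a m] by simp

lemma depth_end: "depth (2 * n) = 0"
  unfolding depth_def by (intro Least_equality) auto

lemma depth_rec: "a < 2 * n \<Longrightarrow> depth a = Suc (depth (nxt a))"
proof -
  assume "a < 2 * n"
  then have "(LEAST m. (nxt ^^ m) a = 2 * n) = Suc (LEAST m. (nxt ^^ Suc m) a = 2 * n)"
    using chain_end[of a "2 * n"] by (intro Least_Suc) auto
  then show ?thesis by (simp add: depth_def funpow_swap1)
qed

text \<open>The chain of \<open>a\<close> consists of \<open>a\<close> and the part of the chain of
  \<open>Suc a\<close> that survives the \<open>m\<close> pops. So the number of iterations of the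
  inner loop is the drop of \<open>depth\<close>, plus one for the new element.\<close>

lemma pops:
  assumes a: "a < 2 * n"
  shows "\<exists>m. (\<forall>i<m. (nxt ^^ i) (Suc a) < 2 * n \<and> U ((nxt ^^ i) (Suc a)) \<le> U a) \<and>
    (nxt ^^ m) (Suc a) = nxt a \<and> (nxt a < 2 * n \<longrightarrow> U a < U (nxt a)) \<and> m + depth a = Suc (depth (Suc a))"
proof -
  define K where "K = (\<lambda>i. (nxt ^^ i) (Suc a))"
  \<comment> \<open>The guard of the inner loop after \<open>i\<close> moves along the
    chain.\<close>
  define c where "c = (\<lambda>i. K i < 2 * n \<and> U (K i) \<le> U a)"
  have ex: "\<not> c (2 * n)" using chain_end[of "Suc a" "2 * n"] a by (simp add: c_def K_def)
  define m where "m = (LEAST i. \<not> c i)"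
  have m: "\<not> c m" unfolding m_def using ex by (rule LeastI)
  have lt: "c i" if "i < m" for i using not_less_Least that unfolding m_def by blast
  have inv: "(\<forall>m'. a < m' \<longrightarrow> m' < K i \<longrightarrow> U m' \<le> U a) \<and> a < K i \<and> K i \<le> 2 * n \<and>
      i + depth (K i) = depth (Suc a)" if "i \<le> m" for i
    using that
  proof (induction i)
    case 0
    then show ?case using a by (simp add: K_def)
  next
    case (Suc i)
    then have IH: "\<And>m'. a < m' \<Longrightarrow> m' < K i \<Longrightarrow> U m' \<le> U a" "a < K i"
      "i + depth (K i) = depth (Suc a)" and c: "K i < 2 * n" "U (K i) \<le> U a"
      using lt[of i] by (auto simp: c_def)
    have K: "K (Suc i) = nxt (K i)" by (simp add: K_def)
    have "U m' \<le> U a" if "a < m'" "m' < nxt (K i)" for m'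
      using IH(1)[of m'] nxt_props(4)[OF c(1), of m'] c(2) that by (cases m' "K i" rule: linorder_cases) auto
    then show ?case using K IH c(1) nxt_props(1,2)[OF c(1)] depth_rec[OF c(1)] by simp
  qed
  have "nxt a = K m"
    using inv[OF order_refl] m by (intro nxt_eqI) (auto simp: c_def)
  then show ?thesis
    using lt inv[OF order_refl] depth_rec[OF a] nxt_props(3)[OF a] unfolding c_def K_def by auto
qed

definition next_tables :: "nat \<Rightarrow> store \<Rightarrow> bool" where
  "next_tables i \<sigma> \<longleftrightarrow> (\<forall>j. i \<le> j \<and> j \<le> 2 * n \<longrightarrow> nats \<sigma> ''J'' j = nxt j \<and> reals \<sigma> ''P'' j = P j)"

lemma next_step:
  assumes a: "a < 2 * n" and \<sigma>: "prefix_tables \<sigma>" "nats \<sigma> ''a'' 0 = Suc a" "next_tables (Suc a) \<sigma>"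
  shows "terminates B next_body \<sigma> (10 + 2 * (Suc (depth (Suc a)) - depth a))
    (\<lambda>\<sigma>'. nats \<sigma>' ''a'' 0 = a \<and> next_tables a \<sigma>')"
proof -
  obtain m where m: "\<And>i. i < m \<Longrightarrow> (nxt ^^ i) (Suc a) < 2 * n \<and> U ((nxt ^^ i) (Suc a)) \<le> U a"
    "(nxt ^^ m) (Suc a) = nxt a" "nxt a < 2 * n \<longrightarrow> U a < U (nxt a)" "m + depth a = Suc (depth (Suc a))"
    using pops[OF a] by blast
  let ?K = "\<lambda>i. (nxt ^^ i) (Suc a)"
  have K: "Suc a \<le> ?K i" "?K i \<le> 2 * n" for i
    using chain_ge[of "Suc a" i] chain_le[of "Suc a" i] a by auto
  show ?thesis
    unfolding next_body_def
  proof (rule terminates_Seq_wp[OF terminates_loop[where m = m and T = "\<lambda>_. 1" and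
      I = "\<lambda>i \<sigma>'. nats \<sigma>' ''a'' 0 = a \<and> nats \<sigma>' ''q'' 0 = ?K i" and
      Q = "\<lambda>\<sigma>'. nats \<sigma>' ''a'' 0 = a \<and> nats \<sigma>' ''q'' 0 = nxt a" and T' = "3 + 2 * m"]], goal_cases)
    case 1
    then show ?case using \<sigma> a linear_fits by simp
  next
    case (2 i \<sigma>')
    then have t: "prefix_tables \<sigma>'" "next_tables (Suc a) \<sigma>'"
      using \<sigma> by (simp_all add: unchanged_def prefix_tables_def input_def next_tables_def)
    have J: "nats \<sigma>' ''J'' (?K i) = ?K (Suc i)" "?K (Suc i) \<le> B" "?K i \<le> B" "2 * n \<le> B" "a \<le> B"
      using t(2) K[of i] K[of "Suc i"] linear_fits a by (simp_all add: next_tables_def)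
    have UU: "reals \<sigma>' ''U'' a = U a" "reals \<sigma>' ''U'' (?K i) = U (?K i)" "nats \<sigma>' ''D'' 0 = 2 * n"
      using t(1) a m(1)[OF 2(1)] by (simp_all add: prefix_tables_def)
    show ?case
    proof (intro conjI)
      show "terminates B (assign ''q'' (NCell ''J'' (var ''q''))) \<sigma>' 1
          (\<lambda>\<sigma>'. nats \<sigma>' ''a'' 0 = a \<and> nats \<sigma>' ''q'' 0 = ?K (Suc i))"
        by (rule terminates_mono[OF terminates_wp[where Q = "\<lambda>\<sigma>'. nats \<sigma>' ''a'' 0 = a \<and> nats \<sigma>' ''q'' 0 = ?K (Suc i)"]])
          (use 2 J in auto)
    qed (use 2 J UU m(1)[OF 2(1)] in auto)
  next
    case (3 \<sigma>')
    then have t: "prefix_tables \<sigma>'"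
      using \<sigma> by (simp_all add: unchanged_def prefix_tables_def input_def next_tables_def)
    then show ?case using 3 m(2,3) K[of m] linear_fits a
      by (cases "nxt a < 2 * n") (auto simp: prefix_tables_def)
  next
    case 4
    show ?case by simp
  next
    case (5 \<sigma>')
    then have t: "prefix_tables \<sigma>'" "next_tables (Suc a) \<sigma>'"
      using \<sigma> by (simp_all add: unchanged_def prefix_tables_def input_def next_tables_def)
    then show ?case
      using 5 P_rec[OF a] a nxt_le[of a] nxt_props(1)[OF a] linear_fits
      by (auto simp: prefix_tables_def next_tables_def le_Suc_eq Suc_le_eq nat_less_le)
  next
    case 6
    show ?case using m(4) by simp
  qed
qed

lemma next_prog:
  assumes \<sigma>: "prefix_tables \<sigma>" "reals \<sigma> ''P'' (2 * n) = 0"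
  shows "terminates B next_prog \<sigma> (30 * n + 10) (\<lambda>\<sigma>. prefix_tables \<sigma> \<and> next_tables 0 \<sigma>)"
  unfolding next_prog_def
proof (rule terminates_loop[where m = "2 * n" and
      T = "\<lambda>i. 10 + 2 * (Suc (depth (2 * n - i)) - depth (2 * n - Suc i))" and
      I = "\<lambda>i \<sigma>. nats \<sigma> ''a'' 0 = 2 * n - i \<and> next_tables (2 * n - i) \<sigma>"], goal_cases)
  case 1
  show ?case using \<sigma> linear_fits nxt_end P_end by (auto simp: prefix_tables_def next_tables_def)
next
  case (2 i \<sigma>')
  have t: "prefix_tables \<sigma>'"
    using \<sigma>(1) 2 by (simp add: unchanged_def prefix_tables_def input_def next_body_def)
  have "2 * n - i = Suc (2 * n - Suc i)" using 2 by simp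
  then have "terminates B next_body \<sigma>' (10 + 2 * (Suc (depth (2 * n - i)) - depth (2 * n - Suc i)))
      (\<lambda>\<sigma>'. nats \<sigma>' ''a'' 0 = 2 * n - Suc i \<and> next_tables (2 * n - Suc i) \<sigma>')"
    using next_step[of "2 * n - Suc i" \<sigma>'] 2 t by simp
  then show ?case using 2 linear_fits by simp
next
  case (3 \<sigma>')
  then show ?case
    using \<sigma>(1) by (simp add: unchanged_def prefix_tables_def input_def next_body_def)
next
  case 4
  \<comment> \<open>The potential telescopes: every \<open>a\<close> adds one element to the stack,
    so there are at most \<open>2 * n\<close> pops in total.\<close>
  have "(\<Sum>i<j. Suc (depth (2 * n - i)) - depth (2 * n - Suc i)) + depth (2 * n - j) = j" if "j \<le> 2 * n" for j
    using that
  proof (induction j)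
    case (Suc j)
    have "2 * n - j = Suc (2 * n - Suc j)" "2 * n - Suc j < 2 * n" using Suc by auto
    then have "depth (2 * n - Suc j) \<le> Suc (depth (2 * n - j))"
      using pops[of "2 * n - Suc j"] by auto
    then show ?case using Suc by simp
  qed (simp add: depth_end)
  from this[of "2 * n"] have "(\<Sum>i<2*n. Suc (depth (2 * n - i)) - depth (2 * n - Suc i)) \<le> 2 * n" by simp
  then show ?case
    by (simp add: sum.distrib sum_distrib_left[symmetric] flip: add_Suc)
qed

end

text \<open>Two jumps of length \<open>2 ^ L\<close> make one of length \<open>2 ^ (L + 1)\<close>.
  \<open>T\<close> holds \<open>2 ^ L\<close>, and its final value is reused as the first stride of
  every layer.\<close>

definition lift_body :: com where
  "lift_body =
     (assign ''a'' (NConst 0) ;;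
      While (NLess (var ''a'') (var ''Y''))
        (NAssign ''J'' (NPlus (NTimes (inc (var ''L'')) (var ''Y'')) (var ''a''))
           (NCell ''J'' (NPlus (NTimes (var ''L'') (var ''Y''))
             (NCell ''J'' (NPlus (NTimes (var ''L'') (var ''Y'')) (var ''a''))))) ;;
         assign ''a'' (inc (var ''a'')))) ;;
     (assign ''L'' (inc (var ''L'')) ;; assign ''T'' (NPlus (var ''T'') (var ''T'')))"

definition lift_prog :: com where
  "lift_prog = (assign ''L'' (NConst 0) ;; assign ''T'' (NConst 1)) ;;
     While (NLess (var ''T'') (var ''Y'')) lift_body"

text \<open>\<open>m\<close> becomes the last element not beyond \<open>y\<close> on the chain of
  \<open>x + 1\<close>, or stays at \<open>x + 1\<close>: jumps of decreasing length are taken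
  whenever they do not pass \<open>y\<close>. The final assignment adds \<open>V\<close> to the
  formula of \<open>evac_fast\<close>.\<close>

definition eval_prog :: com where
  "eval_prog =
     ((Cond (NLess (NConst 0) (var ''p''))
         (assign ''x'' (var ''h'') ;; assign ''y'' (var ''i''))
         (assign ''x'' (NMinus (NMinus (var ''D'') (NConst 1)) (var ''i'')) ;;
          assign ''y'' (NMinus (NMinus (var ''D'') (NConst 1)) (var ''h''))) ;;
       assign ''m'' (inc (var ''x'')) ;; assign ''l'' (var ''L'')) ;;
      While (NLess (NConst 0) (var ''l''))
        (assign ''l'' (NMinus (var ''l'') (NConst 1)) ;;
         Cond (NLess (NCell ''J'' (NPlus (NTimes (var ''l'') (var ''Y'')) (var ''m''))) (inc (var ''y'')))
           (assign ''m'' (NCell ''J'' (NPlus (NTimes (var ''l'') (var ''Y'')) (var ''m'')))) Skip)) ;;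
     rassign ''z'' (RPlus (RCell ''V'' (NPlus (var ''b'') (var ''h'')))
       (RPlus
         (RPlus (RMinus (RMinus (RCell ''H'' (inc (var ''y''))) (RCell ''H'' (inc (var ''x''))))
             (RTimes (RCell ''Q'' (var ''x''))
               (RMinus (RCell ''S'' (inc (var ''y''))) (RCell ''S'' (inc (var ''x''))))))
           (RMinus (RCell ''P'' (inc (var ''x''))) (RCell ''P'' (var ''m''))))
         (RTimes (RCell ''U'' (var ''m''))
           (RMinus (RCell ''S'' (inc (var ''y''))) (RCell ''S'' (var ''m''))))))"

section \<open>Jump tables and single cost queries\<close>

context ram
begin

text \<open>\<open>2 ^ lvl\<close> exceeds the length of every chain and the number of rows of every
  layer, so it serves both the jumps and the strides.\<close>

definition lvl :: nat where "lvl = (LEAST l. 2 * n < 2 ^ l)"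

lemma lvl: "2 * n < 2 ^ lvl" "l < lvl \<Longrightarrow> 2 ^ l \<le> 2 * n" "1 \<le> lvl" "lvl \<le> 2 * n"
  "2 ^ lvl \<le> 4 * n"
proof -
  have "2 * n < 2 ^ (2 * n)" by (rule less_exp)
  then show 1: "2 * n < 2 ^ lvl" unfolding lvl_def by (rule LeastI)
  show 2: "2 ^ l \<le> 2 * n" if "l < lvl" for l
    using not_less_Least[of l "\<lambda>l. 2 * n < 2 ^ l"] that by (simp add: lvl_def)
  show 3: "1 \<le> lvl" using 1 n_pos by (cases lvl) auto
  then obtain l where l: "lvl = Suc l" by (cases lvl) auto
  have "l < 2 ^ l" by (rule less_exp)
  then show "lvl \<le> 2 * n" "2 ^ lvl \<le> 4 * n" using 2[of l] l by (simp_all, linarith)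
qed

lemma table_fits: "x \<le> 4 * n + 4 \<Longrightarrow> y \<le> 4 * n + 4 \<Longrightarrow> x * y + (32 * n + 32) \<le> B"
proof -
  assume "x \<le> 4 * n + 4" "y \<le> 4 * n + 4"
  then have "x * y \<le> (4 * n + 4) * (4 * n + 4)" by (rule mult_le_mono)
  then show ?thesis using B by (simp add: algebra_simps)
qed

lemma row_less: "l' \<le> l \<Longrightarrow> j < Z \<Longrightarrow> l' * Z + j < Suc l * (Z :: nat)"
  by (metis add_less_le_mono add.commute mult_Suc mult_le_mono1 less_le_trans)

definition jump_table :: "nat \<Rightarrow> store \<Rightarrow> bool" where
  "jump_table l \<sigma> \<longleftrightarrow> (\<forall>l'\<le>l. \<forall>j\<le>2*n. nats \<sigma> ''J'' (l' * Y + j) = (nxt ^^ (2 ^ l')) j)"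

lemma jump_twice: "(nxt ^^ (2 ^ l)) ((nxt ^^ (2 ^ l)) a) = (nxt ^^ (2 ^ Suc l)) a"
  by (simp add: funpow_add mult_2)

lemma lift_step:
  assumes l: "l < lvl" and \<sigma>: "prefix_tables \<sigma>" "jump_table l \<sigma>"
    "nats \<sigma> ''L'' 0 = l" "nats \<sigma> ''T'' 0 = 2 ^ l"
  shows "terminates B lift_body \<sigma> (6 * n + 7)
    (\<lambda>\<sigma>. jump_table (Suc l) \<sigma> \<and> nats \<sigma> ''L'' 0 = Suc l \<and> nats \<sigma> ''T'' 0 = 2 ^ Suc l)"
  unfolding lift_body_def
proof (rule terminates_Seq_wp[OF terminates_loop[where m = "Suc (2 * n)" and T = "\<lambda>_. 2" and
      I = "\<lambda>i \<sigma>. nats \<sigma> ''a'' 0 = i \<and> jump_table l \<sigma> \<and> nats \<sigma> ''L'' 0 = l \<and> nats \<sigma> ''T'' 0 = 2 ^ l \<and>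
        (\<forall>j<i. nats \<sigma> ''J'' (Suc l * Y + j) = (nxt ^^ (2 ^ Suc l)) j)" and
      Q = "\<lambda>\<sigma>. jump_table (Suc l) \<sigma> \<and> nats \<sigma> ''L'' 0 = l \<and> nats \<sigma> ''T'' 0 = 2 ^ l" and T' = "6 * n + 5"]], goal_cases)
  case 1
  show ?case using \<sigma> by (auto simp: jump_table_def)
next
  case (2 i \<sigma>')
  have t: "prefix_tables \<sigma>'"
    using \<sigma>(1) 2 by (simp add: unchanged_def prefix_tables_def input_def)
  have i: "i \<le> 2 * n" using 2 by simp
  have J: "nats \<sigma>' ''J'' (l * Y + i) = (nxt ^^ (2 ^ l)) i"
    "nats \<sigma>' ''J'' (l * Y + (nxt ^^ (2 ^ l)) i) = (nxt ^^ (2 ^ Suc l)) i"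
    using 2 i chain_le[OF i] by (simp_all only: jump_table_def jump_twice order_refl)
  have fits: "l * Y + (32 * n + 32) \<le> B" "Suc l * Y + (32 * n + 32) \<le> B"
    using l lvl(4) table_fits[of l Y] table_fits[of "Suc l" Y] by (simp_all add: Y_def)
  have fits': "Suc l \<le> B" "Y \<le> B" using l lvl(4) linear_fits by (simp_all add: Y_def)
  note le = chain_le[OF i, of "2 ^ l"] chain_le[OF i, of "2 ^ Suc l"]
  \<comment> \<open>Level \<open>Suc l\<close> is written into the same array, behind all entries of
    the earlier levels.\<close>
  have ne: "l' * Y + j \<noteq> Suc l * Y + i" if "l' \<le> l" "j \<le> 2 * n" for l' j
    using row_less[OF that(1), of j Y] that(2) by (simp add: Y_def)
  have "terminates B
     (NAssign ''J'' (NPlus (NTimes (inc (var ''L'')) (var ''Y'')) (var ''a''))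
           (NCell ''J'' (NPlus (NTimes (var ''L'') (var ''Y''))
             (NCell ''J'' (NPlus (NTimes (var ''L'') (var ''Y'')) (var ''a''))))) ;;
         assign ''a'' (inc (var ''a''))) \<sigma>' 2 (\<lambda>\<sigma>. nats \<sigma> ''a'' 0 = Suc i \<and> jump_table l \<sigma> \<and> nats \<sigma> ''L'' 0 = l \<and> nats \<sigma> ''T'' 0 = 2 ^ l \<and>
        (\<forall>j<Suc i. nats \<sigma> ''J'' (Suc l * Y + j) = (nxt ^^ (2 ^ Suc l)) j))" (is "terminates _ _ _ _ ?Q")
    by (rule terminates_mono[OF terminates_wp[where Q = "?Q"]])
      (use 2 t i J fits fits' le ne linear_fits in \<open>auto simp: prefix_tables_def jump_table_def less_Suc_eq\<close>)
  then show ?case using 2 t i linear_fits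
    by (simp add: prefix_tables_def Y_def)
next
  case (3 \<sigma>')
  have "prefix_tables \<sigma>'" using \<sigma>(1) 3 by (simp add: unchanged_def prefix_tables_def input_def)
  then show ?case using 3 linear_fits by (auto simp: prefix_tables_def Y_def jump_table_def le_Suc_eq)
next
  case 4
  show ?case by simp
next
  case (5 \<sigma>')
  have "2 ^ l \<le> 2 * n" using lvl(2)[OF l] .
  then show ?case using 5 linear_fits l lvl(4) by (auto simp: jump_table_def)
next
  case 6
  show ?case by simp
qed

definition lift_tables :: "store \<Rightarrow> bool" where
  "lift_tables \<sigma> \<longleftrightarrow> prefix_tables \<sigma> \<and> (\<forall>j\<le>2*n. reals \<sigma> ''P'' j = P j) \<and>
     jump_table lvl \<sigma> \<and> nats \<sigma> ''L'' 0 = lvl \<and> nats \<sigma> ''T'' 0 = 2 ^ lvl"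

lemma lift_prog:
  assumes \<sigma>: "prefix_tables \<sigma>" "next_tables 0 \<sigma>"
  shows "terminates B lift_prog \<sigma> (3 + lvl * (6 * n + 8)) lift_tables"
  unfolding lift_prog_def
proof (rule terminates_loop[where m = lvl and T = "\<lambda>_. 6 * n + 7" and
      I = "\<lambda>l \<sigma>. jump_table l \<sigma> \<and> nats \<sigma> ''L'' 0 = l \<and> nats \<sigma> ''T'' 0 = 2 ^ l"], goal_cases)
  case 1
  show ?case using \<sigma> linear_fits by (auto simp: jump_table_def next_tables_def)
next
  case (2 l \<sigma>')
  have t: "prefix_tables \<sigma>'"
    using \<sigma>(1) 2 by (simp add: unchanged_def prefix_tables_def input_def lift_body_def)
  then show ?case using 2 lift_step[of l \<sigma>'] lvl(2)[of l] linear_fits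
    by (auto simp: prefix_tables_def Y_def)
next
  case (3 \<sigma>')
  have t: "prefix_tables \<sigma>'" "\<forall>j\<le>2*n. reals \<sigma>' ''P'' j = P j"
    using \<sigma> 3 by (simp_all add: unchanged_def prefix_tables_def input_def lift_body_def next_tables_def)
  then show ?case using 3 lvl linear_fits by (auto simp: prefix_tables_def lift_tables_def Y_def)
next
  case 4
  show ?case by simp
qed

definition cell_vars :: "nat \<Rightarrow> nat \<Rightarrow> nat \<Rightarrow> store \<Rightarrow> bool" where
  "cell_vars t i h \<sigma> \<longleftrightarrow> nats \<sigma> ''p'' 0 = t mod 2 \<and> nats \<sigma> ''b'' 0 = t * W \<and>
     nats \<sigma> ''i'' 0 = i \<and> nats \<sigma> ''h'' 0 = h"

lemma eval_prog:
  assumes \<sigma>: "lift_tables \<sigma>" "cell_vars t i h \<sigma>" and i: "h \<le> i" "i < n" "t < 2 * k"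
    and V: "reals \<sigma> ''V'' (t * W + h) = V t h"
  shows "terminates B eval_prog \<sigma> (4 * lvl + 10) (\<lambda>\<sigma>. reals \<sigma> ''z'' 0 = entry t i h)"
proof -
  define x where "x = (if odd t then h else 2 * n - 1 - i)"
  define y where "y = (if odd t then i else 2 * n - 1 - h)"
  have xy: "x \<le> y" "y < 2 * n" using i by (auto simp: x_def y_def)
  have x: "Suc x \<le> 2 * n" using xy by simp
  have C: "step_cost t h i = evac x y" by (simp add: step_cost_def x_def y_def)
  let ?J = "\<lambda>l. nxt ^^ (2 ^ l)"
  show ?thesis
    unfolding eval_prog_def
  proof (rule terminates_Seq_wp[OF terminates_loop[where m = lvl and T = "\<lambda>_. 3" and
      I = "\<lambda>it \<sigma>. nats \<sigma> ''x'' 0 = x \<and> nats \<sigma> ''y'' 0 = y \<and> nats \<sigma> ''l'' 0 = lvl - it \<and>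
        (\<exists>e. nats \<sigma> ''m'' 0 = (nxt ^^ e) (Suc x)) \<and> (nats \<sigma> ''m'' 0 = Suc x \<or> nats \<sigma> ''m'' 0 \<le> y) \<and>
        y < ?J (lvl - it) (nats \<sigma> ''m'' 0)" and
      Q = "\<lambda>\<sigma>. nats \<sigma> ''x'' 0 = x \<and> nats \<sigma> ''y'' 0 = y \<and>
        (\<exists>e. nats \<sigma> ''m'' 0 = (nxt ^^ e) (Suc x)) \<and> (nats \<sigma> ''m'' 0 = Suc x \<or> nats \<sigma> ''m'' 0 \<le> y) \<and>
        y < nxt (nats \<sigma> ''m'' 0)" and T' = "4 * lvl + 9"]], goal_cases)
    case 1
    have "y < ?J lvl (Suc x)" using chain_end[OF x, of "2 ^ lvl"] lvl(1) xy by simp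
    moreover have "\<exists>e. Suc x = (nxt ^^ e) (Suc x)" by (rule exI[of _ 0]) simp
    moreover have "Suc x \<le> B" "y \<le> B" "lvl \<le> B" "2 * n \<le> B" "i \<le> B" "h \<le> B" "1 \<le> B"
      using xy x lvl(4) linear_fits i by auto
    ultimately show ?case using \<sigma> i
      by (auto simp: cell_vars_def lift_tables_def prefix_tables_def x_def y_def odd_iff_mod_2_eq_one)
  next
    case (2 it \<sigma>')
    have t: "lift_tables \<sigma>'"
      using \<sigma>(1) 2 by (simp add: unchanged_def lift_tables_def prefix_tables_def input_def jump_table_def)
    define m where "m = nats \<sigma>' ''m'' 0"
    define l where "l = lvl - Suc it"
    have l: "lvl - it = Suc l" "l \<le> lvl" using 2(1) by (auto simp: l_def)
    obtain e where m: "m = (nxt ^^ e) (Suc x)" using 2 by (auto simp: m_def)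
    have mle: "m \<le> 2 * n" using chain_le[OF x] m by simp
    have J: "nats \<sigma>' ''J'' (l * Y + m) = ?J l m" "?J l m \<le> 2 * n"
      using t l(2) mle chain_le[OF mle] by (simp_all add: lift_tables_def jump_table_def)
    have Jm: "\<exists>e. ?J l m = (nxt ^^ e) (Suc x)"
      by (rule exI[of _ "2 ^ l + e"]) (simp add: m funpow_add)
    have ylt: "y < ?J l (?J l m)" using 2 by (simp only: jump_twice l(1) m_def)
    have "l * Y + (32 * n + 32) \<le> B" using l lvl(4) by (intro table_fits) (auto simp: Y_def)
    then have fits: "l * Y \<le> B" "l * Y + m \<le> B" "m \<le> B" "?J l m \<le> B" "Suc y \<le> B" "lvl \<le> B" "1 \<le> B"
      "Suc l \<le> B" "Y \<le> B"
      using mle J(2) xy linear_fits lvl(4) l by (auto simp: Y_def)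
    have st: "nats \<sigma>' ''l'' 0 = Suc l" "nats \<sigma>' ''Y'' 0 = Y" "nats \<sigma>' ''x'' 0 = x" "nats \<sigma>' ''y'' 0 = y"
      using 2 l t by (auto simp: lift_tables_def prefix_tables_def)
    have old: "\<exists>e. m = (nxt ^^ e) (Suc x)" "m = Suc x \<or> m \<le> y" using 2 by (simp_all add: m_def)
    show ?case
      unfolding l_def[symmetric]
    proof (intro conjI)
      show "terminates B (assign ''l'' (NMinus (var ''l'') (NConst 1)) ;;
         Cond (NLess (NCell ''J'' (NPlus (NTimes (var ''l'') (var ''Y'')) (var ''m''))) (inc (var ''y'')))
           (assign ''m'' (NCell ''J'' (NPlus (NTimes (var ''l'') (var ''Y'')) (var ''m'')))) Skip) \<sigma>' 3
        (\<lambda>\<sigma>. nats \<sigma> ''x'' 0 = x \<and> nats \<sigma> ''y'' 0 = y \<and> nats \<sigma> ''l'' 0 = l \<and>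
        (\<exists>e. nats \<sigma> ''m'' 0 = (nxt ^^ e) (Suc x)) \<and> (nats \<sigma> ''m'' 0 = Suc x \<or> nats \<sigma> ''m'' 0 \<le> y) \<and>
        y < ?J l (nats \<sigma> ''m'' 0))" (is "terminates _ _ _ _ ?Q")
      proof (rule terminates_mono[OF terminates_wp[where Q = ?Q]])
        show "wp B (assign ''l'' (NMinus (var ''l'') (NConst 1)) ;;
         Cond (NLess (NCell ''J'' (NPlus (NTimes (var ''l'') (var ''Y'')) (var ''m''))) (inc (var ''y'')))
           (assign ''m'' (NCell ''J'' (NPlus (NTimes (var ''l'') (var ''Y'')) (var ''m'')))) Skip) ?Q \<sigma>'"
          using st fits J Jm ylt old by (cases "?J l m \<le> y") (simp_all add: m_def[symmetric] less_Suc_eq_le)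
      qed simp_all
    qed (use st fits in auto)
  next
    case (3 \<sigma>')
    then show ?case by simp
  next
    case 4
    show ?case by simp
  next
    case (5 \<sigma>')
    have t: "lift_tables \<sigma>'" "cell_vars t i h \<sigma>'" "reals \<sigma>' ''V'' (t * W + h) = V t h"
      using \<sigma> V 5 by (simp_all add: unchanged_def lift_tables_def prefix_tables_def input_def
          cell_vars_def jump_table_def)
    obtain e where m: "nats \<sigma>' ''m'' 0 = (nxt ^^ e) (Suc x)" using 5 by blast
    define m where "m = nats \<sigma>' ''m'' 0"
    have mle: "m \<le> 2 * n" using chain_le[OF x] m by (simp add: m_def)
    \<comment> \<open>The array \<open>U\<close> is filled only below \<open>2 * n\<close>. Here
      \<open>m\<close> is \<open>2 * n\<close> only for an empty range, and then the factor
      \<open>S (Suc y) - S m\<close> vanishes.\<close>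
    have mU: "reals \<sigma>' ''U'' m * (S (Suc y) - S m) = U m * (S (Suc y) - S m)"
    proof (cases "m < 2 * n")
      case True
      then show ?thesis using t(1) by (simp add: lift_tables_def prefix_tables_def)
    next
      case False
      then have "m = Suc y" using 5 xy by (auto simp: m_def)
      then show ?thesis by simp
    qed
    have ev: "evac x y = (H (Suc y) - H (Suc x)) - q x * (S (Suc y) - S (Suc x)) +
        (P (Suc x) - P m) + U m * (S (Suc y) - S m)"
      using 5 m xy by (intro evac_fast[where e = e]) (auto simp: m_def)
    have R: "reals \<sigma>' ''H'' (Suc y) = H (Suc y)" "reals \<sigma>' ''H'' (Suc x) = H (Suc x)"
      "reals \<sigma>' ''Q'' x = q x" "reals \<sigma>' ''S'' (Suc y) = S (Suc y)" "reals \<sigma>' ''S'' (Suc x) = S (Suc x)"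
      "reals \<sigma>' ''S'' m = S m" "reals \<sigma>' ''P'' (Suc x) = P (Suc x)" "reals \<sigma>' ''P'' m = P m"
      using t(1) xy mle by (simp_all add: lift_tables_def prefix_tables_def)
    have "t * W + (32 * n + 32) \<le> B" using i k by (intro table_fits) (auto simp: W_def)
    then have fits: "t * W + h \<le> B" "t * W \<le> B" "Suc x \<le> B" "Suc y \<le> B" "m \<le> B" "1 \<le> B" "h \<le> B"
      using xy mle i linear_fits by auto
    show ?case
      using 5 t(2,3) R fits mU ev by (simp add: cell_vars_def m_def[symmetric] entry_def C)
  next
    case 6
    show ?case by simp
  qed
qed

end

section \<open>Filling the tables\<close>

text \<open>At the first column \<open>o = h\<close>, so the entry is stored no matter what
  \<open>best\<close> held before; later columns replace it only if strictly smaller, which keeps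
  the leftmost minimum.\<close>

definition scan_body :: com where
  "scan_body = eval_prog ;;
     (Cond (BAnd (NLess (var ''o'') (var ''h'')) (BNot (RLess (rvar ''z'') (rvar ''best''))))
       Skip (rassign ''best'' (rvar ''z'') ;; assign ''o'' (var ''h'')) ;;
      assign ''h'' (inc (var ''h'')))"

definition row_prog :: com where
  "row_prog =
     ((assign ''i'' (NMinus (NPlus (var ''j'') (var ''r'')) (NConst 1)) ;;
       assign ''h'' (NCell ''O'' (NMinus (NPlus (var ''b'') (var ''r'')) (var ''s''))) ;;
       assign ''o'' (var ''h'') ;;
       Cond (NLess (var ''t'') (NConst 1)) (assign ''g'' (NConst 0)) (assign ''g'' (var ''i'')) ;;
       Cond (NLess (NPlus (var ''r'') (var ''s'')) (inc (var ''R'')))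
         (Cond (NLess (NCell ''O'' (NPlus (var ''b'') (NPlus (var ''r'') (var ''s'')))) (var ''g''))
           (assign ''g'' (NCell ''O'' (NPlus (var ''b'') (NPlus (var ''r'') (var ''s''))))) Skip) Skip) ;;
      While (NLess (var ''h'') (inc (var ''g''))) scan_body) ;;
     (NAssign ''O'' (NPlus (var ''b'') (var ''r'')) (var ''o'') ;;
      RAssign ''V'' (NPlus (NPlus (var ''b'') (var ''W'')) (NPlus (var ''i'') (var ''p''))) (rvar ''best''))"

definition level_prog :: com where
  "level_prog =
     (assign ''r'' (var ''s'') ;;
      While (NLess (var ''r'') (inc (var ''R'')))
        (row_prog ;; assign ''r'' (NPlus (var ''r'') (NPlus (var ''s'') (var ''s''))))) ;;
     assign ''s'' (NDiv (var ''s'') (NConst 2))"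

text \<open>The first stride exceeds the number of rows, so only the lower bound in entry 0 has to
  be set in advance. Halving the stride 1 gives 0 and ends the loop.\<close>

definition layer_prog :: com where
  "layer_prog =
     ((assign ''j'' (NDiv (var ''t'') (NConst 2)) ;;
       assign ''p'' (NMinus (var ''t'') (NPlus (var ''j'') (var ''j''))) ;;
       assign ''R'' (NMinus (var ''n'') (var ''j'')) ;;
       assign ''b'' (NTimes (var ''t'') (var ''W'')) ;;
       NAssign ''O'' (var ''b'') (var ''j'') ;;
       assign ''s'' (var ''T'')) ;;
      While (NLess (NConst 0) (var ''s'')) level_prog) ;;
     assign ''t'' (inc (var ''t''))"

definition table_prog :: com where
  "table_prog = assign ''t'' (NConst 0) ;;
     While (NLess (var ''t'') (NPlus (var ''k'') (var ''k''))) layer_prog"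

text \<open>The state \<open>e\<close> behind layer \<open>t\<close> belongs to vertex
  \<open>e - p\<close>, whose row is \<open>e + 1 - (p + j)\<close>. Columns of odd layers are
  sinks, those of even layers block boundaries; dividing by \<open>tau\<close> turns a travel time
  back into a coordinate.\<close>

definition trace_prog :: com where
  "trace_prog =
     (rassign ''cost'' (RCell ''V'' (NPlus (NTimes (NPlus (var ''k'') (var ''k'')) (var ''W'')) (var ''n''))) ;;
      NAssign ''boundary'' (var ''k'') (var ''n'') ;;
      assign ''e'' (var ''n'') ;;
      assign ''t'' (NPlus (var ''k'') (var ''k''))) ;;
     While (NLess (NConst 0) (var ''t''))
       (assign ''t'' (NMinus (var ''t'') (NConst 1)) ;;
        assign ''j'' (NDiv (var ''t'') (NConst 2)) ;;
        assign ''p'' (NMinus (var ''t'') (NPlus (var ''j'') (var ''j''))) ;;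
        assign ''e'' (NCell ''O'' (NPlus (NTimes (var ''t'') (var ''W''))
          (NMinus (inc (var ''e'')) (NPlus (var ''p'') (var ''j''))))) ;;
        Cond (NLess (NConst 0) (var ''p''))
          (RAssign ''sink'' (var ''j'') (RDiv (RCell ''Q'' (var ''e'')) (rvar ''tau'')))
          (NAssign ''boundary'' (var ''j'') (var ''e'')))"

section \<open>Correctness and amortized cost of the layers\<close>

context ram
begin

definition rows :: "nat \<Rightarrow> nat" where "rows t = n - t div 2"

text \<open>Rows are numbered from \<open>1\<close>; entry \<open>0\<close> of a layer of the table \<open>O\<close> is a lower bound for all its columns.\<close>

definition vertex :: "nat \<Rightarrow> nat \<Rightarrow> nat" where "vertex t r = t div 2 + r - 1"

definition V_ok :: "nat \<Rightarrow> store \<Rightarrow> bool" where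
  "V_ok t \<sigma> \<longleftrightarrow> (\<forall>e. t div 2 \<le> e \<and> e + t mod 2 \<le> n \<longrightarrow> reals \<sigma> ''V'' (t * W + e) = V t e)"

definition O_ok :: "nat \<Rightarrow> store \<Rightarrow> bool" where
  "O_ok t \<sigma> \<longleftrightarrow> (\<forall>r. 1 \<le> r \<and> r \<le> rows t \<longrightarrow> nats \<sigma> ''O'' (t * W + r) = opt t (vertex t r))"

definition layer_state :: "nat \<Rightarrow> store \<Rightarrow> bool" where
  "layer_state t \<sigma> \<longleftrightarrow> V_ok t \<sigma> \<and> (\<forall>t'<t. O_ok t' \<sigma>) \<and> nats \<sigma> ''O'' (t * W) = t div 2"

definition row_ok :: "nat \<Rightarrow> nat \<Rightarrow> store \<Rightarrow> bool" where
  "row_ok t r \<sigma> \<longleftrightarrow> nats \<sigma> ''O'' (t * W + r) = opt t (vertex t r) \<and>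
     reals \<sigma> ''V'' (Suc t * W + (vertex t r + t mod 2)) = V (Suc t) (vertex t r + t mod 2)"

definition layer_vars :: "nat \<Rightarrow> store \<Rightarrow> bool" where
  "layer_vars t \<sigma> \<longleftrightarrow> nats \<sigma> ''t'' 0 = t \<and> nats \<sigma> ''p'' 0 = t mod 2 \<and> nats \<sigma> ''j'' 0 = t div 2 \<and>
     nats \<sigma> ''R'' 0 = rows t \<and> nats \<sigma> ''b'' 0 = t * W"

text \<open>The optimal columns, extended to missing rows so that the scan widths of one level telescope.\<close>

definition bound :: "nat \<Rightarrow> nat \<Rightarrow> nat" where
  "bound t r = (if r = 0 then t div 2 else if r \<le> rows t then opt t (vertex t r) else n)"

text \<open>Stated as exact updates, so that the entries of other rows and earlier layers are seen
  to survive.\<close>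

definition row_done :: "nat \<Rightarrow> nat \<Rightarrow> store \<Rightarrow> store \<Rightarrow> bool" where
  "row_done t r \<sigma> \<sigma>' \<longleftrightarrow> nats \<sigma>' ''O'' = (nats \<sigma> ''O'')(t * W + r := opt t (vertex t r)) \<and>
     reals \<sigma>' ''V'' = (reals \<sigma> ''V'')(Suc t * W + (vertex t r + t mod 2) := V (Suc t) (vertex t r + t mod 2))"

lemma vertex_range: "1 \<le> r \<Longrightarrow> r \<le> rows t \<Longrightarrow> t div 2 \<le> vertex t r \<and> vertex t r < n"
  by (auto simp: vertex_def rows_def)

lemma bound_mono:
  assumes "t div 2 \<le> n"
  shows "mono (bound t)"
proof (rule monoI)
  fix r r' :: nat assume "r \<le> r'"
  have le: "opt t (vertex t r) \<le> n" "t div 2 \<le> opt t (vertex t r)" if "1 \<le> r" "r \<le> rows t" for r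
    using vertex_range[OF that] opt_le[of t "vertex t r"] opt_in[of t "vertex t r"] by auto
  have "opt t (vertex t r) \<le> opt t (vertex t r')" if "1 \<le> r" "r' \<le> rows t"
    using that \<open>r \<le> r'\<close> vertex_range[of r t] vertex_range[of r' t]
    by (intro opt_mono) (auto simp: vertex_def)
  then show "bound t r \<le> bound t r'"
    using assms \<open>r \<le> r'\<close> le[of r] le[of r'] by (auto simp: bound_def)
qed

lemma bound_le: "t div 2 \<le> n \<Longrightarrow> bound t r \<le> n"
  using vertex_range[of r t] opt_le[of t "vertex t r"] by (auto simp: bound_def)

lemma row_done_layer_state:
  assumes "layer_state t \<sigma>" "row_done t r \<sigma> \<sigma>'" "1 \<le> r" "r \<le> rows t"
  shows "layer_state t \<sigma>'"
proof -
  have 1: "t * W + e \<noteq> Suc t * W + i" if "e \<le> n" for e i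
    using row_less[OF order_refl, of e W t] that by (simp add: W_def)
  have 2: "t' * W + r' < t * W" if "t' < t" "r' \<le> n" for t' r'
  proof -
    obtain u where u: "t = Suc u" using \<open>t' < t\<close> by (cases t) auto
    show ?thesis using row_less[of t' u r' W] that u by (simp add: W_def)
  qed
  have 3: "t' * W + r' \<noteq> t * W + r" if "t' < t" "r' \<le> rows t'" for t' r'
  proof -
    have "t' * W + r' < t * W" using that by (intro 2) (simp_all add: rows_def)
    then show ?thesis by simp
  qed
  show ?thesis
    using assms 1 3 unfolding layer_state_def row_done_def V_ok_def O_ok_def by auto
qed

lemma row_done_row_ok:
  assumes "row_done t r \<sigma> \<sigma>'" "1 \<le> r" "1 \<le> r'" "r' = r \<or> row_ok t r' \<sigma>"
  shows "row_ok t r' \<sigma>'"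
  using assms by (cases "r' = r") (auto simp: row_done_def row_ok_def vertex_def)

lemma row_fits: "t \<le> 2 * k \<Longrightarrow> t * W + (32 * n + 32) \<le> B" "t \<le> 2 * k \<Longrightarrow> t * W + W + (16 * n + 16) \<le> B"
  using table_fits[of t W] k by (simp_all add: W_def)

lemma scan_step:
  assumes \<sigma>: "lift_tables \<sigma>" "cell_vars t i h \<sigma>" "V_ok t \<sigma>"
    and i: "t div 2 \<le> lo" "lo \<le> h" "h \<le> i" "i < n" "t < 2 * k" and o: "nats \<sigma> ''o'' 0 \<le> n"
    and inv: "if h = lo then nats \<sigma> ''o'' 0 = lo else
      nats \<sigma> ''o'' 0 = leftmost (entry t i) lo (h - 1) \<and> reals \<sigma> ''best'' 0 = entry t i (nats \<sigma> ''o'' 0)"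
  shows "terminates B scan_body \<sigma> (4 * lvl + 14) (\<lambda>\<sigma>. nats \<sigma> ''h'' 0 = Suc h \<and> nats \<sigma> ''o'' 0 \<le> n \<and>
      nats \<sigma> ''o'' 0 = leftmost (entry t i) lo h \<and> reals \<sigma> ''best'' 0 = entry t i (nats \<sigma> ''o'' 0))"
  unfolding scan_body_def
proof (rule terminates_Seq_wp[OF eval_prog[OF \<sigma>(1,2)]], goal_cases)
  case 4
  show ?case using \<sigma>(3) i by (auto simp: V_ok_def)
next
  case (5 \<sigma>')
  have u: "nats \<sigma>' ''h'' 0 = h" "nats \<sigma>' ''o'' 0 = nats \<sigma> ''o'' 0" "reals \<sigma>' ''best'' 0 = reals \<sigma> ''best'' 0"
    using 5 \<sigma>(2) by (simp_all add: unchanged_def eval_prog_def cell_vars_def)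
  show ?case
  proof (cases "h = lo")
    case True
    then show ?thesis using 5 u inv i linear_fits leftmost_single[of "entry t i" lo] by simp
  next
    case False
    then obtain h' where h': "h = Suc h'" "lo \<le> h'" using i(2) by (cases h) auto
    then have "nats \<sigma> ''o'' 0 < h" using inv leftmost_in[OF h'(2), of "entry t i"] by simp
    then show ?thesis using 5 u inv i linear_fits h' leftmost_Suc[OF h'(2), of "entry t i"] by simp
  qed
qed (use i in simp_all)



text \<open>\<open>bound_mono\<close> places the optimal column between those of the rows
  \<open>r - s\<close> and \<open>r + s\<close>, so the scan finds it by
  \<open>leftmost_restrict\<close>. The time is stated with \<open>bound\<close> even where the
  window is cut off at \<open>col_max\<close>, to let the sum over a level telescope.\<close>

lemma row_prog:
  assumes \<sigma>: "lift_tables \<sigma>" "layer_vars t \<sigma>" "V_ok t \<sigma>" "nats \<sigma> ''s'' 0 = s" "nats \<sigma> ''r'' 0 = r"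
    and t: "t < 2 * k" and s: "1 \<le> s" "s \<le> 4 * n" "s \<le> r" and r: "1 \<le> r" "r \<le> rows t"
    and lo: "nats \<sigma> ''O'' (t * W + (r - s)) = bound t (r - s)"
    and hi: "r + s \<le> rows t \<Longrightarrow> nats \<sigma> ''O'' (t * W + (r + s)) = bound t (r + s)"
  shows "terminates B row_prog \<sigma> (15 + (Suc (bound t (r + s)) - bound t (r - s)) * (4 * lvl + 15))
    (row_done t r \<sigma>)"
proof -
  define i where "i = vertex t r"
  define l where "l = bound t (r - s)"
  define g where "g = (if r + s \<le> rows t \<and> bound t (r + s) < col_max t i then bound t (r + s) else col_max t i)"
  have i: "t div 2 \<le> i" "i < n" using vertex_range[OF r] by (auto simp: i_def)
  have tn: "t div 2 \<le> n" using i by simp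
  have bi: "bound t r = opt t i" using r by (simp add: bound_def i_def)
  have l: "t div 2 \<le> l" "l \<le> opt t i"
    using monoD[OF bound_mono[OF tn], of 0 "r - s"] monoD[OF bound_mono[OF tn], of "r - s" r]
    by (simp_all add: l_def bi) (simp add: bound_def)
  have g: "opt t i \<le> g" "g \<le> col_max t i" "g \<le> bound t (r + s)"
  proof -
    have col: "col_max t i \<le> n" using i by (simp add: col_max_def)
    show "opt t i \<le> g"
      using opt_in[OF i(1)] monoD[OF bound_mono[OF tn], of r "r + s"] by (auto simp: g_def bi)
    show "g \<le> col_max t i" "g \<le> bound t (r + s)"
      using col s by (auto simp: g_def bound_def)
  qed
  have gi: "g \<le> i" using g(2) by (simp add: col_max_def split: if_splits)
  have leftmost: "leftmost (entry t i) l g = opt t i"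
    using leftmost_restrict[OF l(1) g(2), of "entry t i"] l(2) g(1) by (simp add: opt_def)
  have fits: "t * W + (32 * n + 32) \<le> B" "t * W + W + (16 * n + 16) \<le> B"
    using t by (simp_all add: row_fits)
  have rn: "r \<le> n" "t div 2 \<le> n" "t \<le> 2 * n" using r i t k by (auto simp: rows_def)
  have brs: "bound t (r + s) \<le> n" by (rule bound_le[OF tn])
  let ?I = "\<lambda>it \<sigma>. nats \<sigma> ''i'' 0 = i \<and> nats \<sigma> ''g'' 0 = g \<and> nats \<sigma> ''h'' 0 = l + it \<and> nats \<sigma> ''o'' 0 \<le> n \<and>
    (if it = 0 then nats \<sigma> ''o'' 0 = l else nats \<sigma> ''o'' 0 = leftmost (entry t i) l (l + it - 1) \<and>
      reals \<sigma> ''best'' 0 = entry t i (nats \<sigma> ''o'' 0))"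
  show ?thesis
    unfolding row_prog_def
  proof (rule terminates_Seq_wp[OF terminates_loop[where m = "Suc g - l" and T = "\<lambda>_. 4 * lvl + 14" and
      I = ?I and T' = "10 + (Suc (bound t (r + s)) - bound t (r - s)) * (4 * lvl + 15)" and
      Q = "\<lambda>\<sigma>. nats \<sigma> ''i'' 0 = i \<and> nats \<sigma> ''o'' 0 = opt t i \<and> reals \<sigma> ''best'' 0 = entry t i (opt t i)"]], goal_cases)
    case 1
    have "t * W + r - s = t * W + (r - s)" using s by simp
    then have 1: "nats \<sigma> ''O'' (t * W + r - s) = l" using lo by (simp add: l_def)
    have 2: "nats \<sigma> ''O'' (t * W + (r + s)) = bound t (r + s)" "bound t (r + s) \<le> B" if "r + s \<le> rows t"
      using hi[OF that] brs linear_fits by auto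
    have 3: "l \<le> n" "g \<le> n" using l(2) opt_le[OF i(1)] gi i by auto
    have 4: "i = t div 2 + r - 1" by (simp add: i_def vertex_def)
    have 5: "t * W \<le> B" "t * W + r \<le> B" "t * W + (r + s) \<le> B" "r \<le> B" "s \<le> B" "r + s \<le> B" "i \<le> B"
      "l \<le> B" "t \<le> B" "1 \<le> B" "t div 2 \<le> B" "t div 2 + r \<le> B" "Suc (rows t) \<le> B"
      using fits rn i s(2) 3 linear_fits by (simp_all add: rows_def)
    have 6: "nats \<sigma> ''r'' 0 = r" "nats \<sigma> ''s'' 0 = s" "nats \<sigma> ''t'' 0 = t" "nats \<sigma> ''j'' 0 = t div 2"
      "nats \<sigma> ''R'' 0 = rows t" "nats \<sigma> ''b'' 0 = t * W"
      using \<sigma> by (simp_all add: layer_vars_def)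
    have 7: "t div 2 + r - 1 = i" using 4 by simp
    show ?case
    proof (cases "r + s \<le> rows t")
      case True
      show ?thesis
        using 5 6 3 1 2[OF True] True 7
        by (cases "t = 0") (simp_all add: g_def col_max_def less_Suc_eq_le)
    next
      case False
      show ?thesis
        using 5 6 3 1 False 7
        by (cases "t = 0") (simp_all add: g_def col_max_def less_Suc_eq_le)
    qed
  next
    case (2 it \<sigma>')
    have t': "lift_tables \<sigma>'" "cell_vars t i (l + it) \<sigma>'" "V_ok t \<sigma>'"
      using \<sigma>(1,2,3) 2 by (simp_all add: unchanged_def scan_body_def eval_prog_def
        lift_tables_def prefix_tables_def input_def jump_table_def layer_vars_def cell_vars_def V_ok_def)
    have "l + it \<le> g" using 2(1) by simp
    then have "terminates B scan_body \<sigma>' (4 * lvl + 14) (\<lambda>\<sigma>. nats \<sigma> ''h'' 0 = Suc (l + it) \<and> nats \<sigma> ''o'' 0 \<le> n \<and>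
      nats \<sigma> ''o'' 0 = leftmost (entry t i) l (l + it) \<and> reals \<sigma> ''best'' 0 = entry t i (nats \<sigma> ''o'' 0))"
      using 2 t' l gi i t by (intro scan_step) auto
    then have "terminates B scan_body \<sigma>' (4 * lvl + 14) (?I (Suc it))"
      by (rule terminates_mono[OF terminates_unchanged])
        (use 2 in \<open>auto simp: unchanged_def scan_body_def eval_prog_def\<close>)
    moreover have "Suc g \<le> B" using gi i linear_fits by simp
    ultimately show ?case using 2 \<open>l + it \<le> g\<close> by simp
  next
    case (3 \<sigma>')
    have "l + (Suc g - l) - 1 = g" using l(2) g(1) by simp
    then show ?case using 3 l(2) g(1) leftmost gi i linear_fits by auto
  next
    case 4
    have "(Suc g - l) * (4 * lvl + 15) \<le> (Suc (bound t (r + s)) - bound t (r - s)) * (4 * lvl + 15)"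
      using g(3) by (intro mult_le_mono1) (simp add: l_def)
    then show ?case by (simp add: algebra_simps)
  next
    case (5 \<sigma>')
    have v: "nats \<sigma>' ''b'' 0 = t * W" "nats \<sigma>' ''r'' 0 = r" "nats \<sigma>' ''W'' 0 = W" "nats \<sigma>' ''p'' 0 = t mod 2"
      "nats \<sigma>' ''O'' = nats \<sigma> ''O''" "reals \<sigma>' ''V'' = reals \<sigma> ''V''"
      using 5 \<sigma> by (simp_all add: unchanged_def scan_body_def eval_prog_def
        lift_tables_def prefix_tables_def layer_vars_def)
    have e: "entry t i (opt t i) = V (Suc t) (i + t mod 2)" by (simp add: V_Suc)
    have "t * W \<le> B" "t * W + r \<le> B" "r \<le> B" "opt t i \<le> B" "W \<le> B" "t * W + W \<le> B" "i \<le> B" "t mod 2 \<le> B"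
      "i + t mod 2 \<le> B" "t * W + W + (i + t mod 2) \<le> B" "t mod 2 \<le> 1"
      using fits rn i opt_le[OF i(1)] by auto
    then show ?case using 5 v e by (simp add: row_done_def i_def[symmetric] add.commute[of W])
  next
    case 6
    show ?case by simp
  qed
qed


text \<open>Windows of consecutive rows of a level share only an end column, so their widths add up
  to at most \<open>n\<close> plus the number of rows treated, which is again at most
  \<open>n\<close>.\<close>

lemma level_prog:
  assumes \<sigma>: "lift_tables \<sigma>" "layer_vars t \<sigma>" "layer_state t \<sigma>" "nats \<sigma> ''s'' 0 = s"
    and t: "t < 2 * k" and s: "1 \<le> s" "s \<le> 4 * n"
    and processed: "\<And>r. 1 \<le> r \<Longrightarrow> r \<le> rows t \<Longrightarrow> 2 * s dvd r \<Longrightarrow> row_ok t r \<sigma>"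
  shows "terminates B level_prog \<sigma> (3 + 17 * n + 2 * n * (4 * lvl + 15))
    (\<lambda>\<sigma>. layer_state t \<sigma> \<and> nats \<sigma> ''s'' 0 = s div 2 \<and>
      (\<forall>r. 1 \<le> r \<and> r \<le> rows t \<and> s dvd r \<longrightarrow> row_ok t r \<sigma>))"
proof -
  \<comment> \<open>The number of odd multiples of \<open>s\<close> up to
    \<open>rows t\<close>.\<close>
  define m where "m = (rows t + s) div (2 * s)"
  define F where "F = (\<lambda>it. bound t (2 * s * it))"
  have tn: "t div 2 \<le> n" "rows t \<le> n" using t k by (auto simp: rows_def)
  have m_iff: "it < m \<longleftrightarrow> s * (2 * it + 1) \<le> rows t" for it
  proof -
    have "it < m \<longleftrightarrow> Suc it * (2 * s) \<le> rows t + s"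
      unfolding m_def Suc_le_eq[symmetric] using s by (intro less_eq_div_iff_mult_less_eq) simp
    then show ?thesis by (simp add: algebra_simps)
  qed
  have mn: "m \<le> n"
  proof (cases m)
    case (Suc m')
    then have "s * (2 * m' + 1) \<le> n" using m_iff[of m'] tn by simp
    moreover have "1 * (2 * m' + 1) \<le> s * (2 * m' + 1)" using s by (intro mult_le_mono1)
    ultimately show ?thesis using Suc by simp
  qed simp
  \<comment> \<open>The value of \<open>r\<close> at loop exit must fit as well. It is either
    \<open>s\<close> or two strides beyond a row; as \<open>s \<le> 4 * n\<close>, it is at most
    \<open>n + 8 * n\<close>.\<close>
  have r_le: "s * (2 * it + 1) \<le> 9 * n" if "it \<le> m" for it
  proof (cases it)
    case (Suc it')
    then have "s * (2 * it' + 1) \<le> n" using m_iff[of it'] tn that by simp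
    then show ?thesis using s Suc by simp
  qed (use s in simp)
  have F_mono: "F i \<le> F j" if "i \<le> j" for i j
    unfolding F_def using that by (intro monoD[OF bound_mono[OF tn(1)]]) simp
  have F_sum: "(\<Sum>it<j. Suc (F (Suc it)) - F it) + F 0 = j + F j" for j
  proof (induction j)
    case (Suc j)
    then show ?case using F_mono[of j "Suc j"] by simp
  qed simp
  let ?ok = "\<lambda>it \<sigma>. \<forall>r. 1 \<le> r \<and> r \<le> rows t \<and> (2 * s dvd r \<or> s dvd r \<and> r < s * (2 * it + 1)) \<longrightarrow> row_ok t r \<sigma>"
  let ?I = "\<lambda>it \<sigma>. nats \<sigma> ''r'' 0 = s * (2 * it + 1) \<and> layer_state t \<sigma> \<and> nats \<sigma> ''s'' 0 = s \<and> ?ok it \<sigma>"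
  show ?thesis
    unfolding level_prog_def
  proof (rule terminates_Seq_wp[OF terminates_loop[where m = m and I = ?I and
      T = "\<lambda>it. 16 + (Suc (F (Suc it)) - F it) * (4 * lvl + 15)" and
      Q = "\<lambda>\<sigma>. layer_state t \<sigma> \<and> nats \<sigma> ''s'' 0 = s \<and>
        (\<forall>r. 1 \<le> r \<and> r \<le> rows t \<and> s dvd r \<longrightarrow> row_ok t r \<sigma>)" and
      T' = "2 + 17 * n + 2 * n * (4 * lvl + 15)"]], goal_cases)
    case 1
    have "row_ok t r \<sigma>" if "1 \<le> r" "r \<le> rows t" "2 * s dvd r \<or> s dvd r \<and> r < s" for r
      using that processed[of r] by (auto dest: dvd_imp_le)
    then show ?case using \<sigma> s linear_fits
      by (simp add: layer_state_def V_ok_def O_ok_def row_ok_def)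
  next
    case (2 it \<sigma>')
    define r where "r = s * (2 * it + 1)"
    have t': "lift_tables \<sigma>'" "layer_vars t \<sigma>'"
      using \<sigma>(1,2) 2 by (simp_all add: unchanged_def row_prog_def scan_body_def eval_prog_def
        lift_tables_def prefix_tables_def input_def jump_table_def layer_vars_def)
    have I: "nats \<sigma>' ''r'' 0 = r" "layer_state t \<sigma>'" "nats \<sigma>' ''s'' 0 = s" "?ok it \<sigma>'"
      using 2(2) by (simp_all add: r_def)
    have r: "1 \<le> r" "r \<le> rows t" "s \<le> r" using m_iff 2(1) s by (auto simp: r_def)
    have rs: "r - s = 2 * s * it" "r + s = 2 * s * Suc it" by (simp_all add: r_def algebra_simps)
    have known: "nats \<sigma>' ''O'' (t * W + r') = bound t r'" if "2 * s dvd r'" "r' \<le> rows t" for r'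
      using that I by (cases "r' = 0") (auto simp: bound_def layer_state_def row_ok_def)
    have d: "2 * s dvd r - s" "2 * s dvd r + s" unfolding rs by (rule dvd_triv_left)+
    have row: "terminates B row_prog \<sigma>' (15 + (Suc (bound t (r + s)) - bound t (r - s)) * (4 * lvl + 15))
        (row_done t r \<sigma>')"
    proof (rule row_prog[OF t' _ I(3,1) t s r(3,1,2)])
      show "V_ok t \<sigma>'" using I(2) by (simp add: layer_state_def)
      show "nats \<sigma>' ''O'' (t * W + (r - s)) = bound t (r - s)"
        using r by (intro known[OF d(1)]) simp
      show "nats \<sigma>' ''O'' (t * W + (r + s)) = bound t (r + s)" if "r + s \<le> rows t"
        by (rule known[OF d(2) that])
    qed
    have body: "terminates B (row_prog ;; assign ''r'' (NPlus (var ''r'') (NPlus (var ''s'') (var ''s'')))) \<sigma>'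
        (16 + (Suc (F (Suc it)) - F it) * (4 * lvl + 15)) (?I (Suc it))"
    proof (rule terminates_Seq_wp[OF row], goal_cases)
      case (1 \<sigma>'')
      have v: "nats \<sigma>'' ''r'' 0 = r" "nats \<sigma>'' ''s'' 0 = s"
        using I 1(2) by (simp_all add: unchanged_def row_prog_def scan_body_def eval_prog_def)
      define \<sigma>3 where "\<sigma>3 = nwrite ''r'' 0 (r + (s + s)) \<sigma>''"
      have d: "row_done t r \<sigma>' \<sigma>3" using 1(1) by (simp add: row_done_def \<sigma>3_def)
      have ls: "layer_state t \<sigma>3" by (rule row_done_layer_state[OF I(2) d r(1,2)])
      have ok: "row_ok t r' \<sigma>3" if r': "1 \<le> r'" "r' \<le> rows t"
        "2 * s dvd r' \<or> s dvd r' \<and> r' < s * (2 * Suc it + 1)" for r'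
      proof (rule row_done_row_ok[OF d r(1) r'(1)])
        show "r' = r \<or> row_ok t r' \<sigma>'"
        proof (cases "2 * s dvd r'")
          case True
          then show ?thesis using I(4) r' by blast
        next
          case False
          then have s': "s dvd r'" "r' < s * (2 * Suc it + 1)" using r'(3) by simp_all
          \<comment> \<open>A multiple of \<open>s\<close> but not of \<open>2 * s\<close> is an odd
            multiple, hence the current row or one treated before.\<close>
          then obtain x where x: "r' = s * x" by (elim dvdE)
          have "odd x"
          proof
            assume "even x"
            then have "2 * s dvd x * s" by (intro mult_dvd_mono) simp_all
            then show False using False unfolding x mult.commute[of s x] by contradiction
          qed
          moreover have "x < 2 * Suc it + 1"
            using s'(2) unfolding x by (rule mult_less_cancel1[THEN iffD1, THEN conjunct2])
          ultimately have "x = 2 * it + 1 \<or> x < 2 * it + 1" by presburger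
          then show ?thesis
          proof
            assume "x < 2 * it + 1"
            then have "r' < s * (2 * it + 1)" unfolding x using s by (intro mult_strict_left_mono) simp_all
            then show ?thesis using I(4) r'(1,2) s'(1) by simp
          next
            assume "x = 2 * it + 1"
            then show ?thesis by (simp only: r_def x simp_thms)
          qed
        qed
      qed
      have next_r: "s * (2 * Suc it + 1) = r + (s + s)" by (simp add: r_def algebra_simps)
      have "nats \<sigma>3 ''r'' 0 = s * (2 * Suc it + 1)" unfolding next_r by (simp add: \<sigma>3_def)
      moreover have "nats \<sigma>3 ''s'' 0 = s" using v by (simp add: \<sigma>3_def)
      ultimately have I3: "?I (Suc it) \<sigma>3" using ls ok by blast
      have \<sigma>3: "nwrite ''r'' (nval \<sigma>'' (NConst 0)) (nval \<sigma>'' (NPlus (var ''r'') (NPlus (var ''s'') (var ''s'')))) \<sigma>'' = \<sigma>3"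
        using v by (simp add: \<sigma>3_def)
      have fits: "nfits B \<sigma>'' (NConst 0)" "nfits B \<sigma>'' (NPlus (var ''r'') (NPlus (var ''s'') (var ''s'')))"
        using v r(2) tn s linear_fits by simp_all
      show ?case unfolding wp.simps \<sigma>3 by (rule conjI[OF fits(1) conjI[OF fits(2) I3]])
    next
      case 2
      show ?case by (simp add: rs F_def)
    qed
    have "Suc (rows t) \<le> B" "r \<le> B" using r tn linear_fits by auto
    then have "bfits B \<sigma>' (NLess (var ''r'') (inc (var ''R''))) \<and> bval \<sigma>' (NLess (var ''r'') (inc (var ''R'')))"
      using t'(2) I(1) r(2) by (simp add: layer_vars_def)
    then show ?case using body by blast
  next
    case (3 \<sigma>')
    have t': "layer_vars t \<sigma>'"
      using \<sigma>(1,2) 3 by (simp add: unchanged_def row_prog_def scan_body_def eval_prog_def layer_vars_def)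
    have "rows t < s * (2 * m + 1)" using m_iff[of m] by simp
    moreover have "s * (2 * m + 1) \<le> B" "Suc (rows t) \<le> B" using r_le[of m] tn linear_fits by auto
    ultimately show ?case using 3 t' by (simp add: layer_vars_def)
  next
    case 4
    have "(\<Sum>it<m. Suc (16 + (Suc (F (Suc it)) - F it) * (4 * lvl + 15))) =
        17 * m + (\<Sum>it<m. Suc (F (Suc it)) - F it) * (4 * lvl + 15)"
      by (simp add: sum.distrib sum_distrib_right[symmetric])
    also have "\<dots> \<le> 17 * n + (2 * n) * (4 * lvl + 15)"
    proof (intro add_mono mult_le_mono1)
      show "(\<Sum>it<m. Suc (F (Suc it)) - F it) \<le> 2 * n"
        using F_sum[of m] mn bound_le[OF tn(1), of "2 * s * m"] by (simp add: F_def)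
    qed (use mn in simp)
    finally show ?case by simp
  next
    case (5 \<sigma>')
    then show ?case using s linear_fits
      by (simp add: layer_state_def V_ok_def O_ok_def row_ok_def)
  next
    case 6
    show ?case by simp
  qed
qed

definition tables_upto :: "nat \<Rightarrow> store \<Rightarrow> bool" where
  "tables_upto t \<sigma> \<longleftrightarrow> nats \<sigma> ''t'' 0 = t \<and> V_ok t \<sigma> \<and> (\<forall>t'<t. O_ok t' \<sigma>)"

lemma layer_complete:
  assumes "layer_state t \<sigma>" "t < 2 * k" "\<And>r. 1 \<le> r \<Longrightarrow> r \<le> rows t \<Longrightarrow> row_ok t r \<sigma>"
  shows "V_ok (Suc t) \<sigma>" "t' < Suc t \<Longrightarrow> O_ok t' \<sigma>"
proof -
  show "V_ok (Suc t) \<sigma>"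
    unfolding V_ok_def
  proof (intro allI impI)
    fix e assume e: "Suc t div 2 \<le> e \<and> e + Suc t mod 2 \<le> n"
    \<comment> \<open>The row of the vertex \<open>e - t mod 2\<close>.\<close>
    define r where "r = e - t mod 2 - t div 2 + 1"
    have 1: "t div 2 + t mod 2 \<le> e" using e Suc_div2[of t] by simp
    have "e < n + t mod 2" using e by (cases "even t") (auto simp: odd_iff_mod_2_eq_one)
    then have r: "1 \<le> r" "r \<le> rows t" "vertex t r + t mod 2 = e"
      using 1 by (auto simp: r_def rows_def vertex_def)
    show "reals \<sigma> ''V'' (Suc t * W + e) = V (Suc t) e"
      using assms(3)[OF r(1,2)] by (simp add: row_ok_def r(3))
  qed
  show "t' < Suc t \<Longrightarrow> O_ok t' \<sigma>"
    using assms(1,3) by (cases "t' = t") (auto simp: layer_state_def O_ok_def row_ok_def)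
qed

lemma layer_prog:
  assumes \<sigma>: "lift_tables \<sigma>" "tables_upto t \<sigma>" and t: "t < 2 * k"
  shows "terminates B layer_prog \<sigma> (8 + Suc lvl * (4 + 17 * n + 2 * n * (4 * lvl + 15))) (tables_upto (Suc t))"
proof -
  \<comment> \<open>Written with \<open>div 2\<close> so that the stride is 0 after the last level.
    The multiples of \<open>2 ^ (Suc lvl - it)\<close> are done: no row at the start, every row at
    the end.\<close>
  let ?I = "\<lambda>it \<sigma>. layer_vars t \<sigma> \<and> layer_state t \<sigma> \<and> nats \<sigma> ''s'' 0 = 2 ^ (Suc lvl - it) div 2 \<and>
    (\<forall>r. 1 \<le> r \<and> r \<le> rows t \<and> 2 ^ (Suc lvl - it) dvd r \<longrightarrow> row_ok t r \<sigma>)"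
  show ?thesis
    unfolding layer_prog_def
  proof (rule terminates_Seq_wp[OF terminates_loop[where m = "Suc lvl" and I = ?I and
      T = "\<lambda>it. 3 + 17 * n + 2 * n * (4 * lvl + 15)" and
      Q = "\<lambda>\<sigma>. layer_vars t \<sigma> \<and> V_ok (Suc t) \<sigma> \<and> (\<forall>t'<Suc t. O_ok t' \<sigma>)" and
      T' = "7 + Suc lvl * (4 + 17 * n + 2 * n * (4 * lvl + 15))"]], goal_cases)
    case 1
    have ne: "t' * W + r \<noteq> t * W" if "t' < t" "r \<le> rows t'" for t' r
    proof -
      obtain u where u: "t = Suc u" using \<open>t' < t\<close> by (cases t) auto
      have "r < W" using that by (simp add: W_def rows_def)
      then show ?thesis using row_less[of t' u r W] that u by simp
    qed
    have none: "\<not> 2 ^ Suc lvl dvd r" if "1 \<le> r" "r \<le> rows t" for r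
    proof
      assume "2 ^ Suc lvl dvd r"
      then have "2 ^ Suc lvl \<le> r" using that by (intro dvd_imp_le) auto
      then show False using that lvl(1) by (simp add: rows_def)
    qed
    have m: "t - (t div 2 + t div 2) = t mod 2"
      using div_mult_mod_eq[of t 2] by (metis mult_2_right add_diff_cancel_left')
    have "t * W + (32 * n + 32) \<le> B" using t by (intro row_fits) simp
    then have fits: "t * W \<le> B" "t \<le> B" "n \<le> B" "2 ^ lvl \<le> B" "W \<le> B" "1 \<le> B" "2 \<le> B" "t div 2 + t div 2 \<le> B" "t div 2 \<le> B"
      using t k lvl(5) linear_fits by (auto simp: W_def)
    have v: "nats \<sigma> ''t'' 0 = t" "nats \<sigma> ''n'' 0 = n" "nats \<sigma> ''W'' 0 = W" "nats \<sigma> ''T'' 0 = 2 ^ lvl"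
      using \<sigma> by (simp_all add: tables_upto_def lift_tables_def prefix_tables_def input_def)
    have "V_ok t \<sigma>" "\<And>t'. t' < t \<Longrightarrow> O_ok t' \<sigma>" using \<sigma>(2) by (simp_all add: tables_upto_def)
    then show ?case
      using v m fits none ne
      by (simp add: layer_vars_def layer_state_def V_ok_def O_ok_def rows_def)
        (use none in \<open>auto simp: rows_def\<close>)
  next
    case (2 it \<sigma>')
    have lt: "lift_tables \<sigma>'"
      using \<sigma>(1) 2 by (simp_all add: unchanged_def level_prog_def row_prog_def scan_body_def eval_prog_def
        lift_tables_def prefix_tables_def input_def jump_table_def)
    define s :: nat where "s = 2 ^ (lvl - it)"
    have s: "Suc lvl - it = Suc (lvl - it)" "Suc lvl - Suc it = lvl - it" using 2(1) by auto
    have s1: "1 \<le> s" by (simp add: s_def)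
    have "s \<le> 2 ^ lvl" unfolding s_def by (intro power_increasing) auto
    then have s4: "s \<le> 4 * n" using lvl(5) by simp
    have "terminates B level_prog \<sigma>' (3 + 17 * n + 2 * n * (4 * lvl + 15)) (\<lambda>\<sigma>. layer_state t \<sigma> \<and>
        nats \<sigma> ''s'' 0 = s div 2 \<and> (\<forall>r. 1 \<le> r \<and> r \<le> rows t \<and> s dvd r \<longrightarrow> row_ok t r \<sigma>))"
      using 2 lt t s1 s4 by (intro level_prog) (auto simp: s s_def)
    then have "terminates B level_prog \<sigma>' (3 + 17 * n + 2 * n * (4 * lvl + 15)) (?I (Suc it))"
      by (rule terminates_mono[OF terminates_unchanged])
        (use 2 in \<open>auto simp: s s_def unchanged_def level_prog_def row_prog_def scan_body_def eval_prog_def layer_vars_def\<close>)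
    moreover have "nats \<sigma>' ''s'' 0 = s" using 2 by (simp add: s s_def)
    ultimately show ?case using s1 s4 linear_fits by simp
  next
    case (3 \<sigma>')
    then show ?case using layer_complete[of t \<sigma>'] t by simp
  next
    case 4
    show ?case by simp
  next
    case (5 \<sigma>')
    then show ?case using t k linear_fits
      by (auto simp: tables_upto_def layer_vars_def V_ok_def O_ok_def)
  next
    case 6
    show ?case by simp
  qed
qed

definition layer_time :: nat where
  "layer_time = 8 + Suc lvl * (4 + 17 * n + 2 * n * (4 * lvl + 15))"

lemma table_prog:
  assumes \<sigma>: "lift_tables \<sigma>" "\<And>i. reals \<sigma> ''V'' i = 0"
  shows "terminates B table_prog \<sigma> (2 + 2 * k * Suc layer_time) (\<lambda>\<sigma>. lift_tables \<sigma> \<and> tables_upto (2 * k) \<sigma>)"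
  unfolding table_prog_def
proof (rule terminates_loop[where m = "2 * k" and I = tables_upto and T = "\<lambda>_. layer_time"], goal_cases)
  case 1
  show ?case using \<sigma> by (simp add: tables_upto_def V_ok_def)
next
  case (2 t \<sigma>')
  have lt: "lift_tables \<sigma>'"
    using \<sigma>(1) 2 by (simp_all add: unchanged_def layer_prog_def level_prog_def row_prog_def scan_body_def eval_prog_def
      lift_tables_def prefix_tables_def input_def jump_table_def)
  then have "nats \<sigma>' ''t'' 0 = t" "nats \<sigma>' ''k'' 0 = k"
    using 2 by (simp_all add: tables_upto_def lift_tables_def prefix_tables_def input_def)
  then show ?case using layer_prog[OF lt 2(2,1)] 2 k linear_fits by (simp add: layer_time_def)
next
  case (3 \<sigma>')
  have lt: "lift_tables \<sigma>'"
    using \<sigma>(1) 3 by (simp_all add: unchanged_def layer_prog_def level_prog_def row_prog_def scan_body_def eval_prog_def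
      lift_tables_def prefix_tables_def input_def jump_table_def)
  then have "nats \<sigma>' ''t'' 0 = 2 * k" "nats \<sigma>' ''k'' 0 = k"
    using 3 by (simp_all add: tables_upto_def lift_tables_def prefix_tables_def input_def)
  then show ?case using 3 lt k linear_fits by simp
next
  case 4
  show ?case by simp
qed


end

section \<open>Optimal solutions from the tables\<close>

definition main_prog :: com where
  "main_prog = prefix_prog ;; next_prog ;; lift_prog ;; table_prog ;; trace_prog"

context ram
begin

lemma trace_prog:
  assumes \<sigma>: "lift_tables \<sigma>" "tables_upto (2 * k) \<sigma>"
  shows "terminates B trace_prog \<sigma> (5 + 2 * k * 8) (solved_store N k)"
  unfolding trace_prog_def
proof (rule terminates_loop[where m = "2 * k" and T = "\<lambda>_. 6" and
    I = "\<lambda>it \<sigma>. nats \<sigma> ''t'' 0 = 2 * k - it \<and> nats \<sigma> ''e'' 0 = route k (2 * k - it) \<and>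
      reals \<sigma> ''cost'' 0 = V (2 * k) n \<and>
      (\<forall>j\<le>k. 2 * k \<le> 2 * j + it \<longrightarrow> nats \<sigma> ''boundary'' j = route k (2 * j)) \<and>
      (\<forall>j<k. 2 * k \<le> Suc (2 * j) + it \<longrightarrow> reals \<sigma> ''sink'' j = position N (route k (Suc (2 * j))))"], goal_cases)
  case 1
  have "V_ok (2 * k) \<sigma>" using \<sigma>(2) by (simp add: tables_upto_def)
  then have V: "reals \<sigma> ''V'' (2 * k * W + n) = V (2 * k) n" using k by (simp add: V_ok_def)
  have r: "route k (2 * k) = n" by (simp add: route_def)
  have "2 * k * W + (32 * n + 32) \<le> B" by (intro row_fits) simp
  then have "2 * k * W \<le> B" "2 * k * W + n \<le> B" "2 * k \<le> B" "k \<le> B" "n \<le> B" "W \<le> B"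
    using k linear_fits by (simp_all add: W_def)
  then show ?case
    using \<sigma>(1) V r k
    by (simp add: lift_tables_def prefix_tables_def input_def mult_2[symmetric])
next
  case (2 it \<sigma>')
  define s where "s = 2 * k - Suc it"
  have s: "2 * k - it = Suc s" "s < 2 * k" "s = 2 * k - Suc it" using 2(1) by (auto simp: s_def)
  define e where "e = route k (Suc s)"
  have lt: "lift_tables \<sigma>'" and O: "O_ok s \<sigma>'"
    using \<sigma> 2 s by (simp_all add: unchanged_def lift_tables_def prefix_tables_def input_def
      jump_table_def tables_upto_def O_ok_def)
  have route: "route k s + s mod 2 \<le> route k (Suc s)" if "s < 2 * k" for s
    using route_is_route[OF k] that by (simp add: is_route_def)
  have en: "e \<le> n" using route_bounds[OF k(2), of "Suc s"] s by (simp add: e_def)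
  have e: "s div 2 + s mod 2 \<le> e" using route_row[OF k(2) s(2)] by (simp add: e_def)
  \<comment> \<open>For even \<open>s\<close> the state \<open>e\<close> is a sink, hence strictly
    before the next boundary, which is at most \<open>n\<close>.\<close>
  have "e < n + s mod 2"
  proof (cases "even s")
    case True
    then have "Suc s < 2 * k" using s(2) by (cases "Suc s = 2 * k") (auto, presburger)
    moreover have "Suc s mod 2 = 1" using True by presburger
    ultimately show ?thesis
      using route[of "Suc s"] route_bounds[OF k(2), of "Suc (Suc s)"] by (simp add: e_def)
  next
    case False
    then show ?thesis using en by (simp add: odd_iff_mod_2_eq_one)
  qed
  then have r: "1 \<le> Suc e - (s mod 2 + s div 2)" "Suc e - (s mod 2 + s div 2) \<le> rows s"
    "vertex s (Suc e - (s mod 2 + s div 2)) = e - s mod 2"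
    using e by (auto simp: rows_def vertex_def)
  have O': "nats \<sigma>' ''O'' (s * W + (Suc e - (s mod 2 + s div 2))) = route k s"
    using O r unfolding O_ok_def e_def by (simp add: route_step[OF s(2)])
  have rn: "route k s \<le> n" using route_bounds[OF k(2), of s] s(2) by simp
  have Q: "reals \<sigma>' ''Q'' (route k s) / \<tau> = position N (route k s)" if "odd s"
  proof -
    have "route k s < n" using route[OF s(2)] that en by (simp add: e_def odd_iff_mod_2_eq_one)
    then show ?thesis using lt tau_pos by (simp add: lift_tables_def prefix_tables_def q_position)
  qed
  have m: "s - (s div 2 + s div 2) = s mod 2"
    using div_mult_mod_eq[of s 2] by (metis mult_2_right add_diff_cancel_left')
  have WB: "W \<le> B" using linear_fits by (simp add: W_def)
  have "s * W + (32 * n + 32) \<le> B" using s by (intro row_fits) simp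
  then have fits: "s * W \<le> B" "s * W + (Suc e - (s mod 2 + s div 2)) \<le> B" "W \<le> B" "Suc e \<le> B" "e \<le> B"
    "Suc s \<le> B" "s \<le> B" "s div 2 \<le> B" "s mod 2 + s div 2 \<le> B" "s div 2 + s div 2 \<le> B" "route k s \<le> B" "1 \<le> B" "2 \<le> B" "s mod 2 \<le> B"
    using WB en rn e s(2) k linear_fits by auto
  have v: "nats \<sigma>' ''t'' 0 = Suc s" "nats \<sigma>' ''e'' 0 = e" "nats \<sigma>' ''W'' 0 = W" "reals \<sigma>' ''tau'' 0 = \<tau>"
    using 2 lt s by (simp_all add: e_def lift_tables_def prefix_tables_def input_def)
  have old: "reals \<sigma>' ''cost'' 0 = V (2 * k) n"
    "\<And>j. j \<le> k \<Longrightarrow> Suc s \<le> 2 * j \<Longrightarrow> nats \<sigma>' ''boundary'' j = route k (2 * j)"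
    "\<And>j. j < k \<Longrightarrow> Suc s \<le> Suc (2 * j) \<Longrightarrow> reals \<sigma>' ''sink'' j = position N (route k (Suc (2 * j)))"
    using 2 s(1) by auto
  have le: "2 * k \<le> x + Suc it \<longleftrightarrow> s \<le> x" for x using s by auto
  let ?body = "assign ''t'' (NMinus (var ''t'') (NConst 1)) ;;
        assign ''j'' (NDiv (var ''t'') (NConst 2)) ;;
        assign ''p'' (NMinus (var ''t'') (NPlus (var ''j'') (var ''j''))) ;;
        assign ''e'' (NCell ''O'' (NPlus (NTimes (var ''t'') (var ''W''))
          (NMinus (inc (var ''e'')) (NPlus (var ''p'') (var ''j''))))) ;;
        Cond (NLess (NConst 0) (var ''p''))
          (RAssign ''sink'' (var ''j'') (RDiv (RCell ''Q'' (var ''e'')) (rvar ''tau'')))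
          (NAssign ''boundary'' (var ''j'') (var ''e''))"
  let ?R = "\<lambda>\<sigma>. nats \<sigma> ''t'' 0 = s \<and> nats \<sigma> ''e'' 0 = route k s \<and> reals \<sigma> ''cost'' 0 = V (2 * k) n \<and>
    nats \<sigma> ''boundary'' = (if even s then (nats \<sigma>' ''boundary'')(s div 2 := route k s) else nats \<sigma>' ''boundary'') \<and>
    reals \<sigma> ''sink'' = (if odd s then (reals \<sigma>' ''sink'')(s div 2 := position N (route k s)) else reals \<sigma>' ''sink'')"
  have body: "terminates B ?body \<sigma>' (steps ?body) ?R"
  proof (rule terminates_wp)
    show "wp B ?body ?R \<sigma>'"
    proof (cases "even s")
      case True
      then have "s mod 2 = 0" by presburger
      then show ?thesis using v fits m O' old(1) True by simp
    next
      case False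
      then have "s mod 2 = 1" by presburger
      then show ?thesis using v fits m O' Q old(1) False by simp
    qed
  qed
  show ?case
  proof (intro conjI)
    show "terminates B ?body \<sigma>' 6 (\<lambda>\<sigma>. nats \<sigma> ''t'' 0 = 2 * k - Suc it \<and> nats \<sigma> ''e'' 0 = route k (2 * k - Suc it) \<and>
      reals \<sigma> ''cost'' 0 = V (2 * k) n \<and>
      (\<forall>j\<le>k. 2 * k \<le> 2 * j + Suc it \<longrightarrow> nats \<sigma> ''boundary'' j = route k (2 * j)) \<and>
      (\<forall>j<k. 2 * k \<le> Suc (2 * j) + Suc it \<longrightarrow> reals \<sigma> ''sink'' j = position N (route k (Suc (2 * j)))))"
    proof (rule terminates_mono[OF body])
      fix \<sigma> assume R: "?R \<sigma>"
      have "nats \<sigma> ''boundary'' j = route k (2 * j)" if "j \<le> k" "s \<le> 2 * j" for j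
      proof (cases "s = 2 * j")
        case False
        then show ?thesis using R old(2)[of j] that by auto
      qed (use R in simp)
      moreover have "reals \<sigma> ''sink'' j = position N (route k (Suc (2 * j)))" if "j < k" "s \<le> Suc (2 * j)" for j
      proof (cases "s = Suc (2 * j)")
        case False
        then show ?thesis using R old(3)[of j] that by (auto elim!: oddE)
      qed (use R in simp)
      ultimately show "nats \<sigma> ''t'' 0 = 2 * k - Suc it \<and> nats \<sigma> ''e'' 0 = route k (2 * k - Suc it) \<and>
        reals \<sigma> ''cost'' 0 = V (2 * k) n \<and>
        (\<forall>j\<le>k. 2 * k \<le> 2 * j + Suc it \<longrightarrow> nats \<sigma> ''boundary'' j = route k (2 * j)) \<and>
        (\<forall>j<k. 2 * k \<le> Suc (2 * j) + Suc it \<longrightarrow> reals \<sigma> ''sink'' j = position N (route k (Suc (2 * j))))"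
        using R unfolding le s(3)[symmetric] by blast
    qed simp
  qed (use v(1) fits in simp_all)
next
  case (3 \<sigma>')
  let ?b = "nats \<sigma>' ''boundary''" and ?x = "reals \<sigma>' ''sink''"
  have "minsum_solution N k ?b ?x" "V (2 * k) n = solution_cost N k ?b ?x"
    using 3 by (auto intro!: route_optimal[OF k])
  then show ?case using 3 linear_fits by (simp add: solved_store_def)
next
  case 4
  show ?case by simp
qed



section \<open>Running time\<close>

definition total_time :: nat where
  "total_time = (40 * n + 10) + ((30 * n + 10) + ((3 + lvl * (6 * n + 8)) +
     ((2 + 2 * k * Suc layer_time) + (5 + 2 * k * 8))))"

lemma main_prog:
  assumes \<sigma>: "input \<sigma>" "\<And>a i. a \<notin> {''c'', ''tau'', ''w'', ''d''} \<Longrightarrow> reals \<sigma> a i = 0"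
  shows "terminates B main_prog \<sigma> total_time (solved_store N k)"
proof -
  let ?V = "\<lambda>\<sigma>. \<forall>i. reals \<sigma> ''V'' i = 0"
  have V: "?V \<sigma>" and P: "\<forall>i. reals \<sigma> ''P'' i = 0" using \<sigma>(2) by simp_all
  have 1: "terminates B prefix_prog \<sigma> (40 * n + 10) (\<lambda>\<sigma>'. prefix_tables \<sigma>' \<and> ?V \<sigma>' \<and> (\<forall>i. reals \<sigma>' ''P'' i = 0))"
    using \<sigma> by (intro terminates_mono[OF terminates_unchanged[OF prefix_prog]])
      (use V P in \<open>simp_all add: unchanged_def prefix_prog_def prefix_body_def\<close>)
  have 2: "terminates B next_prog \<sigma>' (30 * n + 10) (\<lambda>\<sigma>'. prefix_tables \<sigma>' \<and> next_tables 0 \<sigma>' \<and> ?V \<sigma>')"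
    if "prefix_tables \<sigma>' \<and> ?V \<sigma>' \<and> (\<forall>i. reals \<sigma>' ''P'' i = 0)" for \<sigma>'
    by (rule terminates_mono[OF terminates_unchanged[OF next_prog]])
      (use that in \<open>simp_all add: unchanged_def next_prog_def next_body_def\<close>)
  have 3: "terminates B lift_prog \<sigma>' (3 + lvl * (6 * n + 8)) (\<lambda>\<sigma>'. lift_tables \<sigma>' \<and> ?V \<sigma>')"
    if "prefix_tables \<sigma>' \<and> next_tables 0 \<sigma>' \<and> ?V \<sigma>'" for \<sigma>'
    by (rule terminates_mono[OF terminates_unchanged[OF lift_prog]])
      (use that in \<open>simp_all add: unchanged_def lift_prog_def lift_body_def\<close>)
  have 4: "terminates B table_prog \<sigma>' (2 + 2 * k * Suc layer_time) (\<lambda>\<sigma>. lift_tables \<sigma> \<and> tables_upto (2 * k) \<sigma>)"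
    if "lift_tables \<sigma>' \<and> ?V \<sigma>'" for \<sigma>'
    using that by (intro table_prog) simp_all
  show ?thesis
    unfolding main_prog_def total_time_def
    by (rule terminates_Seq[OF 1 terminates_Seq[OF 2 terminates_Seq[OF 3 terminates_Seq[OF 4 trace_prog]]]])
      auto
qed

text \<open>Expanded, the time is a combination of nine monomials (the constant included), each at
  most \<open>X\<close>, with coefficients of sum 384.\<close>

lemma total_time_le: "total_time \<le> 400 * (k * n * (Suc lvl * Suc lvl))"
proof -
  define X where "X = k * n * (Suc lvl * Suc lvl)"
  have le: "a * b * (x * y) \<le> X" if "a \<le> k" "b \<le> n" "x \<le> Suc lvl" "y \<le> Suc lvl" for a b x y
    unfolding X_def using that by (intro mult_le_mono)
  have pos: "1 \<le> k" "1 \<le> n" "1 \<le> Suc lvl" "lvl \<le> Suc lvl" using k n_pos by simp_all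
  note bounds =
    le[OF pos(1) pos(2) pos(3) pos(3), unfolded mult_1_left mult_1_right]
    le[OF pos(1) order_refl pos(3) pos(3), unfolded mult_1_left mult_1_right]
    le[OF order_refl pos(2) pos(3) pos(3), unfolded mult_1_left mult_1_right]
    le[OF pos(1) pos(2) pos(3) pos(4), unfolded mult_1_left mult_1_right]
    le[OF pos(1) order_refl pos(3) pos(4), unfolded mult_1_left mult_1_right]
    le[OF order_refl order_refl pos(3) pos(3), unfolded mult_1_left mult_1_right]
    le[OF order_refl pos(2) pos(3) pos(4), unfolded mult_1_left mult_1_right]
    le[OF order_refl order_refl pos(3) pos(4), unfolded mult_1_left mult_1_right]
    le[OF order_refl order_refl pos(4) pos(4), unfolded mult_1_left mult_1_right]
  have "total_time = 70 * n + 30 + 6 * (n * lvl) + 8 * lvl + 42 * k + 2 * (4 * (k * lvl) + 47 * (k * n) +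
      47 * (k * n * lvl) + 8 * (k * n * lvl) + 8 * (k * n * (lvl * lvl)))"
    unfolding total_time_def layer_time_def by (simp add: algebra_simps)
  moreover have "70 * a + 30 + 6 * b + 8 * d + 42 * e + 2 * (4 * f + 47 * g + 47 * h + 8 * h + 8 * i) \<le> 400 * X"
    if "1 \<le> X" "a \<le> X" "e \<le> X" "d \<le> X" "b \<le> X" "g \<le> X" "f \<le> X" "h \<le> X" "i \<le> X"
    for a b d e f g h i :: nat
    using that by simp
  ultimately show ?thesis unfolding X_def[symmetric] by (simp only: bounds)
qed

text \<open>Minimality of \<open>lvl\<close> gives \<open>2 ^ (lvl - 1) \<le> 2 * n\<close>, so
  \<open>Suc lvl\<close> is at most \<open>3 + log 2 n\<close>, and \<open>log 2 n\<close> is at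
  least 1.\<close>

lemma lvl_log: "2 \<le> n \<Longrightarrow> real (Suc lvl) \<le> 4 * log 2 (real n)"
proof -
  assume n: "2 \<le> n"
  obtain l where l: "lvl = Suc l" using lvl(3) by (cases lvl) auto
  have "real (2 ^ l) \<le> real (2 * n)" using lvl(2)[of l] l by (simp only: of_nat_le_iff)
  then have "real l \<le> log 2 (2 * real n)" using n by (subst le_log_iff) (simp_all add: powr_realpow)
  also have "\<dots> = 1 + log 2 (real n)" using n by (simp add: log_mult)
  finally have "real l \<le> 1 + log 2 (real n)" .
  moreover have "1 \<le> log 2 (real n)" using n by (subst le_log_iff) simp_all
  ultimately show ?thesis using l by simp
qed

lemma total_time_log: "2 \<le> n \<Longrightarrow> real total_time \<le> 6400 * (real k * real n * log 2 (real n) ^ 3)"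
proof -
  assume n: "2 \<le> n"
  let ?l = "log 2 (real n)"
  have l1: "1 \<le> ?l" using n by (subst le_log_iff) simp_all
  have "real total_time \<le> real (400 * (k * n * (Suc lvl * Suc lvl)))"
    unfolding of_nat_le_iff by (rule total_time_le)
  also have "\<dots> = 400 * (real k * real n * (real (Suc lvl) * real (Suc lvl)))"
    by (simp only: of_nat_mult of_nat_numeral)
  also have "\<dots> \<le> 400 * (real k * real n * ((4 * ?l) * (4 * ?l)))"
    using lvl_log[OF n] l1 by (intro mult_left_mono mult_mono) auto
  also have "\<dots> = 6400 * (real k * real n * (?l ^ 2 * 1))" by (simp add: power2_eq_square)
  \<comment> \<open>The program needs only two logarithms; the third is added here.\<close>
  also have "\<dots> \<le> 6400 * (real k * real n * (?l ^ 2 * ?l))"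
    using l1 by (intro mult_left_mono) auto
  also have "?l ^ 2 * ?l = ?l ^ 3" by (simp add: power2_eq_square power3_eq_cube)
  finally show ?thesis .
qed

end

theorem theorem3:
  shows "\<exists>p. solves_minsum_in_time p (\<lambda>k n. real k * real n * log 2 (real n) ^ 3)"
proof
  show "solves_minsum_in_time main_prog (\<lambda>k n. real k * real n * log 2 (real n) ^ 3)"
    unfolding solves_minsum_in_time_def
  \<comment> \<open>The exponent 8 is 2 + 6: the locale asks for
    \<open>64 * (n + 1) * (n + 1)\<close>, and 64 is \<open>2 ^ 6\<close>, at most
    \<open>(n + 1) ^ 6\<close> for nonempty paths. The constant 6400 is
    \<open>400 * 4 * 4\<close>.\<close>
  proof (rule exI[of _ 8], rule exI[of _ 6400], intro allI impI)
    fix N k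
    assume N: "path_network N" and k: "1 \<le> k" "k \<le> num_vertices N"
    let ?n = "num_vertices N" and ?B = "(num_vertices N + 1) ^ 8"
    have "1 \<le> ?n" using k by simp
    then have "2 ^ 6 * ((?n + 1) * (?n + 1)) \<le> (?n + 1) ^ 6 * ((?n + 1) * (?n + 1))"
      by (intro mult_le_mono1 power_mono) auto
    also have "\<dots> = ?B" by (simp only: power_add[symmetric] power2_eq_square[symmetric]) simp
    finally interpret ram N k ?B using N k by unfold_locales (simp_all add: algebra_simps)
    have "input (input_store N k)"
      unfolding input_def using k by (auto simp: input_store_def gap_def)
    then have "terminates ?B main_prog (input_store N k) total_time (solved_store N k)"
      by (rule main_prog) (auto simp: input_store_def)
    then obtain t \<sigma> where r: "runs ?B main_prog (input_store N k) t \<sigma>" "t \<le> total_time" "solved_store N k \<sigma>"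
      by (auto simp: terminates_def)
    moreover have "real t \<le> 6400 * (real k * real ?n * log 2 (real ?n) ^ 3)" if "2 \<le> ?n"
      using total_time_log[OF that] r(2) by linarith
    ultimately show "\<exists>t \<sigma>. runs ?B main_prog (input_store N k) t \<sigma> \<and> solved_store N k \<sigma> \<and>
        (2 \<le> ?n \<longrightarrow> real t \<le> 6400 * (real k * real ?n * log 2 (real ?n) ^ 3))"
      by blast
  qed
qed

end
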